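(* Suppose $n\geqslant 9$ or $n=7$. Let $\rho:WB_n\to GL_n(\mathbb{C})$ be an $n$-dimensional representation of the welded braid group $WB_n$ such that its restriction $\rho|_{B_n}$ to the braid group $B_n$ is irreducible. Then there exists a unique quadruple $(y,k,z,\lambda)$, where $y,z,\lambda\in\mathbb{C}^*$, $z\neq 1$ and $k\in\{-1,1\}$, such that $\rho$ is equivalent to $X_n(y,k)\otimes\widetilde{\tau}_n(z,\lambda)$.
   Context: The welded braid group $WB_n$ is the group generated by $\alpha_1,\dots,\alpha_{n-1},\sigma_1,\dots,\sigma_{n-1}$ with defining relations: $\alpha_i^2=1$ ($1\leqslant i\leqslant n-1$); $\alpha_i\alpha_j=\alpha_j\alpha_i$, $\sigma_i\sigma_j=\sigma_j\sigma_i$, $\alpha_i\sigma_j=\sigma_j\alpha_i$ for $|i-j|\geqslant 2$; and, for $1\leqslant i\leqslant n-2$, $\alpha_i\alpha_{i+1}\alpha_i=\alpha_{i+1}\alpha_i\alpha_{i+1}$, $\sigma_i\sigma_{i+1}\sigma_i=\sigma_{i+1}\sigma_i\sigma_{i+1}$, $\alpha_i\alpha_{i+1}\sigma_i=\sigma_{i+1}\alpha_i\alpha_{i+1}$, $\sigma_i\sigma_{i+1}\alpha_i=\alpha_{i+1}\sigma_i\sigma_{i+1}$. The subgroup generated by the $\sigma_i$ is isomorphic to the braid group on $n$ strings and is denoted $B_n$. Matrices act on column vectors. For $y\in\mathbb{C}^*$, $k\in\{-1,1\}$, $X_n(y,k):WB_n\to\mathbb{C}^*$ is the one-dimensional representation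 $\sigma_i\mapsto y$, $\alpha_i\mapsto k$ for all $i$. For $z,\lambda\in\mathbb{C}^*$, $\widetilde{\tau}_n(z,\lambda):WB_n\to GL_n(\mathbb{C})$ is the representation (with $I_m$ the $m\times m$ identity and $\oplus$ block-diagonal sum) $$\widetilde{\tau}_n(z,\lambda)(\sigma_i)=I_{i-1}\oplus\begin{pmatrix}0&z\\1&0\end{pmatrix}\oplus I_{n-1-i},\qquad \widetilde{\tau}_n(z,\lambda)(\alpha_i)=I_{i-1}\oplus\begin{pmatrix}0&\frac1\lambda\\ \lambda&0\end{pmatrix}\oplus I_{n-1-i},\qquad 1\leqslant i\leqslant n-1.$$ *)

theory Defs
  imports "Jordan_Normal_Form.VS_Connect" "HOL-Algebra.Generated_Groups"
begin

section \<open>Groups given by generators and relations\<close>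

text \<open>A letter \<open>(s, True)\<close> stands for the generator \<open>s\<close> and \<open>(s, False)\<close> for its formal
  inverse. A relation \<open>l = r\<close> is a pair \<open>(l, r)\<close> of words.\<close>

type_synonym 'g word = "('g \<times> bool) list"

definition words :: "'g set \<Rightarrow> 'g word set" where
  "words S = lists (S \<times> UNIV)"

inductive_set word_cong :: "'g set \<Rightarrow> ('g word \<times> 'g word) set \<Rightarrow> ('g word \<times> 'g word) set"
  for S :: "'g set" and R :: "('g word \<times> 'g word) set" where
  refl: "w \<in> words S \<Longrightarrow> (w, w) \<in> word_cong S R"
| sym: "(u, v) \<in> word_cong S R \<Longrightarrow> (v, u) \<in> word_cong S R"
| trans: "(u, v) \<in> word_cong S R \<Longrightarrow> (v, w) \<in> word_cong S R \<Longrightarrow> (u, w) \<in> word_cong S R"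
| cancel: "u \<in> words S \<Longrightarrow> v \<in> words S \<Longrightarrow> s \<in> S \<Longrightarrow>
    (u @ [(s, b), (s, \<not> b)] @ v, u @ v) \<in> word_cong S R"
| rel: "u \<in> words S \<Longrightarrow> v \<in> words S \<Longrightarrow> (l, r) \<in> R \<Longrightarrow> l \<in> words S \<Longrightarrow> r \<in> words S \<Longrightarrow>
    (u @ l @ v, u @ r @ v) \<in> word_cong S R"

definition presented_group :: "'g set \<Rightarrow> ('g word \<times> 'g word) set \<Rightarrow> 'g word set monoid" where
  "presented_group S R =
     \<lparr>carrier = words S // word_cong S R,
      monoid.mult = (\<lambda>A B. \<Union>a\<in>A. \<Union>b\<in>B. word_cong S R `` {a @ b}),
      one = word_cong S R `` {[]}\<rparr>"

definition word_class :: "'g set \<Rightarrow> ('g word \<times> 'g word) set \<Rightarrow> 'g word \<Rightarrow> 'g word set" where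
  "word_class S R w = word_cong S R `` {w}"

definition word_eval :: "('a, 'b) monoid_scheme \<Rightarrow> ('g \<Rightarrow> 'a) \<Rightarrow> 'g word \<Rightarrow> 'a" where
  "word_eval G f w =
     foldr (\<lambda>(s, b) x. (if b then f s else inv\<^bsub>G\<^esub> (f s)) \<otimes>\<^bsub>G\<^esub> x) w \<one>\<^bsub>G\<^esub>"

text \<open>The homomorphism out of a presented group with prescribed values on the generators. It is
  meaningful if the values satisfy the defining relations, so that evaluation is constant on each
  class of words; see \<open>induced_hom_in_hom\<close> below.\<close>

definition induced_hom :: "('a, 'b) monoid_scheme \<Rightarrow> ('g \<Rightarrow> 'a) \<Rightarrow> 'g word set \<Rightarrow> 'a" where
  "induced_hom G f C = the_elem (word_eval G f ` C)"

lemma words_simps [simp]: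
  "[] \<in> words S" "x # w \<in> words S \<longleftrightarrow> fst x \<in> S \<and> w \<in> words S"
  "u @ v \<in> words S \<longleftrightarrow> u \<in> words S \<and> v \<in> words S"
  by (cases x; auto simp: words_def)+

lemma word_cong_words:
  "(u, v) \<in> word_cong S R \<Longrightarrow> u \<in> words S \<and> v \<in> words S"
  by (induction rule: word_cong.induct) auto

lemma equiv_word_cong: "equiv (words S) (word_cong S R)"
  by (rule equivI)
     (auto intro!: refl_onI symI transI intro: word_cong.intros dest: word_cong_words)

lemma word_cong_context:
  assumes "(u, v) \<in> word_cong S R" "a \<in> words S" "c \<in> words S"
  shows "(a @ u @ c, a @ v @ c) \<in> word_cong S R"
  using assms
proof (induction rule: word_cong.induct)
  case (refl w)
  then show ?case by (auto intro!: word_cong.refl)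
next
  case (cancel u v s b)
  then show ?case using word_cong.cancel[of "a @ u" S "v @ c" s b R] by simp
next
  case (rel u v l r)
  then show ?case using word_cong.rel[of "a @ u" S "v @ c" l r R] by simp
qed (auto intro: word_cong.sym word_cong.trans)

lemma word_cong_append:
  assumes "(u, u') \<in> word_cong S R" "(v, v') \<in> word_cong S R"
  shows "(u @ v, u' @ v') \<in> word_cong S R"
proof -
  note w = word_cong_words[OF assms(1)] word_cong_words[OF assms(2)]
  have "(u @ v, u' @ v) \<in> word_cong S R"
    using word_cong_context[OF assms(1), of "[]" v] w by simp
  moreover have "(u' @ v, u' @ v') \<in> word_cong S R"
    using word_cong_context[OF assms(2), of u' "[]"] w by simp
  ultimately show ?thesis by (rule word_cong.trans)
qed

lemma word_class_eq:
  "(u, v) \<in> word_cong S R \<Longrightarrow> word_class S R u = word_class S R v"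
  unfolding word_class_def by (rule equiv_class_eq[OF equiv_word_cong])

lemma mem_word_class: "v \<in> word_class S R u \<longleftrightarrow> (u, v) \<in> word_cong S R"
  by (simp add: word_class_def)

lemma presented_group_carrier: "carrier (presented_group S R) = word_class S R ` words S"
  by (auto simp: presented_group_def word_class_def quotient_def)

lemma presented_group_one: "\<one>\<^bsub>presented_group S R\<^esub> = word_class S R []"
  by (simp add: presented_group_def word_class_def)

lemma presented_group_mult:
  assumes "u \<in> words S" "v \<in> words S"
  shows "word_class S R u \<otimes>\<^bsub>presented_group S R\<^esub> word_class S R v = word_class S R (u @ v)"
proof -
  have m: "A \<otimes>\<^bsub>presented_group S R\<^esub> B = (\<Union>a\<in>A. \<Union>b\<in>B. word_class S R (a @ b))" for A B
    by (simp add: presented_group_def word_class_def)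
  have "word_class S R (a @ b) = word_class S R (u @ v)"
    if "a \<in> word_class S R u" "b \<in> word_class S R v" for a b
    using that unfolding mem_word_class by (metis word_class_eq word_cong_append)
  then have "word_class S R u \<otimes>\<^bsub>presented_group S R\<^esub> word_class S R v =
      (\<Union>a\<in>word_class S R u. \<Union>b\<in>word_class S R v. word_class S R (u @ v))"
    unfolding m by (intro SUP_cong HOL.refl)
  moreover have "u \<in> word_class S R u" "v \<in> word_class S R v"
    unfolding mem_word_class using assms by (auto intro: word_cong.refl)
  then have "word_class S R u \<noteq> {}" "word_class S R v \<noteq> {}" by blast+
  ultimately show ?thesis by (simp only: UN_constant if_False)
qed

lemma word_cong_inverse:
  "w \<in> words S \<Longrightarrow> (rev (map (\<lambda>(s, b). (s, \<not> b)) w) @ w, []) \<in> word_cong S R"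
proof (induction w)
  case Nil
  then show ?case by (auto intro: word_cong.refl)
next
  case (Cons x w)
  obtain s b where x: "x = (s, b)" by (cases x)
  let ?v = "rev (map (\<lambda>(s, b). (s, \<not> b)) w)"
  have v: "?v \<in> words S"
    using word_cong_words[OF Cons.IH] Cons.prems by simp
  have "(?v @ [(s, \<not> b), (s, \<not> \<not> b)] @ w, ?v @ w) \<in> word_cong S R"
    using Cons.prems v x by (intro word_cong.cancel) auto
  with Cons show ?case by (auto simp: x intro: word_cong.trans)
qed

lemma group_presented_group: "group (presented_group S R)"
proof (rule groupI)
  fix x assume "x \<in> carrier (presented_group S R)"
  then obtain w where w: "w \<in> words S" "x = word_class S R w"
    by (auto simp: presented_group_carrier)
  let ?v = "rev (map (\<lambda>(s, b). (s, \<not> b)) w)"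
  have c: "(?v @ w, []) \<in> word_cong S R" by (rule word_cong_inverse[OF w(1)])
  then have v: "?v \<in> words S" using word_cong_words[OF c] by simp
  then have "word_class S R ?v \<otimes>\<^bsub>presented_group S R\<^esub> x = \<one>\<^bsub>presented_group S R\<^esub>"
    by (simp only: w presented_group_mult presented_group_one word_class_eq[OF c])
  with v show "\<exists>y\<in>carrier (presented_group S R).
      y \<otimes>\<^bsub>presented_group S R\<^esub> x = \<one>\<^bsub>presented_group S R\<^esub>"
    unfolding presented_group_carrier by blast
next
  fix x y z
  assume "x \<in> carrier (presented_group S R)" "y \<in> carrier (presented_group S R)"
    "z \<in> carrier (presented_group S R)"
  then obtain u v w where w: "u \<in> words S" "v \<in> words S" "w \<in> words S"
    and x: "x = word_class S R u" "y = word_class S R v" "z = word_class S R w"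
    unfolding presented_group_carrier by blast
  from w show "x \<otimes>\<^bsub>presented_group S R\<^esub> y \<otimes>\<^bsub>presented_group S R\<^esub> z =
      x \<otimes>\<^bsub>presented_group S R\<^esub> (y \<otimes>\<^bsub>presented_group S R\<^esub> z)"
    unfolding x by (simp add: presented_group_mult)
next
  fix x y
  assume "x \<in> carrier (presented_group S R)" "y \<in> carrier (presented_group S R)"
  then obtain u v where w: "u \<in> words S" "v \<in> words S"
    and x: "x = word_class S R u" "y = word_class S R v"
    unfolding presented_group_carrier by blast
  from w show "x \<otimes>\<^bsub>presented_group S R\<^esub> y \<in> carrier (presented_group S R)"
    unfolding x presented_group_carrier by (simp add: presented_group_mult)
next
  fix x
  assume "x \<in> carrier (presented_group S R)"
  then obtain u where w: "u \<in> words S" and x: "x = word_class S R u"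
    unfolding presented_group_carrier by blast
  from w show "\<one>\<^bsub>presented_group S R\<^esub> \<otimes>\<^bsub>presented_group S R\<^esub> x = x"
    unfolding x presented_group_one by (simp add: presented_group_mult)
next
  show "\<one>\<^bsub>presented_group S R\<^esub> \<in> carrier (presented_group S R)"
    unfolding presented_group_carrier presented_group_one by (intro imageI words_simps(1))
qed

lemma word_eval_simps [simp]:
  "word_eval G f [] = \<one>\<^bsub>G\<^esub>"
  "word_eval G f ((s, b) # w) = (if b then f s else inv\<^bsub>G\<^esub> (f s)) \<otimes>\<^bsub>G\<^esub> word_eval G f w"
  by (simp_all add: word_eval_def)

context
  fixes G :: "('a, 'b) monoid_scheme" (structure)
    and S :: "'g set" and R :: "('g word \<times> 'g word) set" and f :: "'g \<Rightarrow> 'a"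
  assumes G: "group G" and f: "f \<in> S \<rightarrow> carrier G"
    and rels: "\<And>l r. (l, r) \<in> R \<Longrightarrow> word_eval G f l = word_eval G f r"
begin

interpretation group G by (rule G)

lemma word_eval_closed: "w \<in> words S \<Longrightarrow> word_eval G f w \<in> carrier G"
  using f by (induction w) (auto simp: Pi_iff)

lemma word_eval_append:
  "u \<in> words S \<Longrightarrow> v \<in> words S \<Longrightarrow> word_eval G f (u @ v) = word_eval G f u \<otimes> word_eval G f v"
proof (induction u)
  case (Cons x u)
  obtain s b where x: "x = (s, b)" by (cases x)
  have "f s \<in> carrier G" using Cons.prems f by (auto simp: x)
  with Cons show ?case by (auto simp: x word_eval_closed m_assoc)
qed (simp add: word_eval_closed)

lemma word_eval_cong:
  "(u, v) \<in> word_cong S R \<Longrightarrow> word_eval G f u = word_eval G f v"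
proof (induction rule: word_cong.induct)
  case (cancel u v s b)
  have [simp]: "f s \<in> carrier G" using cancel f by auto
  have "word_eval G f ([(s, b), (s, \<not> b)] @ v) = word_eval G f v"
    using cancel by (cases b) (auto simp: word_eval_closed m_assoc[symmetric])
  with cancel show ?case
    by (subst (1 2) word_eval_append) auto
next
  case (rel u v l r)
  then show ?case by (simp add: word_eval_append rels[OF rel(3)])
qed auto

lemma induced_hom_word_class:
  assumes "w \<in> words S"
  shows "induced_hom G f (word_class S R w) = word_eval G f w"
proof -
  have "w \<in> word_class S R w" using assms by (auto simp: mem_word_class intro: word_cong.refl)
  moreover have "word_eval G f v = word_eval G f w" if "v \<in> word_class S R w" for v
    using word_eval_cong[of w v] that by (simp add: mem_word_class)
  ultimately have "word_eval G f ` word_class S R w = {word_eval G f w}"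
    by blast
  then show ?thesis by (simp add: induced_hom_def)
qed

lemma induced_hom_in_hom: "induced_hom G f \<in> hom (presented_group S R) G"
  unfolding presented_group_carrier hom_def
  by (auto simp: presented_group_mult induced_hom_word_class word_eval_closed word_eval_append)

lemma induced_hom_generator:
  assumes "s \<in> S"
  shows "induced_hom G f (word_class S R [(s, True)]) = f s"
  using assms f by (simp add: induced_hom_word_class Pi_iff)

end


section \<open>The welded braid group\<close>

datatype wb_gen = Alpha_gen nat | Sigma_gen nat

definition wb_gens :: "nat \<Rightarrow> wb_gen set" where
  "wb_gens n = Alpha_gen ` {1..n-1} \<union> Sigma_gen ` {1..n-1}"

definition wb_rels :: "nat \<Rightarrow> (wb_gen word \<times> wb_gen word) set" where
  "wb_rels n =
    (let \<alpha> = (\<lambda>i. (Alpha_gen i, True)); \<sigma> = (\<lambda>i. (Sigma_gen i, True));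
         far = {(i, j). i \<in> {1..n-1} \<and> j \<in> {1..n-1} \<and> \<bar>int i - int j\<bar> \<ge> 2}
     in {([\<alpha> i, \<alpha> i], []) | i. i \<in> {1..n-1}}
      \<union> {([\<alpha> i, \<alpha> j], [\<alpha> j, \<alpha> i]) | i j. (i, j) \<in> far}
      \<union> {([\<sigma> i, \<sigma> j], [\<sigma> j, \<sigma> i]) | i j. (i, j) \<in> far}
      \<union> {([\<alpha> i, \<sigma> j], [\<sigma> j, \<alpha> i]) | i j. (i, j) \<in> far}
      \<union> {([\<alpha> i, \<alpha> (i+1), \<alpha> i], [\<alpha> (i+1), \<alpha> i, \<alpha> (i+1)]) | i. i \<in> {1..n-2}}
      \<union> {([\<sigma> i, \<sigma> (i+1), \<sigma> i], [\<sigma> (i+1), \<sigma> i, \<sigma> (i+1)]) | i. i \<in> {1..n-2}}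
      \<union> {([\<alpha> i, \<alpha> (i+1), \<sigma> i], [\<sigma> (i+1), \<alpha> i, \<alpha> (i+1)]) | i. i \<in> {1..n-2}}
      \<union> {([\<sigma> i, \<sigma> (i+1), \<alpha> i], [\<alpha> (i+1), \<sigma> i, \<sigma> (i+1)]) | i. i \<in> {1..n-2}})"

definition WB :: "nat \<Rightarrow> wb_gen word set monoid" where
  "WB n = presented_group (wb_gens n) (wb_rels n)"

definition wb_alpha :: "nat \<Rightarrow> nat \<Rightarrow> wb_gen word set" where
  "wb_alpha n i = word_class (wb_gens n) (wb_rels n) [(Alpha_gen i, True)]"

definition wb_sigma :: "nat \<Rightarrow> nat \<Rightarrow> wb_gen word set" where
  "wb_sigma n i = word_class (wb_gens n) (wb_rels n) [(Sigma_gen i, True)]"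

definition braid_subgroup :: "nat \<Rightarrow> wb_gen word set set" where
  "braid_subgroup n = generate (WB n) (wb_sigma n ` {1..n-1})"

lemma group_WB: "group (WB n)"
  by (simp add: WB_def group_presented_group)

lemma subgroup_braid_subgroup: "subgroup (braid_subgroup n) (WB n)"
  unfolding braid_subgroup_def
  by (rule group.generate_is_subgroup[OF group_WB])
     (auto simp: WB_def wb_sigma_def presented_group_carrier wb_gens_def)


section \<open>Matrix representations\<close>

definition GL :: "nat \<Rightarrow> complex mat monoid" where
  "GL n = units_of (ring_mat TYPE(complex) n ())"

definition complex_units :: "complex monoid" where
  "complex_units = units_of (class_ring :: complex ring)"

definition irreducible_rep :: "('g, 'm) monoid_scheme \<Rightarrow> nat \<Rightarrow> ('g \<Rightarrow> complex mat) \<Rightarrow> bool" where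
  "irreducible_rep G n \<rho> \<longleftrightarrow>
     n > 0 \<and>
     (\<forall>W. subspace class_ring W (module_vec TYPE(complex) n) \<longrightarrow>
        (\<forall>g\<in>carrier G. \<forall>w\<in>W. \<rho> g *\<^sub>v w \<in> W) \<longrightarrow> W = {0\<^sub>v n} \<or> W = carrier_vec n)"

definition equivalent_reps ::
    "('g, 'm) monoid_scheme \<Rightarrow> nat \<Rightarrow> ('g \<Rightarrow> complex mat) \<Rightarrow> ('g \<Rightarrow> complex mat) \<Rightarrow> bool" where
  "equivalent_reps G n \<rho> \<rho>' \<longleftrightarrow>
     (\<exists>P\<in>carrier (GL n). \<forall>g\<in>carrier G. \<rho>' g = P * \<rho> g * inv\<^bsub>GL n\<^esub> P)"

text \<open>The tensor product of a one-dimensional representation, regarded as a character, with a matrix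
  representation, in the basis \<open>1 \<otimes> e\<^sub>1, \<dots>, 1 \<otimes> e\<^sub>n\<close> of \<open>\<complex> \<otimes> \<complex>\<^sup>n\<close>.\<close>

definition tensor_char :: "('g \<Rightarrow> complex) \<Rightarrow> ('g \<Rightarrow> complex mat) \<Rightarrow> 'g \<Rightarrow> complex mat" where
  "tensor_char \<chi> \<rho> g = \<chi> g \<cdot>\<^sub>m \<rho> g"

fun X_gen :: "complex \<Rightarrow> complex \<Rightarrow> wb_gen \<Rightarrow> complex" where
  "X_gen y k (Sigma_gen i) = y"
| "X_gen y k (Alpha_gen i) = k"

definition X_rep :: "complex \<Rightarrow> complex \<Rightarrow> wb_gen word set \<Rightarrow> complex" where
  "X_rep y k = induced_hom complex_units (X_gen y k)"

fun tau_gen :: "nat \<Rightarrow> complex \<Rightarrow> complex \<Rightarrow> wb_gen \<Rightarrow> complex mat" where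
  "tau_gen n z l (Sigma_gen i) =
     diag_block_mat [1\<^sub>m (i - 1), mat_of_rows_list 2 [[0, z], [1, 0]], 1\<^sub>m (n - 1 - i)]"
| "tau_gen n z l (Alpha_gen i) =
     diag_block_mat [1\<^sub>m (i - 1), mat_of_rows_list 2 [[0, 1 / l], [l, 0]], 1\<^sub>m (n - 1 - i)]"

definition tau_rep :: "nat \<Rightarrow> complex \<Rightarrow> complex \<Rightarrow> wb_gen word set \<Rightarrow> complex mat" where
  "tau_rep n z l = induced_hom (GL n) (tau_gen n z l)"

subsection \<open>Well-definedness of the two families of representations\<close>

lemma group_GL: "group (GL n)"
proof -
  interpret semiring "ring_mat TYPE(complex) n ()" by (rule semiring_mat)
  show ?thesis unfolding GL_def by (rule units_group)
qed

lemma group_complex_units: "group complex_units"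
  unfolding complex_units_def by (rule monoid.units_group[OF ring.is_monoid[OF class_ring.ring_axioms]])

lemma GL_simps [simp]: "\<one>\<^bsub>GL n\<^esub> = 1\<^sub>m n" "A \<otimes>\<^bsub>GL n\<^esub> B = A * B"
  by (simp_all add: GL_def units_of_def ring_mat_def)

lemma GL_carrierI:
  "A \<in> carrier_mat n n \<Longrightarrow> B \<in> carrier_mat n n \<Longrightarrow> A * B = 1\<^sub>m n \<Longrightarrow> B * A = 1\<^sub>m n \<Longrightarrow>
   A \<in> carrier (GL n)"
  by (auto simp: GL_def units_of_def ring_mat_def Units_def)

lemma complex_units_simps [simp]:
  "carrier complex_units = - {0}" "x \<otimes>\<^bsub>complex_units\<^esub> y = x * y" "\<one>\<^bsub>complex_units\<^esub> = 1"
proof -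
  have "\<exists>u. u * x = 1 \<and> x * u = 1" if "x \<noteq> 0" for x :: complex
    using that by (intro exI[of _ "inverse x"]) simp
  then show "carrier complex_units = - {0}"
    by (auto simp: complex_units_def units_of_def Units_def)
qed (simp_all add: complex_units_def units_of_def)

lemma X_rep:
  assumes "y \<noteq> 0" "k \<in> {-1, 1}"
  shows "X_rep y k \<in> hom (WB n) complex_units"
    and "i \<in> {1..n-1} \<Longrightarrow> X_rep y k (wb_sigma n i) = y"
    and "i \<in> {1..n-1} \<Longrightarrow> X_rep y k (wb_alpha n i) = k"
proof -
  have f: "X_gen y k \<in> wb_gens n \<rightarrow> carrier complex_units"
    using assms by (auto simp: wb_gens_def)
  have rels: "word_eval complex_units (X_gen y k) l = word_eval complex_units (X_gen y k) r"
    if "(l, r) \<in> wb_rels n" for l r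
    using that assms by (auto simp: wb_rels_def Let_def)
  note H = induced_hom_in_hom[OF group_complex_units f rels]
    induced_hom_generator[OF group_complex_units f rels]
  show "X_rep y k \<in> hom (WB n) complex_units" unfolding X_rep_def WB_def by (rule H(1))
  show "X_rep y k (wb_sigma n i) = y" if "i \<in> {1..n-1}"
    unfolding X_rep_def wb_sigma_def using that by (subst H(2)) (auto simp: wb_gens_def)
  show "X_rep y k (wb_alpha n i) = k" if "i \<in> {1..n-1}"
    unfolding X_rep_def wb_alpha_def using that by (subst H(2)) (auto simp: wb_gens_def)
qed

definition monomial_mat :: "nat \<Rightarrow> (nat \<Rightarrow> nat) \<Rightarrow> (nat \<Rightarrow> complex) \<Rightarrow> complex mat" where
  "monomial_mat n p d = mat n n (\<lambda>(r, c). if r = p c then d c else 0)"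

lemma monomial_mat_carrier [simp]: "monomial_mat n p d \<in> carrier_mat n n"
  by (simp add: monomial_mat_def)

lemma monomial_mat_mult:
  assumes "\<And>c. c < n \<Longrightarrow> q c < n"
  shows "monomial_mat n p d * monomial_mat n q e = monomial_mat n (\<lambda>c. p (q c)) (\<lambda>c. d (q c) * e c)"
proof (rule eq_matI)
  fix r c assume "r < dim_row (monomial_mat n (\<lambda>c. p (q c)) (\<lambda>c. d (q c) * e c))"
    "c < dim_col (monomial_mat n (\<lambda>c. p (q c)) (\<lambda>c. d (q c) * e c))"
  then have rc: "r < n" "c < n" by (auto simp: monomial_mat_def)
  have "(monomial_mat n p d * monomial_mat n q e) $$ (r, c) =
      (\<Sum>m = 0..<n. (if r = p m then d m else 0) * (if m = q c then e c else 0))"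
    using rc by (simp add: monomial_mat_def times_mat_def scalar_prod_def)
  also have "\<dots> = (\<Sum>m = 0..<n. if m = q c then (if r = p m then d m else 0) * e c else 0)"
    by (intro sum.cong) auto
  also have "\<dots> = (if r = p (q c) then d (q c) else 0) * e c"
    using assms[OF rc(2)] by simp
  finally show "(monomial_mat n p d * monomial_mat n q e) $$ (r, c) =
      monomial_mat n (\<lambda>c. p (q c)) (\<lambda>c. d (q c) * e c) $$ (r, c)"
    using rc by (simp add: monomial_mat_def)
qed (auto simp: monomial_mat_def)

lemma monomial_mat_cong:
  "(\<And>c. c < n \<Longrightarrow> p c = q c \<and> d c = e c) \<Longrightarrow> monomial_mat n p d = monomial_mat n q e"
  by (auto simp: monomial_mat_def intro!: eq_matI)

lemma one_mat_monomial: "1\<^sub>m n = monomial_mat n (\<lambda>c. c) (\<lambda>_. 1)"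
  by (auto simp: monomial_mat_def intro!: eq_matI)

definition swap_mat :: "nat \<Rightarrow> nat \<Rightarrow> complex \<Rightarrow> complex \<Rightarrow> complex mat" where
  "swap_mat n i a b = monomial_mat n (\<lambda>c. if c = i - 1 then i else if c = i then i - 1 else c)
     (\<lambda>c. if c = i - 1 then b else if c = i then a else 1)"

lemma diag_block_swap_mat:
  assumes "i \<in> {1..n-1}"
  shows "diag_block_mat [1\<^sub>m (i - 1), mat_of_rows_list 2 [[0, a], [b, 0]], 1\<^sub>m (n - 1 - i)] =
    swap_mat n i a b"
proof -
  define j m where "j = i - 1" and "m = n - 1 - i"
  then have i: "i = Suc j" and n: "n = j + 2 + m" using assms by auto
  have two: "mat_of_rows_list 2 [[0, a], [b, 0]] =
      mat 2 2 (\<lambda>(r, c). if r = 0 \<and> c = 1 then a else if r = 1 \<and> c = 0 then b else 0)"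
    by (rule eq_matI) (auto simp: mat_of_rows_list_def less_2_cases_iff)
  show ?thesis
    unfolding swap_mat_def monomial_mat_def i n two diag_block_mat.simps Let_def
    by (rule eq_matI) (auto split: if_splits)
qed

lemma tau_gen_swap_mat:
  "i \<in> {1..n-1} \<Longrightarrow> tau_gen n z l (Sigma_gen i) = swap_mat n i z 1"
  "i \<in> {1..n-1} \<Longrightarrow> tau_gen n z l (Alpha_gen i) = swap_mat n i (1 / l) l"
  by (simp_all only: tau_gen.simps diag_block_swap_mat)

lemma swap_mat_carrier [simp]: "swap_mat n i a b \<in> carrier_mat n n"
  by (simp add: swap_mat_def)

lemma swap_mat_inverse:
  assumes "i \<in> {1..n-1}" "a \<noteq> 0" "b \<noteq> 0"
  shows "swap_mat n i a b * swap_mat n i (1 / b) (1 / a) = 1\<^sub>m n"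
  unfolding swap_mat_def one_mat_monomial using assms
  by (subst monomial_mat_mult) (auto intro!: monomial_mat_cong)

lemma swap_mat_GL:
  assumes "i \<in> {1..n-1}" "a \<noteq> 0" "b \<noteq> 0"
  shows "swap_mat n i a b \<in> carrier (GL n)"
  using swap_mat_inverse[OF assms] swap_mat_inverse[OF assms(1), of "1 / b" "1 / a"] assms
  by (intro GL_carrierI[of _ _ "swap_mat n i (1 / b) (1 / a)"]) auto

lemma swap_mat_commute:
  assumes "i \<in> {1..n-1}" "j \<in> {1..n-1}" "\<bar>int i - int j\<bar> \<ge> 2"
  shows "swap_mat n i a b * swap_mat n j c d = swap_mat n j c d * swap_mat n i a b"
proof -
  define i' j' where "i' = i - 1" and "j' = j - 1"
  have i: "i = Suc i'" and j: "j = Suc j'" using assms by (auto simp: i'_def j'_def)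
  have n: "Suc i' < n" "Suc j' < n" using assms unfolding i j by auto
  have ne: "i' \<noteq> j'" "Suc i' \<noteq> j'" "i' \<noteq> Suc j'" "j' \<noteq> i'" "j' \<noteq> Suc i'" "Suc j' \<noteq> i'"
    using assms(3) unfolding i j by auto
  define p where "p k c = (if c = k then Suc k else if c = Suc k then k else c)" for k c
  define w where "w k x y c = (if c = k then y else if c = Suc k then x else 1)"
    for k c and x y :: complex
  have swap: "swap_mat n (Suc k) x y = monomial_mat n (p k) (w k x y)" for k x y
    unfolding swap_mat_def diff_Suc_1 by (rule monomial_mat_cong) (simp add: p_def w_def)
  have lt: "p i' c < n" "p j' c < n" if "c < n" for c
    using n that by (simp_all add: p_def)
  have "p i' (p j' m) = p j' (p i' m) \<and>
      w i' a b (p j' m) * w j' c d m = w j' c d (p i' m) * w i' a b m" for m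
    using ne by (simp add: p_def w_def)
  then show ?thesis
    unfolding i j swap by (simp only: monomial_mat_mult lt)
qed

lemma swap_mat_braid:
  assumes "i \<in> {1..n-2}"
  shows "swap_mat n i a b * (swap_mat n (Suc i) a b * swap_mat n i c d) =
    swap_mat n (Suc i) c d * (swap_mat n i a b * swap_mat n (Suc i) a b)"
proof -
  obtain j where i: "i = Suc j" using assms by (cases i) auto
  with assms have n: "j + 2 < n" by auto
  define p where "p k c = (if c = k then Suc k else if c = Suc k then k else c)" for k c
  define w where "w k x y c = (if c = k then y else if c = Suc k then x else 1)"
    for k c and x y :: complex
  have swap: "swap_mat n (Suc k) x y = monomial_mat n (p k) (w k x y)" for k x y
    unfolding swap_mat_def diff_Suc_1 by (rule monomial_mat_cong) (simp add: p_def w_def)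
  have lt: "p j c < n" "p (Suc j) c < n" if "c < n" for c
    using n that by (auto simp: p_def)
  show ?thesis
    unfolding i swap
    by (simp add: monomial_mat_mult lt, rule monomial_mat_cong) (auto simp: p_def w_def)
qed

lemma tau_rep:
  assumes "z \<noteq> 0" "l \<noteq> 0"
  shows "tau_rep n z l \<in> hom (WB n) (GL n)"
    and "i \<in> {1..n-1} \<Longrightarrow> tau_rep n z l (wb_sigma n i) = tau_gen n z l (Sigma_gen i)"
    and "i \<in> {1..n-1} \<Longrightarrow> tau_rep n z l (wb_alpha n i) = tau_gen n z l (Alpha_gen i)"
proof -
  have f: "tau_gen n z l \<in> wb_gens n \<rightarrow> carrier (GL n)"
    using assms by (auto simp: wb_gens_def tau_gen_swap_mat swap_mat_GL simp del: tau_gen.simps)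
  have rels: "word_eval (GL n) (tau_gen n z l) u = word_eval (GL n) (tau_gen n z l) v"
    if "(u, v) \<in> wb_rels n" for u v
  proof -
    have "swap_mat n i (1 / l) l * swap_mat n i (1 / l) l = 1\<^sub>m n" if "i \<in> {1..n-1}" for i
      using swap_mat_inverse[OF that, of "1 / l" l] assms by simp
    moreover have "i \<in> {1..n-1}" "Suc i \<in> {1..n-1}" if "i \<in> {1..n-2}" for i
      using that by auto
    ultimately show ?thesis
      using that unfolding wb_rels_def Let_def
      by (elim UnE CollectE exE conjE Pair_inject)
         (simp_all add: tau_gen_swap_mat swap_mat_commute[of _ n] swap_mat_braid
            right_mult_one_mat[OF swap_mat_carrier] Suc_eq_plus1[symmetric]
            del: tau_gen.simps atLeastAtMost_iff One_nat_def Suc_eq_plus1,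
          (rule swap_mat_commute; blast)+)
  qed
  note H = induced_hom_in_hom[OF group_GL f rels] induced_hom_generator[OF group_GL f rels]
  show "tau_rep n z l \<in> hom (WB n) (GL n)" unfolding tau_rep_def WB_def by (rule H(1))
  show "tau_rep n z l (wb_sigma n i) = tau_gen n z l (Sigma_gen i)" if "i \<in> {1..n-1}"
    unfolding tau_rep_def wb_sigma_def by (rule H(2)) (use that in \<open>auto simp: wb_gens_def\<close>)
  show "tau_rep n z l (wb_alpha n i) = tau_gen n z l (Alpha_gen i)" if "i \<in> {1..n-1}"
    unfolding tau_rep_def wb_alpha_def by (rule H(2)) (use that in \<open>auto simp: wb_gens_def\<close>)
qed

end

theory Submission
  imports Defs "HOL-Library.Function_Algebras" "Jordan_Normal_Form.Spectral_Radius"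
begin

text \<open>The involutions \<open>\<alpha>\<^sub>i\<close> make \<open>V = \<complex>\<^sup>n\<close> a representation of the symmetric group \<open>S\<^sub>n\<close>, and
  each \<open>\<sigma>\<^sub>i\<close> is conjugate to \<open>\<sigma>\<^sub>1\<close> by a product of \<open>\<alpha>\<close>'s. Hence a subspace that is invariant under
  \<open>S\<^sub>n\<close> and \<open>\<sigma>\<^sub>1\<close> is invariant under the braid group, so it is \<open>0\<close> or \<open>V\<close>. This is the main use
  of irreducibility; the rest is linear algebra in three steps.

  The group \<open>S\<^sub>n\<close> acts by a permutation representation, up to a sign. After multiplication of all
  \<open>\<alpha>\<^sub>i\<close> by a sign \<open>k\<close>, the \<open>(-1)\<close>-eigenspace \<open>N\<close> of \<open>\<alpha>\<^sub>1\<close> has dimension at most \<open>n / 2\<close>. The group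
  \<open>S\<^bsub>n-2\<^esub>\<close> generated by \<open>\<alpha>\<^sub>3, \<alpha>\<^sub>4, \<dots>\<close> acts on \<open>N\<close>, and a representation of \<open>S\<^sub>m\<close>, \<open>m \<ge> 5\<close>, of dimension
  at most \<open>(m + 2) / 2\<close> is a sum of trivial and sign characters (\<open>small_coxeter_rep_agree\<close>); so
  \<open>\<alpha>\<^sub>3, \<alpha>\<^sub>4, \<dots>\<close> coincide on \<open>N\<close>. Where they are \<open>-1\<close> on \<open>N\<close>, the whole of \<open>S\<^sub>n\<close> acts by the sign;
  such vectors form a proper invariant subspace, so there are none (\<open>no_sign_vector\<close>). Thus
  \<open>\<alpha>\<^sub>3, \<alpha>\<^sub>4, \<dots>\<close> fix \<open>N\<close> pointwise. Then each vector of a basis of \<open>N\<close> spans under \<open>S\<^sub>n\<close> a copy of the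
  standard representation, of dimension \<open>n - 1\<close>, and these copies are independent by a computation
  with the Cartan matrix (\<open>chain_sum_eq_0\<close>). There is room for one copy only, the \<open>\<alpha>\<^sub>i\<close> are
  reflections, and \<open>V\<close> has a basis that they permute (\<open>perm_basis_exists\<close>).

  In this basis \<open>\<sigma>\<^sub>1\<close> commutes with the permutations of \<open>3, \<dots>, n\<close>, which leaves ten unknown entries
  (\<open>sigma_form_exists\<close>). The relation \<open>\<sigma>\<^sub>1\<sigma>\<^sub>3 = \<sigma>\<^sub>3\<sigma>\<^sub>1\<close> says that a certain sum of two rank one matrices
  vanishes outside one entry. Either it exhibits the sum of the basis as an eigenvector of all
  generators, or the vectors with coordinate sum \<open>0\<close> as an invariant subspace, or else a
  translation of the basis by a multiple of its sum makes \<open>\<sigma>\<^sub>1\<close> a \<open>2 \<times> 2\<close> block and a scalar \<open>y\<close>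
  (\<open>straightened_basis\<close>). The remaining relations force the block to be antidiagonal, as a
  non-zero diagonal entry would produce one of the same two invariant subspaces
  (\<open>block_is_antidiagonal\<close>). Rescaling the basis gives \<open>X(y, k) \<otimes> \<tau>(z, \<lambda>)\<close>; for \<open>z = 1\<close> the sum of the
  rescaled basis would span an invariant line.

  Finally the traces of five elements of the group determine \<open>(y, k, z, \<lambda>)\<close>
  (\<open>tensor_tau_parameters_unique\<close>).

  The generators \<open>\<alpha>\<^bsub>i+1\<^esub>\<close> and \<open>\<sigma>\<^bsub>i+1\<^esub>\<close> appear below as operators \<open>A i\<close> and \<open>s i\<close>, indexed from \<open>0\<close>, and a
  basis of \<open>V\<close> is a family indexed by \<open>0, \<dots>, n - 1\<close>.\<close>

section \<open>Dimension bounds for subspaces\<close>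

locale scalar_space = vector_space scale
  for scale :: "'a::field_char_0 \<Rightarrow> 'b::ab_group_add \<Rightarrow> 'b" (infixr "*s" 75)
begin

text \<open>The ambient space is infinite-dimensional in the application, where vectors are functions on
  \<open>nat\<close>; dimensions of subspaces are therefore controlled by their independent subsets.\<close>

definition dim_at_most :: "'b set \<Rightarrow> nat \<Rightarrow> bool" where
  "dim_at_most U d \<longleftrightarrow> (\<forall>S. S \<subseteq> U \<and> independent S \<longrightarrow> finite S \<and> card S \<le> d)"

lemma dim_at_mostD:
  assumes "dim_at_most U d" "S \<subseteq> U" "independent S"
  shows "finite S" "card S \<le> d"
  using assms unfolding dim_at_most_def by auto

lemma dim_at_most_subset: "dim_at_most U d \<Longrightarrow> W \<subseteq> U \<Longrightarrow> d \<le> e \<Longrightarrow> dim_at_most W e"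
  unfolding dim_at_most_def by (meson order_trans)

lemma dim_at_most_span: "finite B \<Longrightarrow> U \<subseteq> span B \<Longrightarrow> dim_at_most U (card B)"
  unfolding dim_at_most_def using independent_span_bound by blast

lemma dim_at_most_0: "dim_at_most U 0 \<longleftrightarrow> U \<subseteq> {0}"
proof
  assume d: "dim_at_most U 0"
  show "U \<subseteq> {0}"
  proof
    fix x assume x: "x \<in> U"
    show "x \<in> {0}"
    proof (rule ccontr)
      assume "x \<notin> {0}"
      then have "independent {x}" by simp
      then show False using d x unfolding dim_at_most_def by force
    qed
  qed
next
  assume U: "U \<subseteq> {0}"
  have "S = {}" if "S \<subseteq> U" "independent S" for S
    using that U dependent_zero by blast
  then show "dim_at_most U 0" unfolding dim_at_most_def by (metis card.empty finite.emptyI le_refl)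
qed

lemma independent_family:
  assumes I: "finite I" and ind: "\<And>c. (\<Sum>i\<in>I. c i *s x i) = 0 \<Longrightarrow> \<forall>i\<in>I. c i = 0"
  shows "inj_on x I" and "independent (x ` I)"
proof -
  show inj: "inj_on x I"
  proof (rule inj_onI, rule ccontr)
    fix i j assume ij: "i \<in> I" "j \<in> I" "x i = x j" "i \<noteq> j"
    let ?c = "\<lambda>k. if k = i then 1 else if k = j then -1 else 0"
    have "(\<Sum>k\<in>I. ?c k *s x k) = (\<Sum>k\<in>I. (if k = i then x i else 0) - (if k = j then x j else 0))"
      using ij by (intro sum.cong) auto
    also have "\<dots> = 0" using I ij by (simp add: sum_subtractf)
    finally show False using ind[of ?c] ij by auto
  qed
  show "independent (x ` I)"
  proof
    assume "dependent (x ` I)"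
    then obtain u where u: "\<exists>v\<in>x ` I. u v \<noteq> 0" "(\<Sum>v\<in>x ` I. u v *s v) = 0"
      using I by (auto simp: dependent_finite)
    then have "(\<Sum>i\<in>I. u (x i) *s x i) = 0" by (simp add: sum.reindex[OF inj])
    from ind[OF this] u(1) show False by auto
  qed
qed

text \<open>Independence is stated for families, so that the index set is counted even before the family
  is known to be injective.\<close>

lemma card_le_dim_at_most:
  assumes "dim_at_most U d" "finite I" "\<And>i. i \<in> I \<Longrightarrow> x i \<in> U"
    and "\<And>c. (\<Sum>i\<in>I. c i *s x i) = 0 \<Longrightarrow> \<forall>i\<in>I. c i = 0"
  shows "card I \<le> d"
proof -
  note F = independent_family[OF assms(2) assms(4)]
  have "x ` I \<subseteq> U" using assms(3) by auto
  then have "card (x ` I) \<le> d" using assms(1) F(2) unfolding dim_at_most_def by simp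
  then show ?thesis by (simp add: card_image[OF F(1)])
qed

lemma dim_at_most_family_spans:
  assumes d: "dim_at_most U (card I)" and I: "finite I" and x: "\<And>i. i \<in> I \<Longrightarrow> x i \<in> U"
    and ind: "\<And>c. (\<Sum>i\<in>I. c i *s x i) = 0 \<Longrightarrow> \<forall>i\<in>I. c i = 0" and v: "v \<in> U"
  shows "\<exists>c. v = (\<Sum>i\<in>I. c i *s x i)"
proof -
  note F = independent_family[OF I ind]
  have "v \<in> span (x ` I)"
  proof (rule ccontr)
    assume n: "v \<notin> span (x ` I)"
    then have "independent (insert v (x ` I))" using F(2) by (rule independent_insertI)
    moreover have "insert v (x ` I) \<subseteq> U" using x v by auto
    ultimately have "card (insert v (x ` I)) \<le> card I" using d unfolding dim_at_most_def by blast
    moreover have "v \<notin> x ` I" using n span_base by blast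
    ultimately show False using I by (simp add: card_image[OF F(1)])
  qed
  then obtain u where "v = (\<Sum>w\<in>x ` I. u w *s w)"
    using I by (auto simp: span_finite)
  then have "v = (\<Sum>i\<in>I. u (x i) *s x i)" by (simp add: sum.reindex[OF F(1)])
  then show ?thesis by (rule exI[of _ "\<lambda>i. u (x i)"])
qed

lemma dim_at_most_1_scalar:
  assumes "dim_at_most U 1" "w \<in> U" "w \<noteq> 0" "v \<in> U"
  shows "\<exists>c. v = c *s w"
proof -
  have "\<exists>c. v = (\<Sum>i\<in>{()}. c i *s w)"
    using assms by (intro dim_at_most_family_spans[of U]) auto
  then show ?thesis by auto
qed

text \<open>The union of an independent subset of \<open>U\<close> and one of more than \<open>k\<close> elements of \<open>W\<close> is
  independent. With \<open>k = 0\<close> the bound drops by one as soon as \<open>W \<noteq> 0\<close>; with \<open>k\<close> about half of \<open>d\<close> one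
  of the two subspaces has at most half the dimension.\<close>

lemma dim_at_most_complement:
  assumes V: "dim_at_most V d" and sub: "subspace U" "subspace W" "U \<subseteq> V" "W \<subseteq> V" "U \<inter> W \<subseteq> {0}"
    and W: "\<not> dim_at_most W k"
  shows "dim_at_most U (d - Suc k)"
proof -
  obtain T where T: "T \<subseteq> W" "independent T" "finite T \<Longrightarrow> \<not> card T \<le> k"
    using W unfolding dim_at_most_def by blast
  have fT: "finite T" using V T sub(4) unfolding dim_at_most_def by blast
  show ?thesis unfolding dim_at_most_def
  proof (intro allI impI)
    fix S assume S: "S \<subseteq> U \<and> independent S"
    have fS: "finite S" using V S sub(3) unfolding dim_at_most_def by blast
    have "0 \<notin> S" using S dependent_zero[of S] by blast
    with T have disj: "S \<inter> T = {}" using S T sub(5) by blast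
    have "independent (S \<union> T)"
    proof
      assume "dependent (S \<union> T)"
      then obtain u where u: "\<exists>v\<in>S \<union> T. u v \<noteq> 0" "(\<Sum>v\<in>S \<union> T. u v *s v) = 0"
        using fS fT by (auto simp: dependent_finite)
      let ?s = "\<Sum>v\<in>S. u v *s v" and ?t = "\<Sum>v\<in>T. u v *s v"
      have st: "?s + ?t = 0" using u(2) fS fT disj by (simp add: sum.union_disjoint)
      have sU: "?s \<in> U" using S sub(1) by (intro subspace_sum subspace_scale) auto
      have "?t \<in> W" using T sub(2) by (intro subspace_sum subspace_scale) auto
      moreover have "?s = - ?t" using st by (simp only: eq_neg_iff_add_eq_0)
      ultimately have "?s \<in> W" using subspace_neg[OF sub(2)] by metis
      with sU have s0: "?s = 0" using sub(5) by blast
      then have t0: "?t = 0" using st by simp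
      have "\<forall>v\<in>S. u v = 0" using independentD[of S S u] S fS s0 by blast
      moreover have "\<forall>v\<in>T. u v = 0" using independentD[of T T u] T fT t0 by blast
      ultimately show False using u(1) by blast
    qed
    moreover have "S \<union> T \<subseteq> V" using S T(1) sub(3,4) by auto
    ultimately have "card (S \<union> T) \<le> d" using dim_at_mostD(2)[OF V] by simp
    then have "card S + card T \<le> d" using fS fT disj by (simp add: card_Un_disjoint)
    then show "finite S \<and> card S \<le> d - Suc k" using T(3)[OF fT] fS by simp
  qed
qed

lemma dim_at_most_inj_image:
  assumes g: "module_hom scale scale g" and U: "subspace U" and inj: "\<And>v. v \<in> U \<Longrightarrow> g v = 0 \<Longrightarrow> v = 0"
    and im: "\<And>v. v \<in> U \<Longrightarrow> g v \<in> W" and W: "dim_at_most W d"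
  shows "dim_at_most U d"
  unfolding dim_at_most_def
proof (intro allI impI)
  interpret g: module_hom scale scale g by (rule g)
  fix S assume S: "S \<subseteq> U \<and> independent S"
  have inj_U: "inj_on g U" using inj by (auto simp: g.inj_on_iff_eq_0[OF U])
  have "span S \<subseteq> U" using S U by (simp add: span_minimal)
  then have "inj_on g (span S)" using inj_U inj_on_subset by blast
  then have "independent (g ` S)" using S g.independent_injective_image by blast
  moreover have "g ` S \<subseteq> W" using S im by blast
  ultimately have "finite (g ` S)" "card (g ` S) \<le> d" using W unfolding dim_at_most_def by auto
  moreover have "inj_on g S" using inj_U S inj_on_subset by blast
  ultimately show "finite S \<and> card S \<le> d" by (simp add: card_image finite_image_iff)
qed

end

section \<open>Representations of symmetric groups\<close>

text \<open>The Coxeter relations of \<open>S\<^sub>m\<close> for operators \<open>A i\<close> with \<open>Suc i < m\<close>, where \<open>A i\<close> stands for the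
  transposition of \<open>i\<close> and \<open>i + 1\<close>. The relations hold on \<open>V\<close> only, so that a restriction to an
  invariant subspace is again an instance with the same operators.\<close>

locale coxeter_rep = scalar_space scale
  for scale :: "'a::field_char_0 \<Rightarrow> 'b::ab_group_add \<Rightarrow> 'b" (infixr "*s" 75) +
  fixes V :: "'b set" and A :: "nat \<Rightarrow> 'b \<Rightarrow> 'b" and m :: nat
  assumes V: "subspace V"
    and lin: "Suc i < m \<Longrightarrow> module_hom scale scale (A i)"
    and closed: "Suc i < m \<Longrightarrow> v \<in> V \<Longrightarrow> A i v \<in> V"
    and invol: "Suc i < m \<Longrightarrow> v \<in> V \<Longrightarrow> A i (A i v) = v"
    and comm: "i + 2 \<le> j \<Longrightarrow> Suc j < m \<Longrightarrow> v \<in> V \<Longrightarrow> A i (A j v) = A j (A i v)"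
    and braid: "Suc (Suc i) < m \<Longrightarrow> v \<in> V \<Longrightarrow>
      A i (A (Suc i) (A i v)) = A (Suc i) (A i (A (Suc i) v))"
begin

lemmas A_add = module_hom.add[OF lin]
lemmas A_scale = module_hom.scale[OF lin]
lemmas A_diff = module_hom.diff[OF lin]
lemmas A_neg = module_hom.neg[OF lin]
lemmas A_sum = module_hom.sum[OF lin]
lemmas A_zero = module_hom.zero[OF lin]

lemma double_eq_0: "(v :: 'b) + v = 0 \<longleftrightarrow> v = 0"
proof -
  have "v + v = 2 *s v" using scale_left_distrib[of 1 1 v] by simp
  then show ?thesis by simp
qed

lemma eq_neg_self: "(v :: 'b) = - v \<longleftrightarrow> v = 0"
  using double_eq_0[of v] by (simp add: eq_neg_iff_add_eq_0)

text \<open>For commuting involutions \<open>a\<close> and \<open>b\<close> the two sides of the braid relation are \<open>b\<close> and \<open>a\<close>.\<close>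

lemma agree_if_commute:
  assumes "Suc (Suc i) < m" "\<And>v. v \<in> V \<Longrightarrow> A i (A (Suc i) v) = A (Suc i) (A i v)" "v \<in> V"
  shows "A i v = A (Suc i) v"
proof -
  have "A (Suc i) v = A i (A i (A (Suc i) v))" using assms by (simp add: invol closed)
  also have "\<dots> = A i (A (Suc i) (A i v))" using assms by simp
  also have "\<dots> = A (Suc i) (A i (A (Suc i) v))" using assms by (simp add: braid)
  also have "\<dots> = A (Suc i) (A (Suc i) (A i v))" using assms by simp
  also have "\<dots> = A i v" using assms by (simp add: invol closed)
  finally show ?thesis by simp
qed

lemma agree_up:
  assumes "Suc (Suc (Suc i)) < m" "\<forall>v\<in>V. A i v = A (Suc i) v"
  shows "\<forall>v\<in>V. A (Suc i) v = A (Suc (Suc i)) v"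
proof
  fix v assume v: "v \<in> V"
  show "A (Suc i) v = A (Suc (Suc i)) v"
  proof (rule agree_if_commute[OF assms(1) _ v])
    fix u assume u: "u \<in> V"
    have "A i (A (Suc (Suc i)) u) = A (Suc (Suc i)) (A i u)" using assms(1) u by (intro comm) auto
    then show "A (Suc i) (A (Suc (Suc i)) u) = A (Suc (Suc i)) (A (Suc i) u)"
      using assms u by (simp add: closed)
  qed
qed

lemma agree_down:
  assumes "Suc (Suc (Suc i)) < m" "\<forall>v\<in>V. A (Suc i) v = A (Suc (Suc i)) v"
  shows "\<forall>v\<in>V. A i v = A (Suc i) v"
proof
  fix v assume v: "v \<in> V"
  show "A i v = A (Suc i) v"
  proof (rule agree_if_commute[OF _ _ v])
    show "Suc (Suc i) < m" using assms(1) by simp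
    fix u assume u: "u \<in> V"
    have "A i (A (Suc (Suc i)) u) = A (Suc (Suc i)) (A i u)" using assms(1) u by (intro comm) auto
    then show "A i (A (Suc i) u) = A (Suc i) (A i u)"
      using assms u by (simp add: closed)
  qed
qed

text \<open>Equality of adjacent generators spreads along the diagram: \<open>A (k + 2)\<close> commutes with \<open>A k\<close>,
  hence with \<open>A (k + 1)\<close>, and \<open>agree_if_commute\<close> applies.\<close>

lemma agree_all:
  assumes "Suc (Suc k) < m" "\<forall>v\<in>V. A k v = A (Suc k) v"
  shows "Suc i < m \<Longrightarrow> v \<in> V \<Longrightarrow> A i v = A 0 v"
proof -
  have up: "Suc (Suc (k + i)) < m \<Longrightarrow> \<forall>v\<in>V. A (k + i) v = A (Suc (k + i)) v" for i
  proof (induction i)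
    case 0 then show ?case using assms by simp
  next
    case (Suc i)
    have "Suc (Suc (Suc (k + i))) < m" using Suc.prems by simp
    moreover from this have "\<forall>v\<in>V. A (k + i) v = A (Suc (k + i)) v" by (intro Suc.IH) simp
    ultimately show ?case unfolding add_Suc_right by (rule agree_up)
  qed
  have down: "\<forall>v\<in>V. A (k - i) v = A (Suc (k - i)) v" for i
  proof (induction i)
    case 0 show ?case using assms(2) by (simp only: diff_zero)
  next
    case (Suc i)
    show ?case
    proof (cases "i < k")
      case True
      then have i: "Suc (k - Suc i) = k - i" by simp
      have "Suc (Suc (Suc (k - Suc i))) < m" using i assms(1) by simp
      then show ?thesis by (rule agree_down) (use Suc in \<open>simp only: i\<close>)
    next
      case False
      then have "k - Suc i = k - i" by simp
      then show ?thesis using Suc by (simp only:)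
    qed
  qed
  have adj: "\<forall>v\<in>V. A i v = A (Suc i) v" if "Suc (Suc i) < m" for i
  proof (cases "i \<le> k")
    case True
    then have "k - (k - i) = i" by simp
    then show ?thesis using down[of "k - i"] by (simp only:)
  next
    case False
    then have "k + (i - k) = i" by simp
    moreover from this that have "Suc (Suc (k + (i - k))) < m" by (simp only:)
    from up[OF this] calculation show ?thesis by (simp only:)
  qed
  show "Suc i < m \<Longrightarrow> v \<in> V \<Longrightarrow> A i v = A 0 v"
  proof (induction i)
    case (Suc i)
    have "A (Suc i) v = A i v" using bspec[OF adj[OF Suc.prems(1)] Suc.prems(2)] by (rule HOL.sym)
    also have "\<dots> = A 0 v" by (rule Suc.IH) (use Suc.prems in simp_all)
    finally show ?case .
  qed simp
qed

lemma agree_if_scalar: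
  assumes "Suc (Suc 0) < m" "\<And>v. v \<in> V \<Longrightarrow> A 0 v = c *s v" "v \<in> V"
  shows "A 0 v = A 1 v"
proof -
  have "A 0 v = A (Suc 0) v"
  proof (rule agree_if_commute[OF assms(1) _ assms(3)])
    fix u assume u: "u \<in> V"
    have "A (Suc 0) u \<in> V" using assms(1) u by (rule closed)
    then show "A 0 (A (Suc 0) u) = A (Suc 0) (A 0 u)"
      unfolding assms(2)[OF u] A_scale[OF assms(1)] by (rule assms(2))
  qed
  then show ?thesis by simp
qed

definition Neg :: "nat \<Rightarrow> 'b set" where "Neg i = {v \<in> V. A i v = - v}"
definition Pos :: "nat \<Rightarrow> 'b set" where "Pos i = {v \<in> V. A i v = v}"

lemma subspace_Neg: "Suc i < m \<Longrightarrow> subspace (Neg i)"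
  and subspace_Pos: "Suc i < m \<Longrightarrow> subspace (Pos i)"
  unfolding subspace_def Neg_def Pos_def using V
  by (auto simp: subspace_def A_add A_scale A_zero)

lemma Neg_Pos: "Neg i \<subseteq> V" "Pos i \<subseteq> V" "Neg i \<inter> Pos i \<subseteq> {0}"
proof -
  show "Neg i \<subseteq> V" "Pos i \<subseteq> V" unfolding Neg_def Pos_def by blast+
  have "v = 0" if "A i v = - v" "A i v = v" for v
    using that eq_neg_self[THEN iffD1, of v] by (simp only:)
  then show "Neg i \<inter> Pos i \<subseteq> {0}" unfolding Neg_def Pos_def by blast
qed

lemma diff_Neg: "Suc i < m \<Longrightarrow> v \<in> V \<Longrightarrow> v - A i v \<in> Neg i"
  and add_Pos: "Suc i < m \<Longrightarrow> v \<in> V \<Longrightarrow> v + A i v \<in> Pos i"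
  unfolding Neg_def Pos_def using V
  by (auto simp: A_add A_diff invol closed intro: subspace_add subspace_diff)

text \<open>The vector \<open>2v\<close> is the sum of \<open>v - A k v\<close> and \<open>v + A k v\<close>, which lie in the two eigenspaces.\<close>

lemma agree_if_Neg_Pos:
  assumes "Suc i < m" "Suc j < m" "Suc k < m"
    and N: "\<And>v. v \<in> Neg k \<Longrightarrow> A i v = A j v" and P: "\<And>v. v \<in> Pos k \<Longrightarrow> A i v = A j v" and v: "v \<in> V"
  shows "A i v = A j v"
proof -
  have "A i (v - A k v) + A i (v + A k v) = A j (v - A k v) + A j (v + A k v)"
    using N[OF diff_Neg[OF assms(3) v]] P[OF add_Pos[OF assms(3) v]] by (simp only:)
  then have "A i ((v - A k v) + (v + A k v)) = A j ((v - A k v) + (v + A k v))"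
    by (simp only: A_add[OF assms(1)] A_add[OF assms(2)])
  then have "A i (v + v) = A j (v + v)" by (simp add: algebra_simps)
  then have "(A i v - A j v) + (A i v - A j v) = 0" using assms(1,2) by (simp add: A_add algebra_simps)
  then show ?thesis by (simp only: double_eq_0) simp
qed

lemma restrict:
  assumes "subspace W" "W \<subseteq> V" "m' + s \<le> m" "\<And>i v. Suc i < m' \<Longrightarrow> v \<in> W \<Longrightarrow> A (i + s) v \<in> W"
  shows "coxeter_rep scale W (\<lambda>i. A (i + s)) m'"
proof -
  have *: "v \<in> W \<Longrightarrow> v \<in> V" for v using assms(2) by auto
  have s: "Suc i < m' \<Longrightarrow> Suc (i + s) < m" for i using assms(3) by simp
  show ?thesis
    using assms s by unfold_locales (auto simp: invol * A_add A_scale intro: comm braid[simplified])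
qed

text \<open>The generators that commute with \<open>A 0\<close> form a copy of \<open>S\<^bsub>m-2\<^esub>\<close>, which acts on the
  eigenspaces of \<open>A 0\<close>. Induction on \<open>m\<close> in steps of two rests on this.\<close>

lemma restrict_Neg_Pos:
  assumes "2 \<le> m"
  shows "coxeter_rep scale (Neg 0) (\<lambda>i. A (i + 2)) (m - 2)"
    and "coxeter_rep scale (Pos 0) (\<lambda>i. A (i + 2)) (m - 2)"
proof -
  have c: "A 0 (A (i + 2) v) = A (i + 2) (A 0 v)" "A (i + 2) v \<in> V" if "Suc i < m - 2" "v \<in> V" for i v
    using that by (auto intro!: comm closed)
  have n: "A (i + 2) (- v) = - A (i + 2) v" if "Suc i < m - 2" for i v
    using that by (intro A_neg) auto
  have m: "Suc 0 < m" "m - 2 + 2 \<le> m" using assms by auto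
  show "coxeter_rep scale (Neg 0) (\<lambda>i. A (i + 2)) (m - 2)"
    by (rule restrict[OF subspace_Neg[OF m(1)] Neg_Pos(1) m(2)])
      (use c n in \<open>simp add: Neg_def\<close>)
  show "coxeter_rep scale (Pos 0) (\<lambda>i. A (i + 2)) (m - 2)"
    by (rule restrict[OF subspace_Pos[OF m(1)] Neg_Pos(2) m(2)])
      (use c n in \<open>simp add: Pos_def\<close>)
qed

lemma twist: "coxeter_rep scale V (\<lambda>i v. - A i v) m"
proof -
  have n: "- v \<in> V" if "v \<in> V" for v using V that by (rule subspace_neg)
  show ?thesis
    by unfold_locales (auto simp: V A_add A_scale closed n invol A_neg braid intro: comm)
qed

end

context coxeter_rep begin

text \<open>Since \<open>A (i + 1) A i\<close> conjugates \<open>A (i + 1)\<close> into \<open>A i\<close>, it embeds \<open>Neg (i + 1)\<close> into \<open>Neg i\<close>.\<close>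

lemma dim_Neg:
  assumes "dim_at_most (Neg 0) d"
  shows "Suc i < m \<Longrightarrow> dim_at_most (Neg i) d"
proof (induction i)
  case 0 then show ?case by (simp add: assms)
next
  case (Suc i)
  let ?g = "A (Suc i) \<circ> A i"
  have m: "Suc i < m" "Suc (Suc i) < m" using Suc.prems by auto
  show ?case
  proof (rule dim_at_most_inj_image[of ?g _ "Neg i"])
    show "module_hom scale scale ?g" by (rule module_hom_compose[OF lin lin]) (use m in auto)
    show "subspace (Neg (Suc i))" using m by (intro subspace_Neg)
    show "dim_at_most (Neg i) d" using Suc by simp
    fix v assume "v \<in> Neg (Suc i)"
    then have v: "v \<in> V" "A (Suc i) v = - v" by (auto simp: Neg_def)
    show "?g v \<in> Neg i" using v braid[OF m(2) v(1)] m by (simp add: Neg_def A_neg closed)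
    assume "?g v = 0"
    then have "A i (A (Suc i) (A (Suc i) (A i v))) = 0" using m by (simp add: A_zero)
    then show "v = 0" using m v by (simp add: invol closed)
  qed
qed

text \<open>The braid relation propagates a sign along the diagram: a vector cannot be negated by
  one of two adjacent generators and fixed by the other.\<close>

lemma adjacent_signs:
  assumes "Suc (Suc i) < m" "v \<in> V"
  shows "A i v = - v \<Longrightarrow> A (Suc i) v = v \<Longrightarrow> v = 0"
    and "A i v = v \<Longrightarrow> A (Suc i) v = - v \<Longrightarrow> v = 0"
  using braid[OF assms] assms by (auto simp: A_neg eq_neg_self dest: HOL.sym)

text \<open>The inclusion \<open>Neg 0 \<subseteq> Neg 2\<close> is automatically an equality, as the double transposition
  \<open>(0 2)(1 3)\<close> exchanges the two. The projections onto these eigenspaces commute, so they coincide.\<close>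

lemma Neg_subset_far_imp_agree:
  assumes m: "4 \<le> m" and N: "\<And>v. v \<in> Neg 0 \<Longrightarrow> A 2 v = - v" and v: "v \<in> V"
  shows "A 0 v = A 2 v"
proof -
  have m': "Suc 0 < m" "Suc (Suc 0) < m" "Suc 2 < m" using m by auto
  have braid01: "A 0 (A (Suc 0) (A 0 u)) = A (Suc 0) (A 0 (A (Suc 0) u))" and braid12: "A (Suc 0) (A 2 (A (Suc 0) u)) = A 2 (A (Suc 0) (A 2 u))"
    and c: "A 0 (A 2 u) = A 2 (A 0 u)" if "u \<in> V" for u
    using braid[of 0 u] braid[of "Suc 0" u] comm[of 0 2 u] m that by (auto simp: numeral_2_eq_2)
  note cl = closed[OF m'(1)] closed[OF m'(2)] closed[OF m'(3)]
  define g where "g u = A (Suc 0) (A 0 (A 2 (A (Suc 0) u)))" for u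
  \<comment> \<open>\<open>g\<close> represents the double transposition \<open>(0 2)(1 3)\<close>.\<close>
  have g: "g (A 0 u) = A 2 (g u)" "g (A 2 u) = A 0 (g u)" if u: "u \<in> V" for u
  proof -
    show "g (A 0 u) = A 2 (g u)"
      unfolding g_def using u braid01[OF u] c[of "A (Suc 0) u"] c[of "A (Suc 0) (A 0 u)"] c[of "A 0 (A (Suc 0) u)"]
        braid12[of "A 0 (A (Suc 0) u)"] by (simp add: cl)
    have "g (A 2 u) = A (Suc 0) (A 0 (A (Suc 0) (A 2 (A (Suc 0) u))))"
      unfolding g_def using u braid12[OF u] by (simp add: cl)
    also have "\<dots> = A 0 (g u)"
      unfolding g_def using u braid01[of "A 2 (A (Suc 0) u)"] by (simp add: cl)
    finally show "g (A 2 u) = A 0 (g u)" .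
  qed
  have gV: "g u \<in> V" if "u \<in> V" for u unfolding g_def using that by (simp add: cl)
  have g_neg: "g (- u) = - g u" for u unfolding g_def using m' by (simp add: A_neg)
  have g_inj: "u = u'" if "g u = g u'" "u \<in> V" "u' \<in> V" for u u'
  proof -
    have "A (Suc 0) (A 2 (A 0 (A (Suc 0) (g u)))) = A (Suc 0) (A 2 (A 0 (A (Suc 0) (g u'))))" using that by simp
    then show ?thesis unfolding g_def using that m' by (simp add: cl invol)
  qed
  have N': "A 0 u = - u" if u: "u \<in> V" "A 2 u = - u" for u
  proof -
    have "g u \<in> Neg 0" using g(2)[OF u(1)] u gV by (simp add: Neg_def g_neg)
    then have "g (A 0 u) = g (- u)" using N g(1)[OF u(1)] by (simp add: g_neg)
    moreover have "- u \<in> V" using V u by (simp add: subspace_neg)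
    ultimately show ?thesis using g_inj u cl by blast
  qed
  have 1: "A 2 (v - A 0 v) = - (v - A 0 v)" using diff_Neg[OF m'(1) v] by (rule N)
  have "v - A 2 v \<in> Neg 2" by (rule diff_Neg[OF m'(3) v])
  then have 2: "A 0 (v - A 2 v) = - (v - A 2 v)" using N' by (auto simp: Neg_def)
  have "A 2 v - A 0 v = - (v - A 0 v) + A 2 (A 0 v) - A 0 v"
    using 1 m' by (simp add: A_diff algebra_simps)
  also have "\<dots> = - v + A 0 (A 2 v)" using c[OF v] by simp
  also have "\<dots> = A 0 v - A 2 v"
    using 2 m' by (simp add: A_diff algebra_simps)
  finally have "A 2 v - A 0 v = - (A 2 v - A 0 v)" by simp
  then show ?thesis unfolding eq_neg_self by simp
qed

end

section \<open>Copies of the standard representation\<close>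

text \<open>In the standard representation a root \<open>e\<^sub>i - e\<^bsub>i+1\<^esub>\<close> is negated by its own transposition and fixed
  by the disjoint ones. Assuming the latter for \<open>Neg 0\<close> excludes the sign character and makes
  the span of \<open>Neg 0, Neg 1, \<dots>\<close> a multiple of the standard representation.\<close>

locale far_coxeter_rep = coxeter_rep +
  assumes m4: "4 \<le> m"
    and far0: "2 \<le> j \<Longrightarrow> Suc j < m \<Longrightarrow> v \<in> Neg 0 \<Longrightarrow> A j v = v"
begin

text \<open>Conjugation by \<open>A (i + 1) A i\<close> carries \<open>Neg (i + 1)\<close> to \<open>Neg i\<close> and commutes with \<open>A j\<close>.\<close>

lemma far_up: "i + 2 \<le> j \<Longrightarrow> Suc j < m \<Longrightarrow> v \<in> Neg i \<Longrightarrow> A j v = v"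
proof (induction i arbitrary: v)
  case 0 then show ?case by (simp add: far0)
next
  case (Suc i)
  have m: "Suc i < m" "Suc (Suc i) < m" "Suc j < m" using Suc.prems by auto
  have v: "v \<in> V" "A (Suc i) v = - v" using Suc.prems by (auto simp: Neg_def)
  let ?g = "\<lambda>v. A (Suc i) (A i v)"
  have "?g v \<in> Neg i" using v braid[OF m(2) v(1)] m by (simp add: Neg_def A_neg closed)
  then have "A j (?g v) = ?g v" using Suc by (intro Suc.IH) auto
  moreover have "A j (?g v) = ?g (A j v)"
    using comm[of i j v] comm[of "Suc i" j "A i v"] Suc.prems v m by (simp add: closed)
  ultimately have "?g (A j v) = ?g v" by simp
  then have "A i (A (Suc i) (?g (A j v))) = A i (A (Suc i) (?g v))" by simp
  then show ?case using m v by (simp add: invol closed)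
qed

lemma far: "i + 2 \<le> j \<or> j + 2 \<le> i \<Longrightarrow> Suc i < m \<Longrightarrow> Suc j < m \<Longrightarrow> v \<in> Neg i \<Longrightarrow> A j v = v"
proof (elim disjE)
  assume a: "j + 2 \<le> i" "Suc i < m" "Suc j < m" "v \<in> Neg i"
  then have v: "v \<in> V" "A i v = - v" by (auto simp: Neg_def)
  let ?u = "v - A j v"
  have "A i ?u = ?u" using a v by (intro far_up[of j] diff_Neg) auto
  moreover have "A i (A j v) = - A j v" using a v comm[of j i v] by (simp add: A_neg)
  then have "A i ?u = - ?u" using a v by (simp add: A_diff)
  ultimately have "?u = 0" using eq_neg_self by metis
  then show "A j v = v" by simp
qed (rule far_up)

text \<open>A vector negated by two adjacent generators is fixed by a third one next to them, because one
  of the two is disjoint from it; this contradicts \<open>adjacent_signs\<close>. A third generator exists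
  because \<open>m \<ge> 4\<close>.\<close>

lemma Neg_Int_adjacent:
  assumes m: "Suc (Suc i) < m" and v: "v \<in> Neg i" "v \<in> Neg (Suc i)"
  shows "v = 0"
proof -
  have v': "v \<in> V" "A i v = - v" "A (Suc i) v = - v" using v by (auto simp: Neg_def)
  show ?thesis
  proof (cases "Suc (Suc (Suc i)) < m")
    case True
    then have "A (Suc (Suc i)) v = v" using v by (intro far[of i]) auto
    then show ?thesis using adjacent_signs(1)[of "Suc i" v] True v' by simp
  next
    case False
    then obtain k where k: "i = Suc k" using m4 by (cases i) auto
    then have "A k v = v" using v m by (intro far[of "Suc i"]) auto
    then show ?thesis using adjacent_signs(2)[of k v] m k v' by simp
  qed
qed

text \<open>If \<open>v = e\<^sub>0 - e\<^sub>1\<close>, then \<open>chain i v\<close> is the simple root \<open>e\<^sub>i - e\<^bsub>i+1\<^esub>\<close>.\<close>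

fun chain :: "nat \<Rightarrow> 'b \<Rightarrow> 'b" where
  "chain 0 v = v"
| "chain (Suc i) v = A (Suc i) (chain i v) - chain i v"

lemma chain_Neg: "v \<in> Neg 0 \<Longrightarrow> Suc i < m \<Longrightarrow> chain i v \<in> Neg i"
proof (induction i)
  case (Suc i)
  then have "chain i v \<in> V" using Neg_Pos by auto
  then have "chain i v - A (Suc i) (chain i v) \<in> Neg (Suc i)" using Suc.prems by (intro diff_Neg)
  then show ?case using subspace_neg[OF subspace_Neg, of "Suc i"] Suc.prems by fastforce
qed simp

lemma chain_V: "v \<in> Neg 0 \<Longrightarrow> Suc i < m \<Longrightarrow> chain i v \<in> V"
  using chain_Neg Neg_Pos by blast

text \<open>These are the reflection formulas for simple roots. Only the third is not immediate: the
  difference of its sides is negated by \<open>A i\<close> and by \<open>A (i + 1)\<close>, so it vanishes by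
  \<open>Neg_Int_adjacent\<close>.\<close>

lemma A_chain:
  assumes v: "v \<in> Neg 0"
  shows "Suc i < m \<Longrightarrow> A i (chain i v) = - chain i v"
    and "Suc (Suc i) < m \<Longrightarrow> A (Suc i) (chain i v) = chain i v + chain (Suc i) v"
    and "Suc (Suc i) < m \<Longrightarrow> A i (chain (Suc i) v) = chain (Suc i) v + chain i v"
    and "Suc i < m \<Longrightarrow> Suc j < m \<Longrightarrow> i + 2 \<le> j \<or> j + 2 \<le> i \<Longrightarrow> A j (chain i v) = chain i v"
proof -
  show "Suc i < m \<Longrightarrow> A i (chain i v) = - chain i v"
    using chain_Neg[OF v] by (auto simp: Neg_def)
  show "Suc (Suc i) < m \<Longrightarrow> A (Suc i) (chain i v) = chain i v + chain (Suc i) v" by simp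
  show "Suc i < m \<Longrightarrow> Suc j < m \<Longrightarrow> i + 2 \<le> j \<or> j + 2 \<le> i \<Longrightarrow> A j (chain i v) = chain i v"
    using far chain_Neg[OF v] by blast
  assume m: "Suc (Suc i) < m"
  define u where "u = chain i v"
  define w where "w = A (Suc i) u - u"
  have u: "u \<in> V" "A i u = - u" using chain_Neg[OF v, of i] m by (auto simp: u_def Neg_def)
  have m': "Suc i < m" using m by simp
  have w: "w \<in> V" "A (Suc i) w = - w"
    using u m V by (auto simp: w_def A_diff invol closed subspace_diff)
  define z where "z = A i w - w - u"
  have zV: "z \<in> V" unfolding z_def using u w m' V by (auto simp: closed subspace_diff)
  have "A i z = - z" unfolding z_def using u w m' by (simp add: A_diff invol)
  moreover have "A (Suc i) (A i (A (Suc i) u)) = - A i (A (Suc i) u)"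
    using braid[OF m u(1)] u m' by (simp add: A_neg m)
  then have "A (Suc i) z = - z"
    using u w m m' by (simp add: z_def w_def A_diff A_add A_neg invol closed algebra_simps)
  ultimately have "z = 0" using Neg_Int_adjacent[OF m] zV by (simp add: Neg_def)
  then show "A i (chain (Suc i) v) = chain (Suc i) v + chain i v"
    unfolding z_def w_def u_def by (simp add: algebra_simps)
qed

lemma chain_linear: "Suc i < m \<Longrightarrow> module_hom scale scale (chain i)"
proof (induction i)
  case 0 then show ?case by (unfold_locales) auto
next
  case (Suc i)
  interpret c: module_hom scale scale "chain i" using Suc by simp
  interpret a: module_hom scale scale "A (Suc i)" using Suc by (intro lin)
  show ?case by unfold_locales (simp_all add: c.add c.scale a.add a.scale algebra_simps scale_right_diff_distrib)
qed

lemma chain_inj: "v \<in> Neg 0 \<Longrightarrow> Suc i < m \<Longrightarrow> chain i v = 0 \<Longrightarrow> v = 0"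
proof (induction i)
  case (Suc i)
  have "chain i v = 0" using A_chain(3)[of v i] Suc.prems by (simp add: A_zero)
  then show ?case using Suc by simp
qed simp

end

context far_coxeter_rep begin

text \<open>Applying \<open>1 - A k\<close> to the sum turns it into \<open>chain k (2 y\<^sub>k - y\<^bsub>k-1\<^esub> - y\<^bsub>k+1\<^esub>)\<close>, with \<open>y\<close> extended
  by \<open>0\<close> at both ends. Hence \<open>y\<^sub>k = (k + 1) y\<^sub>0\<close>, and the boundary value \<open>m y\<^sub>0 = 0\<close> gives \<open>y = 0\<close>:
  this is the non-singularity of the Cartan matrix of type \<open>A\<^bsub>m-1\<^esub>\<close>.\<close>

lemma chain_sum_eq_0:
  assumes y: "\<And>i. Suc i < m \<Longrightarrow> y i \<in> Neg 0" and sum: "(\<Sum>i<m - 1. chain i (y i)) = 0"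
    and i: "Suc i < m"
  shows "y i = 0"
proof -
  define z where "z i = (if Suc i < m then y i else 0)" for i
  have z_Neg: "z i \<in> Neg 0" for i
    using y subspace_0[OF subspace_Neg[of 0]] m4 by (simp add: z_def)
  have z0: "chain j 0 = 0" if "Suc j < m" for j by (rule module_hom.zero[OF chain_linear[OF that]])
  have step: "z (Suc k) + (if k = 0 then 0 else z (k - 1)) = z k + z k" if k: "Suc k < m" for k
  proof -
    interpret c: module_hom scale scale "chain k" by (rule chain_linear[OF k])
    let ?p = "chain k (z (Suc k))" and ?q = "chain k (if k = 0 then 0 else z (k - 1))"
    have summand: "chain i (y i) - A k (chain i (y i)) =
        (if i = k then chain k (z k) + chain k (z k) else 0) + (if i = Suc k then - ?p else 0)
        + (if Suc i = k then - ?q else 0)" if i: "i < m - 1" for i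
    proof -
      have im: "Suc i < m" "y i = z i" using i by (auto simp: z_def)
      consider "i = k" | "i = Suc k" | "Suc i = k" | "i + 2 \<le> k \<or> k + 2 \<le> i" by linarith
      then show ?thesis
      proof cases
        case 1 then show ?thesis using A_chain(1)[OF z_Neg k] im by simp
      next
        case 2 then show ?thesis using A_chain(3)[OF z_Neg, of k] im by simp
      next
        case 3 then show ?thesis using A_chain(2)[OF z_Neg, of i] im k by auto
      next
        case 4 then show ?thesis using A_chain(4)[OF z_Neg im(1) k 4] im by auto
      qed
    qed
    have "0 = (\<Sum>i<m - 1. chain i (y i)) - A k (\<Sum>i<m - 1. chain i (y i))"
      unfolding sum A_zero[OF k] by simp
    also have "\<dots> = (\<Sum>i<m - 1. chain i (y i) - A k (chain i (y i)))"
      using k by (simp add: A_sum sum_subtractf)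
    also have "\<dots> = (\<Sum>i<m - 1. (if i = k then chain k (z k) + chain k (z k) else 0)
        + (if i = Suc k then - ?p else 0) + (if Suc i = k then - ?q else 0))"
      by (rule sum.cong) (use summand in auto)
    also have "\<dots> = (chain k (z k) + chain k (z k)) + (if Suc k < m - 1 then - ?p else 0)
        + (\<Sum>i<m - 1. if Suc i = k then - ?q else 0)"
      using k less_diff_conv[of k m 1] by (simp add: sum.distrib)
    also have "(if Suc k < m - 1 then - ?p else 0) = - ?p"
      by (auto simp: z_def c.zero)
    also have "(\<Sum>i<m - 1. if Suc i = k then - ?q else 0) = - ?q"
    proof (cases k)
      case 0 then show ?thesis by (simp add: c.zero)
    next
      case (Suc l) then show ?thesis using k less_diff_conv[of l m 1] by simp
    qed
    finally have "chain k (z k + z k - z (Suc k) - (if k = 0 then 0 else z (k - 1))) = 0"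
      by (simp only: c.add c.diff) simp
    moreover have "z k + z k - z (Suc k) - (if k = 0 then 0 else z (k - 1)) \<in> Neg 0"
      using subspace_Neg[of 0] z_Neg m4 by (auto intro!: subspace_add subspace_diff simp: subspace_0)
    ultimately have "z k + z k - z (Suc k) - (if k = 0 then 0 else z (k - 1)) = 0"
      using chain_inj k by blast
    then show ?thesis by (simp add: algebra_simps)
  qed
  have z_eq: "z k = of_nat (Suc k) *s z 0 \<and> z (Suc k) = of_nat (Suc (Suc k)) *s z 0" if "Suc k < m" for k
    using that
  proof (induction k)
    case 0 then show ?case using step[of 0] scale_left_distrib[of 1 1 "z 0"] by simp
  next
    case (Suc k)
    then have IH: "z k = of_nat (Suc k) *s z 0" "z (Suc k) = of_nat (Suc (Suc k)) *s z 0" by auto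
    have "z (Suc (Suc k)) = z (Suc k) + z (Suc k) - z k"
      using step[of "Suc k"] Suc.prems by (simp add: algebra_simps)
    also have "\<dots> = (of_nat (Suc (Suc k)) + of_nat (Suc (Suc k)) - of_nat (Suc k)) *s z 0"
      unfolding IH by (simp only: scale_left_distrib scale_left_diff_distrib)
    also have "(of_nat (Suc (Suc k)) + of_nat (Suc (Suc k)) - of_nat (Suc k) :: 'a) = of_nat (Suc (Suc (Suc k)))"
      by (simp add: algebra_simps)
    finally show ?case using IH by simp
  qed
  have "Suc (m - 2) < m" using m4 by simp
  then have "z (Suc (m - 2)) = of_nat (Suc (Suc (m - 2))) *s z 0" using z_eq by blast
  moreover have "\<not> Suc (Suc (m - 2)) < m" using m4 by linarith
  then have "z (Suc (m - 2)) = 0" by (simp only: z_def if_False)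
  ultimately have "of_nat (Suc (Suc (m - 2))) *s z 0 = 0" by (simp only:)
  then have "z 0 = 0" by (simp del: of_nat_Suc)
  then show ?thesis using z_eq[OF i] i by (simp add: z_def)
qed

lemma chain_independent:
  assumes S: "finite S" "S \<subseteq> Neg 0" "independent S"
    and sum: "(\<Sum>(i, t)\<in>{..<m - 1} \<times> S. c (i, t) *s chain i t) = 0"
  shows "\<forall>p\<in>{..<m - 1} \<times> S. c p = 0"
proof -
  let ?y = "\<lambda>i. \<Sum>t\<in>S. c (i, t) *s t"
  have N: "?y i \<in> Neg 0" for i
    using S m4 by (intro subspace_sum subspace_Neg subspace_scale) auto
  have y: "chain i (?y i) = (\<Sum>t\<in>S. c (i, t) *s chain i t)" if "Suc i < m" for i
  proof -
    interpret c: module_hom scale scale "chain i" by (rule chain_linear[OF that])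
    show ?thesis by (simp add: c.sum c.scale)
  qed
  have "(\<Sum>i<m - 1. chain i (?y i)) = (\<Sum>i<m - 1. \<Sum>t\<in>S. c (i, t) *s chain i t)"
    by (rule sum.cong) (use y in auto)
  also have "\<dots> = 0" using sum by (simp add: sum.cartesian_product)
  finally have "?y i = 0" if "Suc i < m" for i
    using chain_sum_eq_0[of ?y] N that by blast
  then have "c (i, t) = 0" if "Suc i < m" "t \<in> S" for i t
    using independentD[OF S(3,1) order_refl, of "\<lambda>t. c (i, t)" t] that by blast
  then show ?thesis by auto
qed

lemma card_chain_le:
  assumes d: "dim_at_most V d" and S: "S \<subseteq> Neg 0" "independent S"
  shows "(m - 1) * card S \<le> d"
proof -
  have fS: "finite S" using dim_at_mostD(1)[OF d] S Neg_Pos(1) by blast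
  have "card ({..<m - 1} \<times> S) \<le> d"
  proof (rule card_le_dim_at_most[OF d, of _ "\<lambda>(i, t). chain i t"])
    show "finite ({..<m - 1} \<times> S)" using fS by simp
    show "(case p of (i, t) \<Rightarrow> chain i t) \<in> V" if "p \<in> {..<m - 1} \<times> S" for p
      using that S chain_V by auto
    show "\<forall>p\<in>{..<m - 1} \<times> S. c p = 0"
      if "(\<Sum>p\<in>{..<m - 1} \<times> S. c p *s (case p of (i, t) \<Rightarrow> chain i t)) = 0" for c
      using chain_independent[OF fS S, of c] that by (simp add: case_prod_unfold)
  qed
  then show ?thesis by (simp add: card_cartesian_product)
qed

end

section \<open>Representations of symmetric groups in small dimension\<close>

context coxeter_rep begin

lemma sign_on_line:
  assumes "dim_at_most (Neg 0) 1" "w \<in> Neg 0" "w \<noteq> 0" "2 \<le> j" "Suc j < m"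
  shows "A j w = w \<or> A j w = - w"
proof -
  have w: "w \<in> V" "A 0 w = - w" using assms by (auto simp: Neg_def)
  have "A j w \<in> Neg 0" using comm[of 0 j w] assms w by (simp add: Neg_def closed A_neg)
  then obtain c where c: "A j w = c *s w" using dim_at_most_1_scalar assms by blast
  have "(c * c) *s w = w" using invol[of j w] assms w by (simp add: c A_scale)
  then have "(c * c) *s w = 1 *s w" by simp
  then have "c * c = 1" using assms(3) unfolding scale_cancel_right by simp
  then have "c = 1 \<or> c = -1" by (simp add: square_eq_1_iff)
  then show ?thesis using c by auto
qed

text \<open>If the generators are reflections, then the generators disjoint from \<open>A 0\<close> act on its root by
  one common sign, by \<open>adjacent_signs\<close>. For the sign \<open>+1\<close> the roots span a standard representation,
  which is too large. For \<open>-1\<close> disjoint generators have the same root, so they are equal by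
  \<open>Neg_subset_far_imp_agree\<close>.\<close>

lemma reflections_agree:
  assumes m: "5 \<le> m" and d: "dim_at_most V d" "d < m - 1" and N: "dim_at_most (Neg 0) 1" and v: "v \<in> V"
  shows "A 0 v = A 1 v"
proof (cases "Neg 0 \<subseteq> {0}")
  case True
  then have "A 0 u = 1 *s u" if "u \<in> V" for u using diff_Neg[of 0 u] that m by auto
  then show ?thesis using m v by (intro agree_if_scalar[of 1]) auto
next
  case False
  then obtain w where w: "w \<in> Neg 0" "w \<noteq> 0" by auto
  have wV: "w \<in> V" using w Neg_Pos by auto
  have line: "\<exists>c. u = c *s w" if "u \<in> Neg 0" for u using dim_at_most_1_scalar[OF N w that] .
  have same: "A j w = A 2 w" if "2 \<le> j" "Suc j < m" for j
    using that
  proof (induction j rule: dec_induct)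
    case (step j)
    have "A j w = w \<or> A j w = - w" "A (Suc j) w = w \<or> A (Suc j) w = - w"
      using sign_on_line[OF N w] step by auto
    then have "A (Suc j) w = A j w"
      using adjacent_signs[of j w] step.prems wV w(2) by metis
    then show ?case using step by simp
  qed simp
  have "A 2 w = w \<or> A 2 w = - w" using sign_on_line[OF N w, of 2] m by simp
  then show ?thesis
  proof (elim disjE)
    assume 2: "A 2 w = w"
    interpret far_coxeter_rep scale V A m
    proof
      show "4 \<le> m" using m by simp
      fix j u assume j: "2 \<le> j" "Suc j < m" "u \<in> Neg 0"
      obtain c where "u = c *s w" using line[OF j(3)] ..
      then show "A j u = u" using same[OF j(1,2)] 2 j by (simp add: A_scale)
    qed
    have "(m - 1) * card {w} \<le> d" using w by (intro card_chain_le[OF d(1)]) auto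
    then show ?thesis using d(2) by simp
  next
    assume 2: "A 2 w = - w"
    have N2: "A 2 u = - u" if u: "u \<in> Neg 0" for u
    proof -
      obtain c where "u = c *s w" using line[OF u] ..
      then show ?thesis using 2 m by (simp add: A_scale)
    qed
    have ag: "A 0 u = A 2 u" if "u \<in> V" for u
      using Neg_subset_far_imp_agree[OF _ N2 that] m by auto
    have "\<forall>u\<in>V. A 2 u = A (Suc 2) u"
    proof
      fix u assume u: "u \<in> V"
      show "A 2 u = A (Suc 2) u"
      proof (rule agree_if_commute[OF _ _ u])
        fix t assume t: "t \<in> V"
        show "A 2 (A (Suc 2) t) = A (Suc 2) (A 2 t)"
          using comm[of 0 "Suc 2" t] ag t m by (simp add: closed)
      qed (use m in simp)
    qed
    from agree_all[OF _ this, of 1 v] show ?thesis using m v by simp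
  qed
qed

lemma Pos_twist: "Pos i = coxeter_rep.Neg V (\<lambda>i v. - A i v) i"
proof -
  interpret t: coxeter_rep scale V "\<lambda>i v. - A i v" m by (rule twist)
  show ?thesis unfolding Pos_def t.Neg_def by auto
qed

lemma reflections_agree':
  assumes m: "5 \<le> m" and d: "dim_at_most V d" "d < m - 1" and N: "dim_at_most (Pos 0) 1" and v: "v \<in> V"
  shows "A 0 v = A 1 v"
proof -
  interpret t: coxeter_rep scale V "\<lambda>i v. - A i v" m by (rule twist)
  show ?thesis using t.reflections_agree[OF m d _ v] N unfolding Pos_twist by simp
qed

lemma scalar_if_Neg_Pos_trivial:
  assumes "Suc (Suc 0) < m" "dim_at_most (Neg 0) 0 \<or> dim_at_most (Pos 0) 0"
  obtains c where "\<And>v. v \<in> V \<Longrightarrow> A 0 v = c *s v"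
proof -
  have "(\<forall>v\<in>V. A 0 v = 1 *s v) \<or> (\<forall>v\<in>V. A 0 v = (-1) *s v)"
    using assms(2) unfolding dim_at_most_0
  proof
    assume "Neg 0 \<subseteq> {0}"
    then have "v - A 0 v = 0" if "v \<in> V" for v using diff_Neg[of 0 v] assms(1) that by auto
    then show ?thesis by simp
  next
    assume "Pos 0 \<subseteq> {0}"
    then have "v + A 0 v = 0" if "v \<in> V" for v using add_Pos[of 0 v] assms(1) that by auto
    then show ?thesis by (simp add: eq_neg_iff_add_eq_0 add.commute)
  qed
  then show thesis using that by blast
qed

text \<open>The irreducible two-dimensional representation of \<open>S\<^sub>4\<close> factors through \<open>S\<^sub>3\<close>, where the images
  of \<open>(0 1)\<close> and \<open>(2 3)\<close> coincide. Concretely, if \<open>A 0\<close> is not scalar, then \<open>A 2\<close> is diagonal in the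
  same eigenbasis; it equals \<open>A 0\<close>, since \<open>A 2 = 1\<close> would make all generators trivial and
  \<open>A 2 = - A 0\<close> contradicts the two braid relations with \<open>A 1\<close>.\<close>

lemma agree_dim_2:
  assumes m: "4 \<le> m" and d: "dim_at_most V 2" and v: "v \<in> V"
  shows "A 0 v = A 2 v"
proof (cases "dim_at_most (Neg 0) 0 \<or> dim_at_most (Pos 0) 0")
  case True
  then obtain c where c: "\<And>v. v \<in> V \<Longrightarrow> A 0 v = c *s v"
    using scalar_if_Neg_Pos_trivial m by auto
  have "\<forall>v\<in>V. A 0 v = A (Suc 0) v" using agree_if_scalar[OF _ c] m by auto
  then show ?thesis using agree_all[of 0 2 v] m v by simp
next
  case False
  have m0: "Suc 0 < m" "Suc 2 < m" using m by auto
  note sub = subspace_Neg[OF m0(1)] subspace_Pos[OF m0(1)] Neg_Pos(1,2)[of 0] Neg_Pos(3)[of 0]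
  have N: "dim_at_most (Neg 0) 1" and P: "dim_at_most (Pos 0) 1"
    using dim_at_most_complement[OF d sub, of 0] False
      dim_at_most_complement[OF d sub(2,1,4,3), of 0] sub(5) by (auto simp: Int_commute)
  obtain w u where w: "w \<in> Neg 0" "w \<noteq> 0" and u: "u \<in> Pos 0" "u \<noteq> 0"
    using False unfolding dim_at_most_0 by blast
  interpret t: coxeter_rep scale V "\<lambda>i v. - A i v" m by (rule twist)
  have "- A 2 u = u \<or> - A 2 u = - u" using t.sign_on_line[of u 2] P u m unfolding Pos_twist by simp
  then have u2: "A 2 u = u \<or> A 2 u = - u" by (metis minus_minus)
  have lN: "\<exists>c. x = c *s w" if "x \<in> Neg 0" for x using dim_at_most_1_scalar[OF N w that] .
  have lP: "\<exists>c. x = c *s u" if "x \<in> Pos 0" for x using dim_at_most_1_scalar[OF P u that] .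
  have onN: "A 2 x = k *s x" if "A 2 w = k *s w" "x \<in> Neg 0" for k x
    using lN[OF that(2)] that(1) m0 by (auto simp: A_scale mult.commute)
  have onP: "A 2 x = k *s x" if "A 2 u = k *s u" "x \<in> Pos 0" for k x
    using lP[OF that(2)] that(1) m0 by (auto simp: A_scale mult.commute)
  have onNeg: "A 0 x = (-1) *s x" if "x \<in> Neg 0" for x using that by (simp add: Neg_def)
  have onPos: "A 0 x = x" if "x \<in> Pos 0" for x using that by (simp add: Pos_def)
  have "A 2 w = w \<or> A 2 w = - w" using sign_on_line[OF N w, of 2] m0 by simp
  then show ?thesis
  proof (elim disjE)
    assume "A 2 w = - w"
    then show ?thesis using onN[of "-1"] m v by (intro Neg_subset_far_imp_agree) auto
  next
    assume w2: "A 2 w = w"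
    have ext: "A 2 x = f x" if "x \<in> V" "\<And>x. x \<in> Neg 0 \<Longrightarrow> A 2 x = f x" "\<And>x. x \<in> Pos 0 \<Longrightarrow> A 2 x = f x"
        "module_hom scale scale f" for x f
    proof -
      interpret f: module_hom scale scale f by (rule that(4))
      have "A 2 (x - A 0 x) = f (x - A 0 x)" using that diff_Neg m0 by blast
      moreover have "A 2 (x + A 0 x) = f (x + A 0 x)" using that add_Pos m0 by blast
      ultimately have "A 2 ((x - A 0 x) + (x + A 0 x)) = f ((x - A 0 x) + (x + A 0 x))"
        by (simp only: A_add[OF m0(2)] f.add)
      then have "(A 2 x - f x) + (A 2 x - f x) = 0"
        using m0 by (simp add: A_add f.add algebra_simps)
      then show ?thesis by (simp only: double_eq_0) simp
    qed
    from u2 show ?thesis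
    proof
      assume u2: "A 2 u = u"
      have id: "A 2 x = x" if "x \<in> V" for x
        using onN[of 1] onP[of 1] u2 w2 by (intro ext[OF that]) (auto, unfold_locales, auto)
      have id': "A (Suc 1) x = x" if "x \<in> V" for x using id[OF that] by (simp add: numeral_2_eq_2)
      have "\<forall>x\<in>V. A 1 x = A (Suc 1) x"
      proof
        fix x assume x: "x \<in> V"
        show "A 1 x = A (Suc 1) x"
          by (rule agree_if_commute[OF _ _ x]) (use m closed[of 1] id' in auto)
      qed
      from agree_all[OF _ this, of 2 v] m v show ?thesis by simp
    next
      assume u2: "A 2 u = - u"
      interpret A0: module_hom scale scale "A 0" by (rule lin[OF m0(1)])
      have "module_hom scale scale (\<lambda>x. - A 0 x)" by (rule t.lin[OF m0(1)])
      then have neg: "A 2 x = - A 0 x" if "x \<in> V" for x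
        using onN[of 1] onP[of "-1"] u2 w2 onNeg onPos by (intro ext[OF that]) auto
      have wV: "w \<in> V" using w by (simp add: Neg_def)
      let ?b = "A (Suc 0) (A 0 (A (Suc 0) w))"
      have "A 0 (A (Suc 0) (A 0 w)) = ?b" using braid[of 0 w] m wV by simp
      moreover have "- ?b = A 0 (A (Suc 0) (A 0 w))"
        using braid[of "Suc 0" w] m wV neg by (simp add: numeral_2_eq_2 closed A_neg)
      ultimately have "?b = 0" using eq_neg_self[of ?b] by simp
      then have "A (Suc 0) (A 0 (A (Suc 0) ?b)) = 0" using m by (simp add: A_zero)
      then show ?thesis using w(2) wV m by (simp add: invol closed)
    qed
  qed
qed

end

text \<open>For \<open>m \<ge> 7\<close> pass to the action of \<open>S\<^bsub>m-2\<^esub>\<close> on the eigenspaces of \<open>A 0\<close>. If both are non-zero, their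
  dimensions are at most \<open>(m + 2) div 2 - 1\<close>, which is the bound for \<open>m - 2\<close>. The cases \<open>m = 5\<close> and
  \<open>m = 6\<close>, where the dimension is at most \<open>3\<close> and \<open>4\<close>, start the induction: one eigenspace is at most
  a line, and \<open>reflections_agree\<close> applies up to a twist, or \<open>m = 6\<close> and both are planes, and
  \<open>agree_dim_2\<close> applies to the group \<open>S\<^sub>4\<close> acting on each of them.\<close>

lemma (in scalar_space) small_coxeter_rep_agree:
  assumes "coxeter_rep scale V A m" "5 \<le> m" "dim_at_most V ((m + 2) div 2)" "v \<in> V"
  shows "A 0 v = A 1 v"
  using assms
proof (induction m arbitrary: V A v rule: less_induct)
  case (less m)
  interpret coxeter_rep scale V A m by (rule less.prems)
  note m = less.prems(2) and d = less.prems(3) and v = less.prems(4)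
  have m0: "Suc 0 < m" "Suc (Suc 0) < m" "2 \<le> m" using m by auto
  note sub = subspace_Neg[OF m0(1)] subspace_Pos[OF m0(1)] Neg_Pos(1,2)[of 0] Neg_Pos(3)[of 0]
  have dN: "dim_at_most (Neg 0) ((m + 2) div 2 - Suc k)" if "\<not> dim_at_most (Pos 0) k" for k
    by (rule dim_at_most_complement[OF d sub that])
  have dP: "dim_at_most (Pos 0) ((m + 2) div 2 - Suc k)" if "\<not> dim_at_most (Neg 0) k" for k
    using sub(5) by (intro dim_at_most_complement[OF d sub(2,1,4,3) _ that]) auto
  consider "dim_at_most (Neg 0) 0 \<or> dim_at_most (Pos 0) 0"
    | "m \<le> 6" "dim_at_most (Neg 0) 1" | "m \<le> 6" "dim_at_most (Pos 0) 1"
    | "m = 6" "\<not> dim_at_most (Neg 0) 1" "\<not> dim_at_most (Pos 0) 1"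
    | "7 \<le> m" "\<not> dim_at_most (Neg 0) 0" "\<not> dim_at_most (Pos 0) 0"
  proof -
    have "dim_at_most (Neg 0) 1 \<or> dim_at_most (Pos 0) 1" if "m = 5"
      using dN[of 1] that by auto
    then show thesis using m that by force
  qed
  then show ?case
  proof cases
    case 1
    then obtain c where "\<And>u. u \<in> V \<Longrightarrow> A 0 u = c *s u"
      using scalar_if_Neg_Pos_trivial m0 by metis
    then show ?thesis using m0 v by (intro agree_if_scalar) auto
  next
    case 2
    then show ?thesis using m by (intro reflections_agree[OF _ d _ _ v]) auto
  next
    case 3
    then show ?thesis using m by (intro reflections_agree'[OF _ d _ _ v]) auto
  next
    case 4
    have d2: "dim_at_most (Neg 0) 2" "dim_at_most (Pos 0) 2"
      using dN[OF 4(3)] dP[OF 4(2)] 4(1) by auto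
    have N: "A 2 u = A 4 u" if "u \<in> Neg 0" for u
      using coxeter_rep.agree_dim_2[OF restrict_Neg_Pos(1)[OF m0(3)] _ d2(1) that] 4(1) by (simp add: eval_nat_numeral)
    have P: "A 2 u = A 4 u" if "u \<in> Pos 0" for u
      using coxeter_rep.agree_dim_2[OF restrict_Neg_Pos(2)[OF m0(3)] _ d2(2) that] 4(1) by (simp add: eval_nat_numeral)
    have eq: "A 2 u = A 4 u" if "u \<in> V" for u
      by (rule agree_if_Neg_Pos[OF _ _ _ N P that, of 0]) (use 4 in auto)
    have 12: "\<forall>u\<in>V. A 1 u = A (Suc 1) u"
    proof
      fix u assume u: "u \<in> V"
      show "A 1 u = A (Suc 1) u"
      proof (rule agree_if_commute[OF _ _ u])
        fix t assume t: "t \<in> V"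
        then have "A 1 (A 4 t) = A 4 (A 1 t)" using 4(1) by (intro comm) auto
        then show "A 1 (A (Suc 1) t) = A (Suc 1) (A 1 t)"
          using eq[OF t] eq[of "A 1 t"] closed[of 1 t] t 4(1) by (simp add: eval_nat_numeral)
      qed (use 4 in simp)
    qed
    show ?thesis using agree_all[OF _ 12, of 1 v] 4(1) v by simp
  next
    case 5
    have half: "(m + 2) div 2 - Suc 0 = (m - 2 + 2) div 2" using 5 by simp
    have d2: "dim_at_most (Neg 0) ((m - 2 + 2) div 2)" "dim_at_most (Pos 0) ((m - 2 + 2) div 2)"
      using dN[OF 5(3)] dP[OF 5(2)] unfolding half by auto
    have le: "m - 2 < m" "5 \<le> m - 2" using 5 by auto
    have N: "A 2 u = A 3 u" if "u \<in> Neg 0" for u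
      using less.IH[OF le(1) restrict_Neg_Pos(1)[OF m0(3)] le(2) d2(1) that] by (simp add: eval_nat_numeral)
    have P: "A 2 u = A 3 u" if "u \<in> Pos 0" for u
      using less.IH[OF le(1) restrict_Neg_Pos(2)[OF m0(3)] le(2) d2(2) that] by (simp add: eval_nat_numeral)
    have "A 2 u = A (Suc 2) u" if "u \<in> V" for u
      using agree_if_Neg_Pos[OF _ _ m0(1) N P that] 5 by simp
    then have 23: "\<forall>u\<in>V. A 2 u = A (Suc 2) u" by blast
    show ?thesis using agree_all[OF _ 23, of 1 v] 5(1) v by simp
  qed
qed

section \<open>Irreducible representations of the welded braid group\<close>

text \<open>The last assumptions say that \<open>V\<close> has dimension exactly \<open>n\<close>. The assumption on an eigenvector
  stands in for algebraic closedness of the field. The bound on \<open>n\<close> makes \<open>S\<^bsub>n-2\<^esub>\<close> large enough for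
  \<open>small_coxeter_rep_agree\<close>.\<close>

locale welded_rep = coxeter_rep scale V A n
  for scale :: "'a::field_char_0 \<Rightarrow> 'b::ab_group_add \<Rightarrow> 'b" (infixr "*s" 75)
    and V A n +
  fixes s :: "nat \<Rightarrow> 'b \<Rightarrow> 'b"
  assumes s_lin: "Suc i < n \<Longrightarrow> module_hom scale scale (s i)"
    and s_closed: "Suc i < n \<Longrightarrow> v \<in> V \<Longrightarrow> s i v \<in> V"
    and s_inj: "Suc i < n \<Longrightarrow> v \<in> V \<Longrightarrow> s i v = 0 \<Longrightarrow> v = 0"
    and s_comm: "i + 2 \<le> j \<Longrightarrow> Suc j < n \<Longrightarrow> v \<in> V \<Longrightarrow> s i (s j v) = s j (s i v)"
    and A_s_comm: "i + 2 \<le> j \<or> j + 2 \<le> i \<Longrightarrow> Suc i < n \<Longrightarrow> Suc j < n \<Longrightarrow> v \<in> V \<Longrightarrow>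
      A i (s j v) = s j (A i v)"
    and s_braid: "Suc (Suc i) < n \<Longrightarrow> v \<in> V \<Longrightarrow> s i (s (Suc i) (s i v)) = s (Suc i) (s i (s (Suc i) v))"
    and A_A_s: "Suc (Suc i) < n \<Longrightarrow> v \<in> V \<Longrightarrow> A i (A (Suc i) (s i v)) = s (Suc i) (A i (A (Suc i) v))"
    and s_s_A: "Suc (Suc i) < n \<Longrightarrow> v \<in> V \<Longrightarrow> s i (s (Suc i) (A i v)) = A (Suc i) (s i (s (Suc i) v))"
    and irreducible: "subspace W \<Longrightarrow> W \<subseteq> V \<Longrightarrow> (\<And>i v. Suc i < n \<Longrightarrow> v \<in> W \<Longrightarrow> s i v \<in> W) \<Longrightarrow>
      W = {0} \<or> W = V"
    and eigenvector: "\<exists>v\<in>V. v \<noteq> 0 \<and> (\<exists>c. s 0 v = c *s v)"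
    and n: "7 \<le> n"
    and dim_V: "dim_at_most V n" "\<not> dim_at_most V (n - 1)"
begin

lemmas s_add = module_hom.add[OF s_lin]
lemmas s_scale = module_hom.scale[OF s_lin]
lemmas s_diff = module_hom.diff[OF s_lin]
lemmas s_neg = module_hom.neg[OF s_lin]
lemmas s_sum = module_hom.sum[OF s_lin]

lemma s_Suc:
  assumes "Suc (Suc i) < n" "v \<in> V"
  shows "s (Suc i) v = A i (A (Suc i) (s i (A (Suc i) (A i v))))"
  using A_A_s[OF assms(1), of "A (Suc i) (A i v)"] assms by (simp add: closed invol)

lemma invariant_subspace:
  assumes W: "subspace W" "W \<subseteq> V" and A: "\<And>i v. Suc i < n \<Longrightarrow> v \<in> W \<Longrightarrow> A i v \<in> W"
    and s0: "\<And>v. v \<in> W \<Longrightarrow> s 0 v \<in> W"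
  shows "W = {0} \<or> W = V"
proof (rule irreducible[OF W])
  show "Suc i < n \<Longrightarrow> v \<in> W \<Longrightarrow> s i v \<in> W" for i v
  proof (induction i arbitrary: v)
    case 0 then show ?case using s0 by simp
  next
    case (Suc i)
    then have "v \<in> V" using W by auto
    then show ?case using s_Suc[of i v] Suc A by simp
  qed
qed

text \<open>If the \<open>A i\<close> coincide, then so do the \<open>s i\<close> by \<open>s_Suc\<close>, and the line through an eigenvector is
  invariant.\<close>

lemma not_agree: "\<not> (\<forall>v\<in>V. A 0 v = A (Suc 0) v)"
proof
  assume a: "\<forall>v\<in>V. A 0 v = A (Suc 0) v"
  have all: "A i v = A 0 v" if "Suc i < n" "v \<in> V" for i v
    using agree_all[OF _ a that] n by simp
  obtain v c where v: "v \<in> V" "v \<noteq> 0" "s 0 v = c *s v" using eigenvector by blast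
  have s: "Suc i < n \<Longrightarrow> u \<in> V \<Longrightarrow> s i u = s 0 u" for i u
  proof (induction i arbitrary: u)
    case (Suc i)
    have i: "Suc i < n" "Suc (Suc i) < n" "0 < n" "Suc 0 < n" using Suc.prems by auto
    have inv: "A i (A (Suc i) t) = t" "A (Suc i) (A i t) = t" if "t \<in> V" for t
      using all[OF i(1)] all[OF i(2)] that i by (simp_all add: closed invol)
    show ?case using s_Suc[OF i(2) Suc.prems(2)] inv Suc.prems Suc.IH[OF i(1)] i
      by (simp add: s_closed)
  qed simp
  have sub: "span {v} \<subseteq> V" using v V by (simp add: span_minimal)
  have "span {v} = {0} \<or> span {v} = V"
  proof (rule irreducible[OF subspace_span sub])
    fix i u assume "Suc i < n" "u \<in> span {v}"
    moreover then obtain d where "u = d *s v" by (auto simp: span_singleton)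
    ultimately show "s i u \<in> span {v}" using s[of i v] v by (simp add: s_scale span_scale span_base)
  qed
  moreover have "v \<in> span {v}" by (simp add: span_base)
  ultimately have "V \<subseteq> span {v}" using v(2) by auto
  then have "dim_at_most V (card {v})" by (intro dim_at_most_span) auto
  then have "dim_at_most V (n - 1)" by (rule dim_at_most_subset) (use n in auto)
  then show False using dim_V(2) by simp
qed

text \<open>The middle condition is linear independence; as the dimension is \<open>n\<close>, the family is a basis.\<close>

definition perm_basis :: "(nat \<Rightarrow> 'b) \<Rightarrow> bool" where
  "perm_basis e \<longleftrightarrow> (\<forall>i<n. e i \<in> V) \<and> (\<forall>c. (\<Sum>i<n. c i *s e i) = 0 \<longrightarrow> (\<forall>i<n. c i = 0)) \<and>
     (\<forall>k i. Suc k < n \<longrightarrow> i < n \<longrightarrow>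
        A k (e i) = (if i = k then e (Suc k) else if i = Suc k then e k else e i))"

end

locale welded_rep_small_Neg = welded_rep +
  assumes dim_Neg0: "dim_at_most (Neg 0) (n div 2)"
begin

lemma agree_Neg_0:
  assumes v: "v \<in> Neg 0" and j: "2 \<le> j" "Suc j < n"
  shows "A j v = A 2 v"
proof -
  have n2: "2 \<le> n" "5 \<le> n - 2" using n by auto
  interpret r: coxeter_rep scale "Neg 0" "\<lambda>i. A (i + 2)" "n - 2" by (rule restrict_Neg_Pos[OF n2(1)])
  have half: "(n - 2 + 2) div 2 = n div 2" using n by simp
  have "dim_at_most (Neg 0) ((n - 2 + 2) div 2)" unfolding half by (rule dim_Neg0)
  from small_coxeter_rep_agree[OF r.coxeter_rep_axioms n2(2) this]
  have "\<forall>u\<in>Neg 0. A (0 + 2) u = A (Suc 0 + 2) u" by simp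
  then have "A (j - 2 + 2) v = A (0 + 2) v" using v j n by (intro r.agree_all[of 0]) auto
  moreover have "j - 2 + 2 = j" using j by simp
  ultimately show ?thesis by (simp only: add_0)
qed

text \<open>The mirror image of \<open>agree_Neg_0\<close> at the other end of the diagram.\<close>

lemma agree_Neg_last:
  assumes v: "v \<in> Neg (n - 2)" and j: "Suc j < n - 2"
  shows "A j v = A 0 v"
proof -
  have n2: "5 \<le> n - 2" and last: "Suc (n - 2) < n" using n by auto
  interpret r: coxeter_rep scale "Neg (n - 2)" "\<lambda>i. A (i + 0)" "n - 2"
  proof (rule restrict[OF subspace_Neg[OF last] Neg_Pos(1)])
    fix i u assume i: "Suc i < n - 2" and u: "u \<in> Neg (n - 2)"
    have "A i (A (n - 2) u) = A (n - 2) (A i u)" using i u by (intro comm) (auto simp: Neg_def)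
    then show "A (i + 0) u \<in> Neg (n - 2)" using i u by (simp add: Neg_def closed A_neg)
  qed simp
  have half: "(n - 2 + 2) div 2 = n div 2" using n by simp
  have "dim_at_most (Neg (n - 2)) ((n - 2 + 2) div 2)" unfolding half by (rule dim_Neg[OF dim_Neg0 last])
  from small_coxeter_rep_agree[OF r.coxeter_rep_axioms n2 this]
  have "\<forall>u\<in>Neg (n - 2). A (0 + 0) u = A (Suc 0 + 0) u" by simp
  from r.agree_all[OF _ this, of j v] show ?thesis using v j n by simp
qed

text \<open>Let \<open>W\<close> consist of the vectors negated by \<open>A 2\<close> and \<open>A (n - 2)\<close>. By \<open>agree_Neg_last\<close> they are
  negated by \<open>A 0\<close> and \<open>A 1\<close>, and then by \<open>agree_Neg_0\<close> by all generators. As both \<open>A 2\<close> and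
  \<open>A (n - 2)\<close> commute with \<open>s 0\<close>, the subspace \<open>W\<close> is invariant; it is not \<open>V\<close> by \<open>not_agree\<close>.\<close>

lemma no_sign_vector:
  assumes v: "v \<in> V" "A 2 v = - v" "A (n - 2) v = - v"
  shows "v = 0"
proof -
  define W where "W = {v \<in> V. A 2 v = - v \<and> A (n - 2) v = - v}"
  have m: "Suc 0 < n" "Suc 2 < n" "Suc (n - 2) < n" "n - 2 \<noteq> 0" using n by auto
  have W: "subspace W"
  proof (rule subspaceI)
    show "0 \<in> W" using subspace_0[OF V] m by (simp add: W_def A_zero)
    show "u + t \<in> W" if "u \<in> W" "t \<in> W" for u t
      using that subspace_add[OF V] m by (simp add: W_def A_add)
    show "c *s u \<in> W" if "u \<in> W" for c u
      using that subspace_scale[OF V] m by (simp add: W_def A_scale)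
  qed
  have neg: "A i u = - u" if u: "u \<in> W" and i: "Suc i < n" for i u
  proof -
    have u': "u \<in> V" "A 2 u = - u" "u \<in> Neg (n - 2)" using u by (auto simp: W_def Neg_def)
    have "Suc 2 < n - 2" "Suc 1 < n - 2" using n by auto
    note eq = agree_Neg_last[OF u'(3) this(1)] agree_Neg_last[OF u'(3) this(2)]
    have 01: "A 0 u = - u" "A 1 u = - u" using eq u'(2) by simp_all
    show ?thesis
    proof (cases "2 \<le> i")
      case True
      have "u \<in> Neg 0" using u' 01 by (simp add: Neg_def)
      from agree_Neg_0[OF this True i] show ?thesis using u' by simp
    next
      case False
      then have "i = 0 \<or> i = 1" by auto
      then show ?thesis using 01 by auto
    qed
  qed
  have "W = {0} \<or> W = V"
  proof (rule invariant_subspace[OF W])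
    show "W \<subseteq> V" by (auto simp: W_def)
    show "A i u \<in> W" if "Suc i < n" "u \<in> W" for i u
      using neg[OF that(2,1)] that(2) subspace_neg[OF W] by simp
    show "s 0 u \<in> W" if "u \<in> W" for u
    proof -
      have u: "u \<in> V" "A 2 u = - u" "A (n - 2) u = - u" using that by (auto simp: W_def)
      have "A 2 (s 0 u) = s 0 (A 2 u)" "A (n - 2) (s 0 u) = s 0 (A (n - 2) u)"
        using m n u by (intro A_s_comm; auto)+
      then show ?thesis using u m by (simp add: W_def s_closed s_neg)
    qed
  qed
  moreover have "W \<noteq> V" using neg[of _ 0] neg[of _ "Suc 0"] not_agree m n by auto
  ultimately show ?thesis using v by (auto simp: W_def)
qed

sublocale far_coxeter_rep scale V A n
proof
  show "4 \<le> n" using n by simp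
  fix j v assume j: "2 \<le> j" "Suc j < n" and v: "v \<in> Neg 0"
  have m: "Suc 0 < n" "Suc 2 < n" "Suc (n - 2) < n" using n by auto
  have v': "v \<in> V" "A 0 v = - v" using v by (auto simp: Neg_def)
  let ?u = "v - A 2 v"
  have "A 0 (A 2 v) = A 2 (A 0 v)" using m v' by (intro comm) auto
  then have "A 2 v \<in> Neg 0" using v' m by (simp add: Neg_def closed A_neg)
  then have uN: "?u \<in> Neg 0" using subspace_diff[OF subspace_Neg[OF m(1)] v] by simp
  have u2: "A 2 ?u = - ?u" using v' m by (simp add: A_diff invol)
  moreover have "A (n - 2) ?u = A 2 ?u" using n by (intro agree_Neg_0[OF uN]) auto
  ultimately have "?u = 0" using uN by (intro no_sign_vector) (simp_all add: Neg_def)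
  then show "A j v = v" using agree_Neg_0[OF v j] by simp
qed

text \<open>Two independent vectors in \<open>Neg 0\<close> would yield \<open>2 (n - 1) > n\<close> independent vectors in \<open>V\<close>.\<close>

lemma dim_Neg_1: "Suc i < n \<Longrightarrow> dim_at_most (Neg i) 1"
proof (rule dim_Neg)
  show "dim_at_most (Neg 0) 1" unfolding dim_at_most_def
  proof (intro allI impI)
    fix S assume S: "S \<subseteq> Neg 0 \<and> independent S"
    have "(n - 1) * card S \<le> n" using S by (intro card_chain_le[OF dim_V(1)]) auto
    moreover have "n < (n - 1) * 2" using n by simp
    ultimately have "(n - 1) * card S < (n - 1) * 2" by linarith
    then have "card S < 2" by (simp only: mult_less_cancel1)
    then show "finite S \<and> card S \<le> 1" using S dim_at_mostD(1)[OF dim_Neg0] by auto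
  qed
qed

text \<open>The roots \<open>w\<^sub>0, \<dots>, w\<^bsub>n-2\<^esub>\<close> span a copy \<open>W\<close> of the standard representation, of dimension \<open>n - 1\<close>.
  A vector outside \<open>W\<close> is corrected by elements of \<open>W\<close> until it is a vector \<open>f\<close> fixed by all
  generators. Adding a multiple of \<open>f\<close> to the projections of the permuted basis vectors to \<open>W\<close>
  gives the basis.\<close>

lemma perm_basis_exists: "\<exists>e. perm_basis e"
proof -
  have m: "Suc 0 < n" "Suc (n - 2) < n" using n by auto
  have "\<not> Neg 0 \<subseteq> {0}"
  proof
    assume "Neg 0 \<subseteq> {0}"
    then have "A 0 v = 1 *s v" if "v \<in> V" for v using diff_Neg[OF m(1) that] by auto
    then show False using agree_if_scalar[of 1] not_agree n by auto
  qed
  then obtain w where w: "w \<in> Neg 0" "w \<noteq> 0" by auto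
  let ?w = "\<lambda>i. chain i w"
  let ?W = "span (?w ` {..<n - 1})"
  have wV: "?w i \<in> V" if "Suc i < n" for i using chain_V[OF w(1) that] .
  have w0: "?w i \<noteq> 0" if "Suc i < n" for i using chain_inj[OF w(1) that] w(2) by blast
  have wW: "?w i \<in> ?W" if "Suc i < n" for i using that by (auto intro: span_base)
  note Aw = A_chain[OF w(1)]
  \<comment> \<open>With \<open>w\<^sub>j = e\<^sub>j - e\<^bsub>j+1\<^esub>\<close> this is \<open>x k = e\<^sub>0 + \<dots> + e\<^sub>k - (k + 1) e\<^bsub>k+1\<^esub>\<close>, which the first \<open>k\<close>
    generators fix.\<close>
  define x where "x k = (\<Sum>j<Suc k. of_nat (Suc j) *s ?w j)" for k
  have xV: "x k \<in> V" "x k \<in> ?W" if k: "Suc k < n" for k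
  proof -
    have j: "Suc j < n" if "j \<in> {..<Suc k}" for j using that k by auto
    show "x k \<in> V" unfolding x_def by (intro subspace_sum[OF V] subspace_scale[OF V] wV j)
    show "x k \<in> ?W" unfolding x_def by (intro span_sum span_scale wW j)
  qed
  have Ax: "Suc k < n \<Longrightarrow> \<forall>i. Suc i < n \<longrightarrow> A i (x k) = x k + (if i = k then - (of_nat (k + 2) *s ?w k)
      else if i = Suc k then of_nat (k + 1) *s ?w (Suc k) else 0)" for k
  proof (induction k)
    case 0
    show ?case
    proof (intro allI impI)
      fix i assume i: "Suc i < n"
      have x0: "x 0 = w" by (simp add: x_def)
      have two: "of_nat (0 + 2) *s ?w 0 = w + w" using scale_left_distrib[of 1 1 w] by simp
      have "w + - (of_nat (0 + 2) *s ?w 0) = - w" unfolding two by simp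
      moreover consider "i = 0" | "i = Suc 0" | "0 + 2 \<le> i" by linarith
      ultimately show "A i (x 0) = x 0 + (if i = 0 then - (of_nat (0 + 2) *s ?w 0)
          else if i = Suc 0 then of_nat (0 + 1) *s ?w (Suc 0) else 0)"
        unfolding x0 using Aw(1)[of 0] Aw(2)[of 0] Aw(4)[of 0 i] i by cases auto
    qed
  next
    case (Suc k)
    have k: "Suc k < n" using Suc.prems by simp
    show ?case
    proof (intro allI impI)
      fix i assume i: "Suc i < n"
      have x_Suc: "x (Suc k) = x k + of_nat (k + 2) *s ?w (Suc k)"
        by (simp add: x_def)
      have "A i (x (Suc k)) = A i (x k) + of_nat (k + 2) *s A i (?w (Suc k))"
        unfolding x_Suc using i by (simp only: A_add A_scale)
      also have "A i (x k) = x k + (if i = k then - (of_nat (k + 2) *s ?w k)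
          else if i = Suc k then of_nat (k + 1) *s ?w (Suc k) else 0)" using Suc.IH k i by blast
      finally have A: "A i (x (Suc k)) = x k + (if i = k then - (of_nat (k + 2) *s ?w k)
          else if i = Suc k then of_nat (k + 1) *s ?w (Suc k) else 0) + of_nat (k + 2) *s A i (?w (Suc k))" .
      have coeff: "of_nat (k + 1) *s ?w (Suc k) - of_nat (k + 2) *s ?w (Suc k)
          = of_nat (k + 2) *s ?w (Suc k) - of_nat (Suc k + 2) *s ?w (Suc k)"
        unfolding scale_left_diff_distrib[symmetric] by simp
      consider "i = k" | "i = Suc k" | "i = Suc (Suc k)" | "Suc k + 2 \<le> i \<or> i + 2 \<le> Suc k" by linarith
      then show "A i (x (Suc k)) = x (Suc k) + (if i = Suc k then - (of_nat (Suc k + 2) *s ?w (Suc k))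
          else if i = Suc (Suc k) then of_nat (Suc k + 1) *s ?w (Suc (Suc k)) else 0)"
      proof cases
        case 1
        then show ?thesis unfolding A unfolding x_Suc using Aw(3)[OF Suc.prems]
          by (simp add: scale_right_distrib del: chain.simps of_nat_add)
      next
        case 2
        then show ?thesis unfolding A unfolding x_Suc using Aw(1)[OF Suc.prems] coeff
          by (simp add: algebra_simps del: chain.simps of_nat_add of_nat_Suc add_2_eq_Suc add_2_eq_Suc' Suc_eq_plus1_left add_Suc)
      next
        case 3
        have "A i (?w (Suc k)) = ?w (Suc k) + ?w (Suc (Suc k))" using Aw(2)[of "Suc k"] i 3 by simp
        then show ?thesis unfolding A unfolding x_Suc using 3
          by (simp add: scale_right_distrib algebra_simps del: chain.simps of_nat_add of_nat_Suc)
      next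
        case 4
        then show ?thesis unfolding A unfolding x_Suc using Aw(4)[OF Suc.prems i 4] by auto
      qed
    qed
  qed
  have fixed: "k < n \<Longrightarrow> \<exists>u. u \<in> V \<and> u \<notin> ?W \<and> (\<forall>i<k. A i u = u)" for k
  proof (induction k)
    case 0
    have "\<not> V \<subseteq> ?W"
    proof
      assume "V \<subseteq> ?W"
      then have "dim_at_most V (card (?w ` {..<n - 1}))" by (intro dim_at_most_span) auto
      then have "dim_at_most V (n - 1)"
        by (rule dim_at_most_subset) (use card_image_le[of "{..<n - 1}" ?w] in auto)
      then show False using dim_V by simp
    qed
    then show ?case by auto
  next
    case (Suc k)
    then obtain u where u: "u \<in> V" "u \<notin> ?W" "\<forall>i<k. A i u = u" by auto
    obtain a where a: "u - A k u = a *s ?w k"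
      using dim_at_most_1_scalar[OF dim_Neg_1 chain_Neg[OF w(1)] w0 diff_Neg] Suc.prems u by blast
    define b where "b = a / of_nat (k + 2)"
    have b: "b * of_nat (k + 2) = a" unfolding b_def by (simp del: of_nat_add of_nat_Suc)
    let ?u = "u - b *s x k"
    have "?u \<in> V" using u xV Suc.prems V by (auto intro: subspace_diff subspace_scale)
    moreover have "?u \<notin> ?W"
    proof
      assume "?u \<in> ?W"
      then have "?u + b *s x k \<in> ?W" using xV Suc.prems by (intro span_add span_scale) auto
      then show False using u by simp
    qed
    moreover have "A i ?u = ?u" if "i < Suc k" for i
    proof (cases "i = k")
      case True
      have "A k u = u - a *s ?w k" using a by (simp add: algebra_simps)
      then show ?thesis
        using True Suc.prems Ax[of k] b
        by (simp add: A_diff A_scale A_add A_neg scale_right_distrib scale_right_diff_distrib del: of_nat_add of_nat_Suc chain.simps)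
    next
      case False
      then show ?thesis using that u Suc.prems Ax[of k] by (simp add: A_diff A_scale)
    qed
    ultimately show ?case by blast
  qed
  obtain f where f: "f \<in> V" "f \<notin> ?W" "\<forall>i<n - 1. A i f = f" using fixed[of "n - 1"] n by auto
  \<comment> \<open>Here \<open>- x (n - 2) / n\<close> is the projection of \<open>e\<^bsub>n-1\<^esub>\<close> to \<open>W\<close>, and \<open>e\<^sub>i = e\<^bsub>n-1\<^esub> + w\<^sub>i + \<dots> + w\<^bsub>n-2\<^esub>\<close>.\<close>
  define e where "e i = f - (1 / of_nat n) *s x (n - 2) + (\<Sum>j\<in>{i..<n - 1}. ?w j)" for i
  have e_step: "e i = e (Suc i) + ?w i" if "Suc i < n" for i
    using that by (simp add: e_def sum.atLeast_Suc_lessThan)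
  have eV: "e i \<in> V" for i
    unfolding e_def using f xV[OF m(2)] wV V by (auto intro!: subspace_add subspace_diff subspace_sum subspace_scale)
  have efW: "e i - f \<in> ?W" for i
    unfolding e_def using xV[OF m(2)] wW by (auto intro!: span_add span_diff span_sum span_scale simp: algebra_simps)
  have last: "A k (e (n - 1)) = (if k = n - 2 then e (n - 2) else e (n - 1))" if k: "Suc k < n" for k
  proof -
    have e1: "e (n - Suc 0) = f - (1 / of_nat n) *s x (n - 2)" by (simp add: e_def)
    have Af: "A k f = f" using f k by simp
    show ?thesis
    proof (cases "k = n - 2")
      case True
      have "Suc (n - 2) = n - 1" using n by simp
      then have "e (n - 2) = e (n - 1) + ?w (n - 2)" using e_step[OF m(2)] by (simp only:)
      moreover have "n - 2 + 2 = n" using n by simp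
      then have "A (n - 2) (x (n - 2)) = x (n - 2) - of_nat n *s ?w (n - 2)" using Ax[OF m(2)] m(2) by simp
      ultimately show ?thesis using True Af m n
        by (simp add: e1 A_diff A_scale scale_right_diff_distrib)
    next
      case False
      moreover have "k \<noteq> Suc (n - 2)" using k by linarith
      ultimately have "A k (x (n - 2)) = x (n - 2)" using Ax[OF m(2)] k by simp
      then show ?thesis using False Af k by (simp add: e1 A_diff A_scale)
    qed
  qed
  have Ae: "A k (e i) = (if i = k then e (Suc k) else if i = Suc k then e k else e i)"
    if "i < n" "Suc k < n" for i k
  proof -
    have "i \<le> n - 1" using that by simp
    then show ?thesis
    proof (induction i rule: inc_induct)
      case base
      have "Suc (n - 2) = n - 1" using n by simp
      then show ?case using last[OF that(2)] that(2) by auto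
    next
      case (step i)
      have i: "Suc i < n" using step by simp
      have sum: "A k (e i) = A k (e (Suc i)) + A k (?w i)" unfolding e_step[OF i] using that by (simp add: A_add)
      consider "k = i" | "k = Suc i" | "Suc k = i" | "i + 2 \<le> k \<or> k + 2 \<le> i" by linarith
      then show ?case
      proof cases
        case 1 then show ?thesis using sum step.IH Aw(1)[OF i] e_step[OF i] by simp
      next
        case 2 then show ?thesis using sum step.IH Aw(2)[of i] e_step[OF i] e_step[of "Suc i"] that by (simp del: chain.simps)
      next
        case 3 then show ?thesis using sum step.IH Aw(3)[of k] e_step[OF i] e_step[of k] i by (auto simp del: chain.simps)
      next
        case 4 then show ?thesis using sum step.IH Aw(4)[OF i that(2)] e_step[OF i] by (auto simp del: chain.simps)
      qed
    qed
  qed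
  have "\<forall>i<n. c i = 0" if c: "(\<Sum>i<n. c i *s e i) = 0" for c
  proof -
    have adj: "c k = c (Suc k)" if k: "Suc k < n" for k
    proof -
      have "0 = (\<Sum>i<n. c i *s e i) - A k (\<Sum>i<n. c i *s e i)" unfolding c using A_zero[OF k] by simp
      also have "\<dots> = (\<Sum>i<n. c i *s (e i - A k (e i)))"
        using k by (simp add: A_sum A_scale sum_subtractf scale_right_diff_distrib)
      also have "\<dots> = (\<Sum>i<n. (if i = k then c k *s ?w k else 0) + (if i = Suc k then - (c (Suc k) *s ?w k) else 0))"
        using k by (intro sum.cong HOL.refl) (auto simp: Ae e_step[OF k])
      also have "\<dots> = (c k - c (Suc k)) *s ?w k"
        using k by (simp add: sum.distrib scale_left_diff_distrib)
      finally show ?thesis using w0[OF k] by simp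
    qed
    have c0: "k < n \<Longrightarrow> c k = c 0" for k
      by (induction k) (use adj in auto)
    have "c i *s e i = c 0 *s e i" if "i \<in> {..<n}" for i
      unfolding c0[OF that[unfolded lessThan_iff]] ..
    then have "(\<Sum>i<n. c i *s e i) = (\<Sum>i<n. c 0 *s e i)" by (rule sum.cong[OF HOL.refl])
    then have "0 = (\<Sum>i<n. c 0 *s e i)" by (simp only: c)
    also have "\<dots> = (\<Sum>i<n. c 0 *s (e i - f)) + (of_nat n * c 0) *s f"
      by (simp add: scale_right_diff_distrib sum_subtractf sum_constant_scale scale_sum_right)
    finally have "(of_nat n * c 0) *s f = - (\<Sum>i<n. c 0 *s (e i - f))"
      by (simp add: eq_neg_iff_add_eq_0 add.commute)
    moreover have "- (\<Sum>i<n. c 0 *s (e i - f)) \<in> ?W" using efW by (intro span_neg span_sum span_scale) auto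
    ultimately have "(of_nat n * c 0) *s f \<in> ?W" by simp
    then have "(1 / (of_nat n * c 0)) *s (of_nat n * c 0) *s f \<in> ?W" by (rule span_scale)
    then have "c 0 = 0" using f(2) n by (cases "c 0 = 0") auto
    show ?thesis
    proof (intro allI impI)
      fix i assume "i < n"
      from c0[OF this] show "c i = 0" unfolding \<open>c 0 = 0\<close> .
    qed
  qed
  then have pb: "perm_basis e" unfolding perm_basis_def using eV Ae by auto
  show ?thesis by (intro exI) (rule pb)
qed

end

section \<open>The braid generators in a permuted basis\<close>

text \<open>Put \<open>\<alpha> = (a11 + a12, a21 + a22, c + g)\<close>, \<open>\<beta> = (p, q, r)\<close>, \<open>\<gamma> = (c, g, r)\<close> and
  \<open>\<delta> = (a11 + a21 + N c, a12 + a22 + N g, p + q + N r)\<close>. The eight equations say that the matrix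
  \<open>\<alpha> \<gamma>\<^sup>T + \<beta> \<delta>\<^sup>T\<close> vanishes except perhaps in its last entry. Because \<open>\<delta>\<^sub>1\<close> or \<open>\<delta>\<^sub>2\<close> is non-zero, \<open>\<beta>\<close> is a
  multiple \<open>- k \<alpha>\<close> of \<open>\<alpha>\<close>; because \<open>\<alpha> + N \<beta>\<close> is non-zero in one of the first two places, so are
  \<open>1 - N k\<close> and one of \<open>\<alpha>\<^sub>1\<close>, \<open>\<alpha>\<^sub>2\<close>, and then \<open>\<gamma> = k \<delta>\<close>. The conclusion restates this for
  \<open>x = k / (1 - N k)\<close>, the translation that is applied in \<open>straightened_basis\<close>.\<close>

lemma rank_one_relations_solution:
  fixes N p q r c g a11 a12 a21 a22 :: "'a :: field"
  assumes 3: "(p + q + N * r) * p + r * (a11 + a12) = 0" "(p + q + N * r) * q + r * (a21 + a22) = 0"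
    and 1: "(a11 + a21 + N * c) * p + c * (a11 + a12) = 0" "(a11 + a21 + N * c) * q + c * (a21 + a22) = 0"
      "(a11 + a21 + N * c) * r + c * (c + g) = 0"
    and 2: "(a12 + a22 + N * g) * p + g * (a11 + a12) = 0" "(a12 + a22 + N * g) * q + g * (a21 + a22) = 0"
      "(a12 + a22 + N * g) * r + g * (c + g) = 0"
    and tot: "\<not> (N * p + a11 + a12 = 0 \<and> N * q + a21 + a22 = 0)"
    and ker: "\<not> (a11 + a21 + N * c = 0 \<and> a12 + a22 + N * g = 0)"
  shows "\<exists>x. 1 + N * x \<noteq> 0 \<and> p + x * (N * p + a11 + a12) = 0 \<and> q + x * (N * q + a21 + a22) = 0 \<and>
    r + x * (N * r + c + g) = 0 \<and> c = x * (a11 + a21) \<and> g = x * (a12 + a22)"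
proof -
  obtain k where k: "p = - k * (a11 + a12)" "q = - k * (a21 + a22)" "r = - k * (c + g)"
  proof (cases "a11 + a21 + N * c = 0")
    case False
    then show thesis using 1 that[of "c / (a11 + a21 + N * c)"]
      by (simp add: field_simps eq_neg_iff_add_eq_0)
  next
    case True
    then have "a12 + a22 + N * g \<noteq> 0" using ker by simp
    then show thesis using 2 that[of "g / (a12 + a22 + N * g)"]
      by (simp add: field_simps eq_neg_iff_add_eq_0)
  qed
  have "N * p + a11 + a12 = (1 - N * k) * (a11 + a12)" "N * q + a21 + a22 = (1 - N * k) * (a21 + a22)"
    "N * r + c + g = (1 - N * k) * (c + g)"
    unfolding k by (simp_all add: algebra_simps)
  note top = this
  have k0: "1 - N * k \<noteq> 0" and row: "a11 + a12 \<noteq> 0 \<or> a21 + a22 \<noteq> 0"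
    using tot unfolding top by auto
  have "(a11 + a12) * (c - k * (a11 + a21 + N * c)) = 0" "(a21 + a22) * (c - k * (a11 + a21 + N * c)) = 0"
    "(a11 + a12) * (g - k * (a12 + a22 + N * g)) = 0" "(a21 + a22) * (g - k * (a12 + a22 + N * g)) = 0"
    using 1(1,2) 2(1,2) unfolding k(1,2) by (simp_all add: algebra_simps)
  then have cg: "c = k * (a11 + a21 + N * c)" "g = k * (a12 + a22 + N * g)" using row by auto
  define x where "x = k / (1 - N * k)"
  have x: "x * (1 - N * k) = k" using k0 by (simp add: x_def)
  have "(1 + N * x) * (1 - N * k) = 1 - N * k + N * (x * (1 - N * k))" by (simp add: algebra_simps)
  also have "\<dots> = 1" unfolding x by simp
  finally have "(1 + N * x) * (1 - N * k) = 1" .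
  then have "1 + N * x \<noteq> 0" by auto
  moreover have "p + x * (N * p + a11 + a12) = 0" "q + x * (N * q + a21 + a22) = 0" "r + x * (N * r + c + g) = 0"
    unfolding top mult.assoc[symmetric] x unfolding k by simp_all
  moreover have "c * (1 - N * k) = k * (a11 + a21)" "g * (1 - N * k) = k * (a12 + a22)"
    using cg by (simp_all add: algebra_simps)
  then have "c = x * (a11 + a21)" "g = x * (a12 + a22)"
    using k0 by (simp_all add: x_def field_simps)
  ultimately show ?thesis by blast
qed

context welded_rep
begin

definition adj :: "nat \<Rightarrow> nat \<Rightarrow> nat" where
  "adj k i = (if i = k then Suc k else if i = Suc k then k else i)"

lemma adj_simps [simp]: "adj k k = Suc k" "adj k (Suc k) = k" "adj k (adj k i) = i"
  by (auto simp: adj_def)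

lemma adj_less: "Suc k < n \<Longrightarrow> i < n \<Longrightarrow> adj k i < n"
  by (simp add: adj_def)

context
  fixes e :: "nat \<Rightarrow> 'b"
  assumes e: "perm_basis e"
begin

lemma e_V: "i < n \<Longrightarrow> e i \<in> V"
  using e unfolding perm_basis_def by blast

lemma e_independent: "(\<Sum>i<n. c i *s e i) = 0 \<Longrightarrow> i < n \<Longrightarrow> c i = 0"
  using e unfolding perm_basis_def by blast

lemma A_e: "Suc k < n \<Longrightarrow> i < n \<Longrightarrow> A k (e i) = e (adj k i)"
  using e unfolding perm_basis_def adj_def by simp

lemma e_spans: "v \<in> V \<Longrightarrow> \<exists>c. v = (\<Sum>i<n. c i *s e i)"
  using dim_V(1) e_V e_independent by (intro dim_at_most_family_spans[of V]) auto

lemma coordinates_exist: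
  "\<exists>coord. \<forall>i. module_hom scale (*) (coord i) \<and> (\<forall>j<n. coord i (e j) = (if i = j then 1 else 0))"
proof (rule choice, rule allI)
  fix i
  interpret p: vector_space_pair scale "(*) :: 'a \<Rightarrow> 'a \<Rightarrow> 'a"
    by unfold_locales (simp_all add: algebra_simps)
  have inj: "inj_on e {..<n}" and ind: "independent (e ` {..<n})"
    using independent_family[of "{..<n}" e] e_independent by auto
  obtain g where g: "Vector_Spaces.linear scale (*) g" "\<forall>x\<in>e ` {..<n}. g x = (if x = e i then 1 else 0)"
    using p.linear_independent_extend[OF ind, of "\<lambda>x. if x = e i then 1 else 0"] by blast
  show "\<exists>f. module_hom scale (*) f \<and> (\<forall>j<n. f (e j) = (if i = j then 1 else 0))"
  proof (cases "i < n")
    case True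
    then have "\<forall>j<n. g (e j) = (if i = j then 1 else 0)" using g(2) inj by (auto dest: inj_onD)
    then show ?thesis using g(1) by (auto simp: linear_iff_module_hom)
  next
    case False
    have "module_hom scale (*) (\<lambda>_. 0)" by unfold_locales (simp_all add: algebra_simps)
    then show ?thesis using False by (intro exI[of _ "\<lambda>_. 0"]) auto
  qed
qed

text \<open>The coordinate functionals are extended from \<open>V\<close> to the ambient space, so that they are linear
  without side conditions.\<close>

definition coord where
  "coord = (SOME coord. \<forall>i. module_hom scale (*) (coord i) \<and> (\<forall>j<n. coord i (e j) = (if i = j then 1 else 0)))"

lemma coord_hom: "module_hom scale (*) (coord i)"
  and coord_e: "j < n \<Longrightarrow> coord i (e j) = (if i = j then 1 else 0)"
  using someI_ex[OF coordinates_exist] unfolding coord_def by blast+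

lemmas coord_add = module_hom.add[OF coord_hom]
lemmas coord_diff = module_hom.diff[OF coord_hom]
lemmas coord_scale = module_hom.scale[OF coord_hom]
lemmas coord_sum = module_hom.sum[OF coord_hom]
lemmas coord_zero = module_hom.zero[OF coord_hom]

lemma coord_comb: "i < n \<Longrightarrow> coord i (\<Sum>j<n. c j *s e j) = c i"
  by (simp add: coord_sum coord_scale coord_e if_distrib[of "(*) _"] cong: if_cong)

lemma expand: "v \<in> V \<Longrightarrow> v = (\<Sum>i<n. coord i v *s e i)"
proof -
  assume "v \<in> V"
  then obtain c where c: "v = (\<Sum>i<n. c i *s e i)" using e_spans by blast
  have "(\<Sum>i<n. coord i v *s e i) = (\<Sum>i<n. c i *s e i)"
    by (rule sum.cong[OF HOL.refl]) (simp add: c coord_comb)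
  then show ?thesis using c by simp
qed

lemma coord_eqI: "v \<in> V \<Longrightarrow> w \<in> V \<Longrightarrow> (\<And>i. i < n \<Longrightarrow> coord i v = coord i w) \<Longrightarrow> v = w"
proof -
  assume vw: "v \<in> V" "w \<in> V" and eq: "\<And>i. i < n \<Longrightarrow> coord i v = coord i w"
  have "(\<Sum>i<n. coord i v *s e i) = (\<Sum>i<n. coord i w *s e i)"
    by (rule sum.cong[OF HOL.refl]) (simp add: eq)
  then show ?thesis using expand[OF vw(1)] expand[OF vw(2)] by simp
qed

lemma coord_A:
  assumes "v \<in> V" "Suc k < n" "i < n"
  shows "coord i (A k v) = coord (adj k i) v"
proof -
  have "coord i (A k (\<Sum>j<n. coord j v *s e j)) = (\<Sum>j<n. coord j v * (if i = adj k j then 1 else 0))"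
    using assms by (simp add: A_sum A_scale A_e coord_sum coord_scale coord_e adj_less)
  also have "\<dots> = (\<Sum>j<n. if j = adj k i then coord j v else 0)"
    by (rule sum.cong) auto
  also have "\<dots> = coord (adj k i) v" using assms by (simp add: adj_less)
  finally show ?thesis using expand[OF assms(1)] by simp
qed

definition total where "total = (\<Sum>i<n. e i)"

lemma total_V: "total \<in> V"
  unfolding total_def using e_V by (intro subspace_sum[OF V]) auto

lemma coord_total: "i < n \<Longrightarrow> coord i total = 1"
  by (simp add: total_def coord_sum coord_e)

lemma A_total: "Suc k < n \<Longrightarrow> A k total = total"
  by (rule coord_eqI) (simp_all add: coord_A coord_total total_V closed adj_less)

text \<open>The shape of \<open>s i\<close> in the basis \<open>e\<close> that is forced by its commuting with the permutations of the
  basis vectors other than \<open>e\<^sub>i\<close> and \<open>e\<^bsub>i+1\<^esub>\<close>: a scalar plus an operator that involves only \<open>e\<^sub>i\<close>, \<open>e\<^bsub>i+1\<^esub>\<close>,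
  the sum of the basis, and the dual functionals.\<close>

definition sigma_form where
  "sigma_form y p q r a11 a21 c a12 a22 g i j =
     y *s e j + (p *s e i + q *s e (Suc i) + r *s total)
     + (if j = i then a11 *s e i + a21 *s e (Suc i) + c *s total else 0)
     + (if j = Suc i then a12 *s e i + a22 *s e (Suc i) + g *s total else 0)"

text \<open>The product \<open>A i A (i + 1)\<close> conjugates \<open>s i\<close> into \<open>s (i + 1)\<close> and permutes the basis accordingly,
  so that the parameters do not depend on \<open>i\<close>.\<close>

lemma sigma_form_propagates:
  assumes s0: "\<And>j. j < n \<Longrightarrow> s 0 (e j) = sigma_form y p q r a11 a21 c a12 a22 g 0 j"
  shows "Suc i < n \<Longrightarrow> j < n \<Longrightarrow> s i (e j) = sigma_form y p q r a11 a21 c a12 a22 g i j"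
proof (induction i arbitrary: j)
  case 0 then show ?case by (simp add: s0)
next
  case (Suc i)
  have i: "Suc i < n" "Suc (Suc i) < n" "i < n" using Suc.prems by auto
  define j' where "j' = adj (Suc i) (adj i j)"
  have j': "j' < n" unfolding j'_def using i Suc.prems by (simp add: adj_less)
  have "s (Suc i) (e j) = A i (A (Suc i) (s i (e j')))"
    using i Suc.prems by (simp add: s_Suc e_V A_e adj_less j'_def)
  also have "\<dots> = A i (A (Suc i) (sigma_form y p q r a11 a21 c a12 a22 g i j'))"
    using Suc.IH[OF i(1) j'] by simp
  also have "\<dots> = sigma_form y p q r a11 a21 c a12 a22 g (Suc i) j"
  proof -
    have r: "adj i (adj (Suc i) j') = j" "adj i (adj (Suc i) i) = Suc i" "adj i (adj (Suc i) (Suc i)) = Suc (Suc i)" "adj i (Suc (Suc i)) = Suc (Suc i)"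
      by (auto simp: j'_def adj_def)
    have jj: "j' = i \<longleftrightarrow> j = Suc i" "j' = Suc i \<longleftrightarrow> j = Suc (Suc i)"
      by (auto simp: j'_def adj_def)
    have Ae: "A i (A (Suc i) (e k)) = e (adj i (adj (Suc i) k))" if "k < n" for k
      using that i by (simp add: A_e adj_less)
    have E: "A i (A (Suc i) total) = total" using i by (simp add: A_total)
    show ?thesis unfolding sigma_form_def jj
      using i j' by (simp add: A_add A_scale Ae r E A_zero)
  qed
  finally show ?case .
qed

text \<open>The matrix \<open>t\<close> of \<open>s 0\<close> satisfies \<open>t (\<pi> i) (\<pi> j) = t i j\<close> for the permutations \<open>\<pi>\<close> of the indices
  from \<open>2\<close> on. Hence \<open>t i j\<close> depends only on which of \<open>i\<close>, \<open>j\<close> are \<open>0\<close>, \<open>1\<close> or larger, and on whether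
  \<open>i = j\<close>; the ten values correspond to the ten parameters.\<close>

lemma sigma_form_exists:
  "\<exists>y p q r a11 a21 c a12 a22 g. \<forall>j<n. s 0 (e j) = sigma_form y p q r a11 a21 c a12 a22 g 0 j"
proof -
  define t where "t i j = coord i (s 0 (e j))" for i j
  have s0V: "s 0 (e j) \<in> V" if "j < n" for j using that n e_V by (intro s_closed) auto
  have equi: "t (adj k i) (adj k j) = t i j" if k: "2 \<le> k" "Suc k < n" and ij: "i < n" "j < n" for k i j
  proof -
    have "s 0 (e (adj k j)) = A k (s 0 (e j))"
      using A_s_comm[of k 0 "e j"] k ij n by (simp add: A_e e_V)
    then show ?thesis unfolding t_def using k ij by (simp add: coord_A s0V adj_less)
  qed
  have adj_id: "adj k j = j" if "j \<noteq> k" "j \<noteq> Suc k" for k j using that by (simp add: adj_def)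
  have col: "i < n \<Longrightarrow> t i j = t 2 j" if "2 \<le> i" "j < 2" for i j
    using that(1)
  proof (induction i rule: dec_induct)
    case (step i)
    have "t (Suc i) j = t i j" using equi[of i i j] step that(2) by (simp add: adj_id)
    then show ?case using step by simp
  qed simp
  have row: "j < n \<Longrightarrow> t i j = t i 2" if "2 \<le> j" "i < 2" for i j
    using that(1)
  proof (induction j rule: dec_induct)
    case (step j)
    have "t i (Suc j) = t i j" using equi[of j i j] step that(2) by (simp add: adj_id)
    then show ?case using step by simp
  qed simp
  have diag: "i < n \<Longrightarrow> t i i = t 2 2" if "2 \<le> i" for i
    using that
  proof (induction i rule: dec_induct)
    case (step i)
    have "t (Suc i) (Suc i) = t i i" using equi[of i i i] step by simp
    then show ?case using step by simp
  qed simp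
  have off: "i < n \<Longrightarrow> j < n \<Longrightarrow> 2 \<le> i \<Longrightarrow> 2 \<le> j \<Longrightarrow> i \<noteq> j \<Longrightarrow> t i j = t 2 3" for i j
  proof (induction "i + j" arbitrary: i j rule: less_induct)
    case less
    consider (i) k where "i = Suc k" "2 \<le> k" "k \<noteq> j" | (j) k where "j = Suc k" "2 \<le> k" "k \<noteq> i"
      | "i = 2" "j = 3" | "i = 3" "j = 2"
    proof -
      have "\<exists>k. i = Suc k" "\<exists>k. j = Suc k" using less.prems by presburger+
      then obtain k l where "i = Suc k" "j = Suc l" by auto
      then show thesis using that less.prems
        by (cases "2 \<le> k \<and> k \<noteq> j"; cases "2 \<le> l \<and> l \<noteq> i") auto
    qed
    then show ?case
    proof cases
      case (i k)
      then have "t i j = t k j" using equi[of k k j] less.prems by (simp add: adj_id)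
      then show ?thesis using less.hyps[of k j] less.prems i by simp
    next
      case (j k)
      then have "t i j = t i k" using equi[of k i k] less.prems by (simp add: adj_id)
      then show ?thesis using less.hyps[of i k] less.prems j by simp
    next
      case 4
      then show ?thesis using equi[of 2 2 3] n by (simp add: adj_def)
    qed simp
  qed
  define y r where "y = t 2 2 - t 2 3" and "r = t 2 3"
  define p q c g where "p = t 0 2 - r" and "q = t 1 2 - r" and "c = t 2 0 - r" and "g = t 2 1 - r"
  define a11 a21 a12 a22 where "a11 = t 0 0 - (y + p + c + r)" and "a21 = t 1 0 - (q + c + r)"
    and "a12 = t 0 1 - (p + g + r)" and "a22 = t 1 1 - (y + q + g + r)"
  note defs = a11_def a21_def a12_def a22_def p_def q_def c_def g_def y_def r_def
  have "s 0 (e j) = sigma_form y p q r a11 a21 c a12 a22 g 0 j" if j: "j < n" for j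
  proof (rule coord_eqI)
    show "s 0 (e j) \<in> V" by (rule s0V[OF j])
    show "sigma_form y p q r a11 a21 c a12 a22 g 0 j \<in> V"
      unfolding sigma_form_def using j n e_V total_V
      by (auto intro!: subspace_add[OF V] subspace_scale[OF V] subspace_0[OF V])
    fix i assume i: "i < n"
    have F: "coord i (sigma_form y p q r a11 a21 c a12 a22 g 0 j) =
      y * of_bool (i = j) + (p * of_bool (i = 0) + q * of_bool (i = 1) + r)
      + (if j = 0 then a11 * of_bool (i = 0) + a21 * of_bool (i = 1) + c else 0)
      + (if j = 1 then a12 * of_bool (i = 0) + a22 * of_bool (i = 1) + g else 0)"
      unfolding sigma_form_def using i j n by (simp add: coord_add coord_scale coord_e coord_total coord_zero)
    have cases: "k = 0 \<or> k = 1 \<or> 2 \<le> k" for k :: nat by linarith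
    have "coord i (s 0 (e j)) = t i j" by (simp add: t_def)
    also have "\<dots> = coord i (sigma_form y p q r a11 a21 c a12 a22 g 0 j)"
      unfolding F using cases[of i] cases[of j]
      by (elim disjE; cases "i = j")
        (simp_all add: defs col[of i 0] col[of i "Suc 0"] row[of j 0] row[of j "Suc 0"] diag[of j] off[of i j] i j)
    finally show "coord i (s 0 (e j)) = coord i (sigma_form y p q r a11 a21 c a12 a22 g 0 j)" .
  qed
  then show ?thesis by blast
qed

context
  fixes y p q r a11 a21 c a12 a22 g
  assumes s0: "\<And>j. j < n \<Longrightarrow> s 0 (e j) = sigma_form y p q r a11 a21 c a12 a22 g 0 j"
begin

lemma s_e: "Suc i < n \<Longrightarrow> j < n \<Longrightarrow> s i (e j) = sigma_form y p q r a11 a21 c a12 a22 g i j"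
  using sigma_form_propagates[OF s0] .

lemma s_total:
  assumes i: "Suc i < n"
  shows "s i total = y *s total + of_nat n *s (p *s e i + q *s e (Suc i) + r *s total)
     + (a11 *s e i + a21 *s e (Suc i) + c *s total) + (a12 *s e i + a22 *s e (Suc i) + g *s total)"
proof -
  have "s i total = (\<Sum>j<n. sigma_form y p q r a11 a21 c a12 a22 g i j)"
    unfolding total_def s_sum[OF i] by (rule sum.cong) (simp_all add: s_e i)
  also have "\<dots> = (\<Sum>j<n. y *s e j) + of_nat n *s (p *s e i + q *s e (Suc i) + r *s total)
     + (a11 *s e i + a21 *s e (Suc i) + c *s total) + (a12 *s e i + a22 *s e (Suc i) + g *s total)"
    using i unfolding sigma_form_def by (simp only: sum.distrib sum_constant_scale sum.delta) (simp add: scale_right_distrib)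
  also have "(\<Sum>j<n. y *s e j) = y *s total" by (simp add: total_def scale_sum_right)
  finally show ?thesis .
qed

text \<open>Otherwise the sum of the basis spans an invariant line.\<close>

lemma total_not_invariant: "\<not> (of_nat n * p + a11 + a12 = 0 \<and> of_nat n * q + a21 + a22 = 0)"
proof
  assume h: "of_nat n * p + a11 + a12 = 0 \<and> of_nat n * q + a21 + a22 = 0"
  define k where "k = y + of_nat n * r + c + g"
  have n0: "Suc 0 < n" "0 < n" using n by auto
  have "s 0 total = k *s total + (of_nat n * p + a11 + a12) *s e 0 + (of_nat n * q + a21 + a22) *s e (Suc 0)"
    unfolding s_total[OF n0(1)] k_def by (simp add: scale_left_distrib scale_right_distrib)
  then have k: "s 0 total = k *s total" using h by simp
  have "span {total} = {0} \<or> span {total} = V"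
  proof (rule invariant_subspace[OF subspace_span])
    show "span {total} \<subseteq> V" using total_V V by (simp add: span_minimal)
    fix v assume "v \<in> span {total}"
    then obtain d where v: "v = d *s total" by (auto simp: span_singleton)
    show "A i v \<in> span {total}" if "Suc i < n" for i
      using that by (simp add: v A_scale A_total span_scale span_base)
    show "s 0 v \<in> span {total}" using n0 by (simp add: v s_scale k span_scale span_base)
  qed
  moreover have "total \<noteq> 0" using coord_total[OF n0(2)] by (auto simp: coord_zero)
  moreover have "total \<in> span {total}" by (simp add: span_base)
  ultimately have "e 0 \<in> span {total}" using e_V[of 0] n by auto
  then obtain d where "e 0 = d *s total" by (auto simp: span_singleton)
  then have "coord 0 (e 0) = coord 1 (e 0)" using n by (simp add: coord_scale coord_total)
  then show False using n by (simp add: coord_e)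
qed

text \<open>Otherwise the vectors with coordinate sum \<open>0\<close> form an invariant subspace.\<close>

lemma kernel_not_invariant: "\<not> (a11 + a21 + of_nat n * c = 0 \<and> a12 + a22 + of_nat n * g = 0)"
proof
  assume h: "a11 + a21 + of_nat n * c = 0 \<and> a12 + a22 + of_nat n * g = 0"
  define \<Phi> where "\<Phi> v = (\<Sum>i<n. coord i v)" for v
  define k where "k = y + p + q + of_nat n * r"
  have n0: "Suc 0 < n" "0 < n" using n by auto
  have \<Phi>: "\<Phi> (u + v) = \<Phi> u + \<Phi> v" "\<Phi> (d *s v) = d * \<Phi> v" for u v d
    by (simp_all add: \<Phi>_def coord_add coord_scale sum.distrib sum_distrib_left)
  have \<Phi>_0: "\<Phi> 0 = 0" by (simp add: \<Phi>_def coord_zero)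
  have \<Phi>_e: "\<Phi> (e j) = 1" if "j < n" for j using that by (simp add: \<Phi>_def coord_e)
  have \<Phi>_total: "\<Phi> total = of_nat n" by (simp add: \<Phi>_def coord_total)
  have \<Phi>_sum: "\<Phi> (\<Sum>j\<in>J. f j) = (\<Sum>j\<in>J. \<Phi> (f j))" for J :: "nat set" and f
    by (induction J rule: infinite_finite_induct) (simp_all add: \<Phi> \<Phi>_0)
  have \<Phi>_s: "\<Phi> (s 0 (e j)) = k" if j: "j < n" for j
  proof -
    have "\<Phi> (s 0 (e j)) = k + (if j = 0 then a11 + a21 + of_nat n * c else 0) + (if j = 1 then a12 + a22 + of_nat n * g else 0)"
      unfolding s0[OF j] sigma_form_def k_def using n0 j
      by (simp add: \<Phi> \<Phi>_e \<Phi>_total \<Phi>_0 algebra_simps)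
    then show ?thesis using h by simp
  qed
  have \<Phi>_s0: "\<Phi> (s 0 v) = k * \<Phi> v" if "v \<in> V" for v
  proof -
    have "\<Phi> (s 0 (\<Sum>j<n. coord j v *s e j)) = (\<Sum>j<n. coord j v * k)"
      using n0 by (simp add: s_sum s_scale \<Phi>_sum \<Phi> \<Phi>_s)
    also have "\<dots> = k * \<Phi> v" by (simp add: \<Phi>_def sum_distrib_left mult.commute)
    finally show ?thesis using expand[OF that] by simp
  qed
  have \<Phi>_A: "\<Phi> (A i v) = \<Phi> v" if i: "Suc i < n" and "v \<in> V" for i v
  proof -
    have "\<Phi> (A i (\<Sum>j<n. coord j v *s e j)) = \<Phi> v"
      using i by (simp add: A_sum A_scale A_e \<Phi>_sum \<Phi> \<Phi>_e adj_less) (simp add: \<Phi>_def)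
    then show ?thesis using expand[OF that(2)] by simp
  qed
  define W where "W = {v \<in> V. \<Phi> v = 0}"
  have "W = {0} \<or> W = V"
  proof (rule invariant_subspace)
    show "subspace W"
      by (rule subspaceI) (simp_all add: W_def \<Phi> \<Phi>_0 subspace_0[OF V] subspace_add[OF V] subspace_scale[OF V])
    show "W \<subseteq> V" by (auto simp: W_def)
    show "A i v \<in> W" if "Suc i < n" "v \<in> W" for i v using that \<Phi>_A by (simp add: W_def closed)
    show "s 0 v \<in> W" if "v \<in> W" for v using that \<Phi>_s0 n0 by (simp add: W_def s_closed)
  qed
  moreover have "e 0 \<in> V" "e 0 \<notin> W" using n0 by (auto simp: W_def e_V \<Phi>_e)
  moreover have "\<Phi> (e 0 - e 1) = 0" using \<Phi>(1)[of "e 0 - e 1" "e 1"] n0 by (simp add: \<Phi>_e)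
  then have "e 0 - e 1 \<in> W" using n0 by (simp add: W_def subspace_diff[OF V] e_V)
  moreover have "coord 0 (e 0 - e 1) \<noteq> 0" using n0 by (simp add: coord_diff coord_e)
  then have "e 0 - e 1 \<noteq> 0" by (metis coord_zero)
  ultimately show False by blast
qed

text \<open>The coefficients of \<open>s 0 s 2 - s 2 s 0\<close>. Evaluation at \<open>e 4\<close> gives the first two equations; the
  others come from \<open>e 2 - e 4\<close> and \<open>e 3 - e 4\<close>.\<close>

lemma sigma_commutation:
  defines "N \<equiv> of_nat n"
  shows "(p + q + N * r) * p + r * (a11 + a12) = 0" "(p + q + N * r) * q + r * (a21 + a22) = 0"
    and "(a11 + a21 + N * c) * p + c * (a11 + a12) = 0" "(a11 + a21 + N * c) * q + c * (a21 + a22) = 0"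
    and "(a11 + a21 + N * c) * r + c * (c + g) = 0"
    and "(a12 + a22 + N * g) * p + g * (a11 + a12) = 0" "(a12 + a22 + N * g) * q + g * (a21 + a22) = 0"
    and "(a12 + a22 + N * g) * r + g * (c + g) = 0"
proof -
  have m: "0 < n" "Suc 0 < n" "2 < n" "3 < n" "4 < n" "5 < n" "Suc 2 < n" "Suc (Suc 0) < n" using n by auto
  have com: "coord i (s 0 (s 2 (e j))) = coord i (s 2 (s 0 (e j)))" if "j < n" for i j
    using s_comm[of 0 2 "e j"] that n e_V by simp
  note S = s_e[OF m(2)] s_e[OF m(7)]
  note T = s_total[OF m(2)] s_total[OF m(7)]
  note ev = S T s_add s_scale coord_add coord_scale coord_e coord_total sigma_form_def coord_zero
  show "(p + q + N * r) * p + r * (a11 + a12) = 0"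
    using com[of 4 0] com[of 4 5] m unfolding N_def by (simp add: ev algebra_simps) algebra?
  show "(p + q + N * r) * q + r * (a21 + a22) = 0"
    using com[of 4 1] com[of 4 5] m unfolding N_def by (simp add: ev algebra_simps) algebra?
  define u X where "u = p *s e 0 + q *s e (Suc 0) + r *s total"
    and "X = (a11 + a12) *s e 0 + (a21 + a22) *s e (Suc 0) + (c + g) *s total"
  have s0_total: "s 0 total = y *s total + N *s u + X"
    unfolding s_total[OF m(2)] u_def X_def N_def by (simp add: scale_left_distrib algebra_simps)
  have s0_far: "s 0 (e j) = y *s e j + u" if "2 \<le> j" "j < n" for j
    using S(1)[OF that(2)] that(1) by (simp add: sigma_form_def u_def)
  \<comment> \<open>Such \<open>v\<close> are eigenvectors of \<open>s 0\<close> for the eigenvalue \<open>y\<close>, so that all terms with \<open>y\<close> cancel.\<close>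
  have col: "(a + a' + N * d) *s u + d *s X = 0"
    if v: "v \<in> V" "s 0 v = y *s v" "s 2 v = y *s v + (a *s e 2 + a' *s e 3 + d *s total)" for v a a' d
  proof -
    have "s 0 (s 2 v) = s 2 (s 0 v)" using s_comm[of 0 2 v] v(1) n by simp
    moreover have "s 2 (s 0 v) = y *s s 2 v" unfolding v(2) by (rule s_scale[OF m(7)])
    moreover have "s 0 (s 2 v) = y *s (y *s v) + (a *s (y *s e 2 + u) + a' *s (y *s e 3 + u) + d *s (y *s total + N *s u + X))"
      unfolding v(3) using m s0_far[of 2] s0_far[of 3] by (simp add: s_add s_scale v(2) s0_total)
    ultimately have "y *s (y *s v) + (a *s (y *s e 2 + u) + a' *s (y *s e 3 + u) + d *s (y *s total + N *s u + X))
        = y *s (y *s v + (a *s e 2 + a' *s e 3 + d *s total))" using v(3) by simp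
    then show ?thesis
      by (simp add: scale_right_distrib scale_left_distrib mult.commute algebra_simps)
  qed
  have coeffs: "k1 * p + k2 * (a11 + a12) = 0 \<and> k1 * q + k2 * (a21 + a22) = 0 \<and> k1 * r + k2 * (c + g) = 0"
    if "k1 *s u + k2 *s X = 0" for k1 k2
  proof -
    have z: "coord i (k1 *s u + k2 *s X) = 0" for i unfolding that by (rule coord_zero)
    have r: "k1 * r + k2 * (c + g) = 0"
      using z[of 5] m by (simp add: u_def X_def coord_add coord_scale coord_e coord_total)
    have "k1 * (p + r) + k2 * (a11 + a12 + (c + g)) = 0" "k1 * (q + r) + k2 * (a21 + a22 + (c + g)) = 0"
      using z[of 0] z[of 1] m by (simp_all add: u_def X_def coord_add coord_scale coord_e coord_total)
    moreover have "k1 * (p' + r) + k2 * (x + (c + g)) = (k1 * p' + k2 * x) + (k1 * r + k2 * (c + g))" for p' x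
      by (simp add: algebra_simps)
    ultimately show ?thesis using r by simp
  qed
  have s0_diff: "s 0 (e i - e 4) = y *s (e i - e 4)" if "2 \<le> i" "i < n" for i
    using s0_far[OF that] s0_far[of 4] m by (simp add: s_diff scale_right_diff_distrib)
  have "s 2 (e 2 - e 4) = y *s (e 2 - e 4) + (a11 *s e 2 + a21 *s e 3 + c *s total)"
    using S(2)[of 2] S(2)[of 4] m by (simp add: s_diff sigma_form_def scale_right_diff_distrib)
  from coeffs[OF col[OF subspace_diff[OF V e_V e_V] s0_diff this]] m
  show "(a11 + a21 + N * c) * p + c * (a11 + a12) = 0" "(a11 + a21 + N * c) * q + c * (a21 + a22) = 0"
    "(a11 + a21 + N * c) * r + c * (c + g) = 0" by auto
  have "s 2 (e 3 - e 4) = y *s (e 3 - e 4) + (a12 *s e 2 + a22 *s e 3 + g *s total)"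
    using S(2)[of 3] S(2)[of 4] m by (simp add: s_diff sigma_form_def scale_right_diff_distrib)
  from coeffs[OF col[OF subspace_diff[OF V e_V e_V] s0_diff this]] m
  show "(a12 + a22 + N * g) * p + g * (a11 + a12) = 0" "(a12 + a22 + N * g) * q + g * (a21 + a22) = 0"
    "(a12 + a22 + N * g) * r + g * (c + g) = 0" by auto
qed

text \<open>The vectors \<open>f i = e i + x total\<close> are permuted like the \<open>e i\<close>. The choice of \<open>x\<close> makes \<open>s 0\<close> scalar
  on \<open>f 2, f 3, \<dots>\<close> and preserve the span of \<open>f 0\<close> and \<open>f 1\<close>; \<open>1 + n x \<noteq> 0\<close> keeps them independent.\<close>

lemma straightened_basis:
  "\<exists>f. perm_basis f \<and> (\<forall>j<n. s 0 (f j) = y *s f j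
     + (if j = 0 then a11 *s f 0 + a21 *s f 1 else 0) + (if j = 1 then a12 *s f 0 + a22 *s f 1 else 0))"
proof -
  obtain x where x: "1 + of_nat n * x \<noteq> 0" "p + x * (of_nat n * p + a11 + a12) = 0"
      "q + x * (of_nat n * q + a21 + a22) = 0" "r + x * (of_nat n * r + c + g) = 0"
      "c = x * (a11 + a21)" "g = x * (a12 + a22)"
    using rank_one_relations_solution[OF sigma_commutation total_not_invariant kernel_not_invariant] by blast
  define f where "f i = e i + x *s total" for i
  have m: "Suc 0 < n" "0 < n" using n by auto
  have "perm_basis f" unfolding perm_basis_def
  proof (intro conjI allI impI)
    show "f i \<in> V" if "i < n" for i
      unfolding f_def using that e_V total_V by (intro subspace_add[OF V] subspace_scale[OF V])
    show "A k (f i) = (if i = k then f (Suc k) else if i = Suc k then f k else f i)" if "Suc k < n" "i < n" for k i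
      unfolding f_def using that by (simp add: A_add A_scale A_e A_total adj_def)
    fix d i assume d: "(\<Sum>i<n. d i *s f i) = 0" and i: "i < n"
    define D where "D = (\<Sum>i<n. d i)"
    have d_eq: "d j = - (x * D)" if j: "j < n" for j
    proof -
      have "0 = coord j (\<Sum>i<n. d i *s f i)" unfolding d by (simp add: coord_zero)
      also have "\<dots> = (\<Sum>i<n. (if i = j then d i else 0) + d i * x)"
        unfolding coord_sum f_def using j
        by (intro sum.cong) (auto simp: coord_scale coord_add coord_e coord_total algebra_simps)
      also have "\<dots> = d j + D * x" using j by (simp add: sum.distrib D_def sum_distrib_right)
      finally show ?thesis by (simp add: eq_neg_iff_add_eq_0 mult.commute)
    qed
    have "(\<Sum>i<n. d i) = (\<Sum>i<n. - (x * D))" by (rule sum.cong[OF HOL.refl]) (simp only: lessThan_iff d_eq)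
    then have "D = - (of_nat n * x * D)" by (simp add: D_def[symmetric] mult.assoc)
    then have "D + of_nat n * x * D = 0" by (simp only: eq_neg_iff_add_eq_0)
    then have "(1 + of_nat n * x) * D = 0" by (simp only: distrib_right mult_1)
    then have "D = 0" using x(1) by simp
    then show "d i = 0" using d_eq[OF i] by simp
  qed
  moreover have "s 0 (f j) = y *s f j + (if j = 0 then a11 *s f 0 + a21 *s f 1 else 0)
      + (if j = 1 then a12 *s f 0 + a22 *s f 1 else 0)" if j: "j < n" for j
  proof -
    have "s 0 (f j) = s 0 (e j) + x *s s 0 total" unfolding f_def using m by (simp add: s_add s_scale)
    also have "x *s s 0 total = (x * y) *s total + (x * (of_nat n * p + a11 + a12)) *s e 0
        + (x * (of_nat n * q + a21 + a22)) *s e (Suc 0) + (x * (of_nat n * r + c + g)) *s total"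
      unfolding s_total[OF m(1)] by (simp add: scale_right_distrib distrib_left scale_left_distrib algebra_simps)
    also have "x * (of_nat n * p + a11 + a12) = - p" using x(2) by (simp add: eq_neg_iff_add_eq_0 add.commute)
    also have "x * (of_nat n * q + a21 + a22) = - q" using x(3) by (simp add: eq_neg_iff_add_eq_0 add.commute)
    also have "x * (of_nat n * r + c + g) = - r" using x(4) by (simp add: eq_neg_iff_add_eq_0 add.commute)
    finally have "s 0 (f j) = y *s e j + (x * y) *s total
        + (if j = 0 then a11 *s e 0 + a21 *s e 1 + c *s total else 0)
        + (if j = 1 then a12 *s e 0 + a22 *s e 1 + g *s total else 0)"
      unfolding s0[OF j] sigma_form_def by simp
    then show ?thesis unfolding x(5,6) f_def
      by (simp add: scale_right_distrib distrib_left scale_left_distrib mult.commute algebra_simps)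
  qed
  ultimately show ?thesis by blast
qed

end

end

text \<open>Write the block as \<open>(a, b; c, d)\<close>, where \<open>a = y + a11\<close>, \<open>b = a12\<close>, \<open>c = a21\<close> and
  \<open>d = y + a22\<close>. The relation
  \<open>s 0 s 1 A 0 = A 1 s 0 s 1\<close> gives \<open>a d = 0\<close> and \<open>a (b - y) = d (b - y) = 0\<close>. If \<open>a \<noteq> 0\<close>, then \<open>b = y\<close>, \<open>d = 0\<close>
  and the braid relation gives \<open>a + c = y\<close>, as in the Burau representation: both columns of the
  block have sum \<open>y\<close>, against \<open>kernel_not_invariant\<close>. If \<open>d \<noteq> 0\<close>, then likewise both rows have
  sum \<open>y\<close>, against \<open>total_not_invariant\<close>.\<close>

lemma block_is_antidiagonal:
  assumes f: "perm_basis f"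
    and s0: "\<forall>j<n. s 0 (f j) = y *s f j
     + (if j = 0 then a11 *s f 0 + a21 *s f 1 else 0) + (if j = 1 then a12 *s f 0 + a22 *s f 1 else 0)"
  shows "y \<noteq> 0" "a12 \<noteq> 0" "a21 \<noteq> 0" "y + a11 = 0" "y + a22 = 0"
    and "Suc i < n \<Longrightarrow> s i (f i) = a21 *s f (Suc i)"
    and "Suc i < n \<Longrightarrow> s i (f (Suc i)) = a12 *s f i"
    and "Suc i < n \<Longrightarrow> j < n \<Longrightarrow> j \<noteq> i \<Longrightarrow> j \<noteq> Suc i \<Longrightarrow> s i (f j) = y *s f j"
proof -
  let ?form = "sigma_form f y 0 0 0 a11 a21 0 a12 a22 0"
  have form0: "s 0 (f j) = ?form 0 j" if "j < n" for j
    using s0[rule_format, OF that] by (simp add: sigma_form_def[OF f])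
  define a b c d where "a = y + a11" and "b = a12" and "c = a21" and "d = y + a22"
  have s_f: "s i (f j) = ?form i j" if "Suc i < n" "j < n" for i j
    using sigma_form_propagates[OF f form0 that] .
  have s1: "s i (f i) = a *s f i + c *s f (Suc i)" if "Suc i < n" for i
    using s_f[OF that, of i] that by (simp add: sigma_form_def[OF f] a_def c_def scale_left_distrib)
  have s2: "s i (f (Suc i)) = b *s f i + d *s f (Suc i)" if "Suc i < n" for i
    using s_f[OF that, of "Suc i"] that by (simp add: sigma_form_def[OF f] b_def d_def scale_left_distrib)
  have s3: "s i (f j) = y *s f j" if "Suc i < n" "j < n" "j \<noteq> i" "j \<noteq> Suc i" for i j
    using s_f[OF that(1,2)] that by (simp add: sigma_form_def[OF f])
  have m: "0 < n" "Suc 0 < n" "Suc (Suc 0) < n" "2 < n" using n by auto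
  have fV: "f j \<in> V" if "j < n" for j using e_V[OF f that] .
  note co = coord_add[OF f] coord_scale[OF f] coord_e[OF f]
  have f0: "f j \<noteq> 0" if "j < n" for j
    using coord_e[OF f that, of j] coord_zero[OF f] by auto
  show y0: "y \<noteq> 0" using s3[OF m(2) m(4)] s_inj[OF m(2) fV[OF m(4)]] f0[OF m(4)] by auto
  have A0: "A 0 (f 0) = f 1" "A 0 (f 2) = f 2" using A_e[OF f m(2)] m by (simp_all add: adj_def)
  have A1: "A (Suc 0) (f 0) = f 0" "A (Suc 0) (f 1) = f 2" "A (Suc 0) (f 2) = f 1"
    using A_e[OF f m(3)] m by (simp_all add: adj_def numeral_2_eq_2)
  note S = s1[OF m(2)] s1[OF m(3)] s2[OF m(2)] s2[OF m(3)] s3[OF m(2)] s3[OF m(3)]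
  have S': "s 0 (f 0) = a *s f 0 + c *s f 1" "s 0 (f 1) = b *s f 0 + d *s f 1" "s 0 (f 2) = y *s f 2"
    "s 1 (f 0) = y *s f 0" "s 1 (f 1) = a *s f 1 + c *s f 2" "s 1 (f 2) = b *s f 1 + d *s f 2"
    using S m by (simp_all add: numeral_2_eq_2)
  have lin: "s 0 (u + v) = s 0 u + s 0 v" "s 0 (k *s u) = k *s s 0 u" "s 1 (u + v) = s 1 u + s 1 v" "s 1 (k *s u) = k *s s 1 u"
     "A 1 (u + v) = A 1 u + A 1 v" "A 1 (k *s u) = k *s A 1 u" for u v k
    using m by (simp_all add: s_add s_scale A_add A_scale)
  have mixed: "s 0 (s 1 (A 0 u)) = A 1 (s 0 (s 1 u))" and braid: "s 0 (s 1 (s 0 u)) = s 1 (s 0 (s 1 u))" if "u \<in> V" for u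
    using s_s_A[of 0 u] s_braid[of 0 u] that m by simp_all
  have m2: "coord f 1 (s 0 (s 1 (A 0 (f 2)))) = coord f 1 (A 1 (s 0 (s 1 (f 2))))" using mixed[OF fV[OF m(4)]] by simp
  have m0: "coord f j (s 0 (s 1 (A 0 (f 0)))) = coord f j (A 1 (s 0 (s 1 (f 0))))" for j using mixed[OF fV[OF m(1)]] by simp
  have A1': "A 1 (f 0) = f 0" "A 1 (f 1) = f 2" "A 1 (f 2) = f 1" using A1 by simp_all
  have e1: "b * d = d * y" using m2 m by (simp add: A0 A1' S' lin co scale_right_distrib del: One_nat_def)
  have e2: "a * b = y * a" using m0[of 0] m by (simp add: A0 A1' S' lin co scale_right_distrib del: One_nat_def)
  have e3: "a * d = 0" using m0[of 1] m by (simp add: A0 A1' S' lin co scale_right_distrib del: One_nat_def)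
  have b0: "coord f 0 (s 0 (s 1 (s 0 (f 0)))) = coord f 0 (s 1 (s 0 (s 1 (f 0))))" using braid[OF fV[OF m(1)]] by simp
  have b2: "coord f 2 (s 0 (s 1 (s 0 (f 2)))) = coord f 2 (s 1 (s 0 (s 1 (f 2))))" using braid[OF fV[OF m(4)]] by simp
  have e4: "a * y * a + c * a * b = y * (a * y)" using b0 m
    by (simp add: S' lin co scale_right_distrib del: One_nat_def) (simp add: algebra_simps)?
  have e5: "y * (d * y) = b * d * c + d * y * d" using b2 m
    by (simp add: S' lin co scale_right_distrib del: One_nat_def) (simp add: algebra_simps)?
  show a0: "y + a11 = 0"
  proof (rule ccontr)
    assume "y + a11 \<noteq> 0"
    then have a: "a \<noteq> 0" by (simp add: a_def)
    then have "d = 0" "b = y" using e2 e3 by auto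
    moreover from this have "a * y * (a + c - y) = 0" using e4 by (simp add: algebra_simps)
    then have "a + c = y" using a y0 by simp
    ultimately have "a11 + a21 + of_nat n * 0 = 0 \<and> a12 + a22 + of_nat n * 0 = 0"
      by (simp add: a_def b_def c_def d_def algebra_simps)
    then show False using kernel_not_invariant[OF f form0] by blast
  qed
  show d0: "y + a22 = 0"
  proof (rule ccontr)
    assume "y + a22 \<noteq> 0"
    then have d: "d \<noteq> 0" by (simp add: d_def)
    then have "a = 0" "b = y" using e1 e3 by auto
    moreover from this have "d * y * (c + d - y) = 0" using e5 by (simp add: algebra_simps)
    then have "c + d = y" using d y0 by simp
    ultimately have "of_nat n * 0 + a11 + a12 = 0 \<and> of_nat n * 0 + a21 + a22 = 0"
      by (simp add: a_def b_def c_def d_def algebra_simps)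
    then show False using total_not_invariant[OF f form0] by blast
  qed
  have ad: "a = 0" "d = 0" using a0 d0 by (simp_all add: a_def d_def)
  show "a12 \<noteq> 0" using S'(2) s_inj[OF m(2) fV, of 1] f0[of 1] m ad by (auto simp: b_def)
  show "a21 \<noteq> 0" using S'(1) s_inj[OF m(2) fV, of 0] f0[of 0] m ad by (auto simp: c_def)
  show "s i (f i) = a21 *s f (Suc i)" if "Suc i < n" using s1[OF that] ad by (simp add: c_def)
  show "s i (f (Suc i)) = a12 *s f i" if "Suc i < n" using s2[OF that] ad by (simp add: b_def)
  show "s i (f j) = y *s f j" if "Suc i < n" "j < n" "j \<noteq> i" "j \<noteq> Suc i" using s3[OF that] .
qed

end

context welded_rep
begin

text \<open>A basis in which the operators have the matrices of \<open>X(y, k) \<otimes> \<tau>(z, l)\<close>.\<close>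

definition standard_basis :: "'a \<Rightarrow> 'a \<Rightarrow> 'a \<Rightarrow> 'a \<Rightarrow> (nat \<Rightarrow> 'b) \<Rightarrow> bool" where
  "standard_basis k y z l h \<longleftrightarrow>
     (\<forall>i<n. h i \<in> V) \<and> (\<forall>c. (\<Sum>i<n. c i *s h i) = 0 \<longrightarrow> (\<forall>i<n. c i = 0)) \<and>
     (\<forall>i j. Suc i < n \<longrightarrow> j < n \<longrightarrow>
        s i (h j) = (if j = i then y *s h (Suc i) else if j = Suc i then (y * z) *s h i else y *s h j) \<and>
        A i (h j) = (if j = i then (k * l) *s h (Suc i) else if j = Suc i then (k / l) *s h i else k *s h j))"

text \<open>For \<open>z = 1\<close> every \<open>s i\<close> is \<open>y\<close> times a permutation of the basis and preserves its sum up to the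
  factor \<open>y\<close>.\<close>

lemma standard_basis_parameter:
  assumes h: "standard_basis k y z l h"
  shows "z \<noteq> 1"
proof
  assume "z = 1"
  with h have hV: "\<And>i. i < n \<Longrightarrow> h i \<in> V" and ind: "\<And>c. (\<Sum>i<n. c i *s h i) = 0 \<Longrightarrow> \<forall>i<n. c i = 0"
    and s: "\<And>i j. Suc i < n \<Longrightarrow> j < n \<Longrightarrow> s i (h j) = y *s h (adj i j)"
    unfolding standard_basis_def adj_def by auto
  define H where "H = (\<Sum>i<n. h i)"
  have sH: "s i H = y *s H" if i: "Suc i < n" for i
  proof -
    have "s i H = (\<Sum>j<n. y *s h (adj i j))"
      unfolding H_def s_sum[OF i] by (rule sum.cong) (use s i in auto)
    also have "\<dots> = (\<Sum>j<n. y *s h j)"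
      by (rule sum.reindex_bij_witness[of _ "adj i" "adj i"]) (use i adj_less in auto)
    finally show ?thesis by (simp add: H_def scale_sum_right)
  qed
  have HV: "H \<in> V" unfolding H_def using hV by (intro subspace_sum[OF V]) auto
  have "span {H} = {0} \<or> span {H} = V"
  proof (rule irreducible[OF subspace_span])
    show "span {H} \<subseteq> V" using HV V by (simp add: span_minimal)
    fix i v assume i: "Suc i < n" and "v \<in> span {H}"
    then obtain d where "v = d *s H" by (auto simp: span_singleton)
    then show "s i v \<in> span {H}" using i by (simp add: s_scale sH span_scale span_base)
  qed
  moreover have "0 < n" using n by simp
  then have "H \<noteq> 0" using ind[of "\<lambda>_. 1"] by (auto simp: H_def)
  moreover have "H \<in> span {H}" by (simp add: span_base)
  ultimately have "V \<subseteq> span {H}" by auto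
  then have "dim_at_most V (card {H})" by (intro dim_at_most_span) auto
  then have "dim_at_most V (n - 1)" by (rule dim_at_most_subset) (use n in auto)
  then show False using dim_V(2) by simp
qed

text \<open>Rescaling the \<open>i\<close>-th basis vector by \<open>t\<^sup>i\<close> with \<open>t = c / y\<close> turns the block \<open>(0, b; c, 0)\<close> of \<open>s i\<close>
  into \<open>y (0, z; 1, 0)\<close> and the permutation matrix of \<open>A i\<close> into the block with entries \<open>t = 1 / l\<close>
  and \<open>l\<close>.\<close>

lemma perm_basis_imp_standard_basis:
  assumes e: "perm_basis e"
  shows "\<exists>y z l h. y \<noteq> 0 \<and> z \<noteq> 0 \<and> l \<noteq> 0 \<and> standard_basis 1 y z l h"
proof -
  obtain y p q r a11 a21 c a12 a22 g
    where "\<And>j. j < n \<Longrightarrow> s 0 (e j) = sigma_form e y p q r a11 a21 c a12 a22 g 0 j"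
    using sigma_form_exists[OF e] by blast
  from straightened_basis[OF e this] obtain f where f: "perm_basis f"
    and s0: "\<forall>j<n. s 0 (f j) = y *s f j
     + (if j = 0 then a11 *s f 0 + a21 *s f 1 else 0) + (if j = 1 then a12 *s f 0 + a22 *s f 1 else 0)" by blast
  note B = block_is_antidiagonal[OF f s0]
  define t where "t = a21 / y"
  have t0: "t \<noteq> 0" using B(1,3) by (simp add: t_def)
  define h where "h i = t ^ i *s f i" for i
  define z where "z = a12 * a21 / y\<^sup>2"
  have yt: "t * y = a21" "t * a12 = y * z" using B(1) by (simp_all add: t_def z_def power2_eq_square)
  have "standard_basis 1 y z (1 / t) h" unfolding standard_basis_def
  proof (intro conjI allI impI)
    show "h i \<in> V" if "i < n" for i unfolding h_def using that by (intro subspace_scale[OF V] e_V[OF f])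
    show "c i = 0" if c: "(\<Sum>i<n. c i *s h i) = 0" and i: "i < n" for c i
      using e_independent[OF f, of "\<lambda>i. c i * t ^ i"] that t0 by (simp add: h_def)
    fix i j assume i: "Suc i < n" and j: "j < n"
    have "t ^ i * a21 = y * t ^ Suc i" "t ^ Suc i * a12 = y * z * t ^ i"
      unfolding yt(1)[symmetric] using yt(2) by (simp_all add: algebra_simps)
    then show "s i (h j) = (if j = i then y *s h (Suc i) else if j = Suc i then (y * z) *s h i else y *s h j)"
      unfolding h_def using i j B(6)[OF i] B(7)[OF i] B(8)[OF i j] by (simp add: s_scale mult.commute)
    show "A i (h j) = (if j = i then (1 * (1 / t)) *s h (Suc i) else if j = Suc i then (1 / (1 / t)) *s h i else 1 *s h j)"
      unfolding h_def using i j A_e[OF f i j] t0 by (simp add: A_scale adj_def)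
  qed
  moreover have "z \<noteq> 0" using B by (simp add: z_def)
  ultimately show ?thesis using t0 B(1) by (metis divide_eq_0_iff zero_neq_one)
qed

lemma welded_twist: "welded_rep scale V (\<lambda>i v. - A i v) n s"
proof -
  interpret t: coxeter_rep scale V "\<lambda>i v. - A i v" n by (rule twist)
  show ?thesis
  proof
    show "(\<lambda>v. - A i (s j v)) v = s j (- A i v)" if "i + 2 \<le> j \<or> j + 2 \<le> i" "Suc i < n" "Suc j < n" "v \<in> V" for i j v
      using A_s_comm[OF that] that by (simp add: s_neg)
    show "- A i (- A (Suc i) (s i v)) = s (Suc i) (- A i (- A (Suc i) v))" if "Suc (Suc i) < n" "v \<in> V" for i v
      using A_A_s[OF that] that by (simp add: A_neg s_neg)
    show "s i (s (Suc i) (- A i v)) = - A (Suc i) (s i (s (Suc i) v))" if "Suc (Suc i) < n" "v \<in> V" for i v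
      using s_s_A[OF that] that by (simp add: s_neg)
  qed (use s_closed s_inj s_comm s_braid irreducible eigenvector n dim_V in \<open>auto simp: s_add s_scale\<close>)
qed

text \<open>The eigenspaces of \<open>A 0\<close> are complementary, so one of them has dimension at most \<open>n div 2\<close>; if it
  is \<open>Pos 0\<close>, the representation is twisted by the sign, which accounts for \<open>k = -1\<close>.\<close>

theorem standard_basis_exists:
  "\<exists>k y z l h. (k = 1 \<or> k = -1) \<and> y \<noteq> 0 \<and> z \<noteq> 0 \<and> l \<noteq> 0 \<and> z \<noteq> 1 \<and> standard_basis k y z l h"
proof -
  have n0: "Suc 0 < n" using n by simp
  show ?thesis
  proof (cases "dim_at_most (Neg 0) (n div 2)")
    case True
    then interpret welded_rep_small_Neg scale V A n s by unfold_locales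
    obtain e where "perm_basis e" using perm_basis_exists by blast
    from perm_basis_imp_standard_basis[OF this] standard_basis_parameter show ?thesis by blast
  next
    case False
    interpret t: welded_rep scale V "\<lambda>i v. - A i v" n s by (rule welded_twist)
    have "dim_at_most (Pos 0) (n - Suc (n div 2))"
      using Neg_Pos(3)[of 0] subspace_Neg[OF n0] subspace_Pos[OF n0]
      by (intro dim_at_most_complement[OF dim_V(1) _ _ Neg_Pos(2,1) _ False]) auto
    then have "dim_at_most (t.Neg 0) (n div 2)"
      unfolding Pos_twist by (rule dim_at_most_subset) auto
    then interpret t: welded_rep_small_Neg scale V "\<lambda>i v. - A i v" n s by unfold_locales
    obtain e where "t.perm_basis e" using t.perm_basis_exists by blast
    from t.perm_basis_imp_standard_basis[OF this] obtain y z l h where yzl: "y \<noteq> 0" "z \<noteq> 0" "l \<noteq> 0"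
      and h: "t.standard_basis 1 y z l h" by blast
    have hA: "A i (h j) = (if j = i then (-1 * l) *s h (Suc i) else if j = Suc i then (-1 / l) *s h i else (-1) *s h j)"
      if "Suc i < n" "j < n" for i j
    proof -
      have "- A i (h j) = (if j = i then (1 * l) *s h (Suc i) else if j = Suc i then (1 / l) *s h i else 1 *s h j)"
        using h that unfolding t.standard_basis_def by blast
      from arg_cong[OF this, of uminus]
      have "A i (h j) = - (if j = i then (1 * l) *s h (Suc i) else if j = Suc i then (1 / l) *s h i else 1 *s h j)"
        by (simp only: minus_minus)
      then show ?thesis by simp
    qed
    have hs: "s i (h j) = (if j = i then y *s h (Suc i) else if j = Suc i then (y * z) *s h i else y *s h j)"
      if "Suc i < n" "j < n" for i j
      using h that unfolding t.standard_basis_def by blast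
    have hV: "h i \<in> V" if "i < n" for i using h that unfolding t.standard_basis_def by blast
    have ind: "\<forall>c. (\<Sum>i<n. c i *s h i) = 0 \<longrightarrow> (\<forall>i<n. c i = 0)"
      using h unfolding t.standard_basis_def by (elim conjE)
    have sb: "standard_basis (-1) y z l h"
      unfolding standard_basis_def by (intro conjI allI impI hV ind[rule_format] hs hA)
    show ?thesis using yzl sb standard_basis_parameter[OF sb]
      by (intro exI[of _ "-1"] exI[of _ y] exI[of _ z] exI[of _ l] exI[of _ h]) simp
  qed
qed

end

section \<open>Matrices as operators on functions\<close>

lemma (in scalar_space) injective_endomorphism_surj:
  assumes W: "subspace W" "dim_at_most W d" and g: "module_hom scale scale g"
    and inj: "\<And>v. v \<in> W \<Longrightarrow> g v = 0 \<Longrightarrow> v = 0" and im: "\<And>v. v \<in> W \<Longrightarrow> g v \<in> W"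
  shows "W \<subseteq> g ` W"
proof
  interpret g: module_hom scale scale g by (rule g)
  fix w assume w: "w \<in> W"
  obtain B where B: "B \<subseteq> W" "independent B" "W \<subseteq> span B"
    using maximal_independent_subset by blast
  have fB: "finite B" using dim_at_mostD(1)[OF W(2) B(1,2)] .
  have inj_W: "inj_on g W" using inj by (auto simp: g.inj_on_iff_eq_0[OF W(1)])
  have sB: "span B \<subseteq> W" using B(1) W(1) by (simp add: span_minimal)
  have ind: "independent (g ` B)"
    using B(2) inj_on_subset[OF inj_W sB] by (rule g.independent_injective_image)
  have card: "card (g ` B) = card B" by (rule card_image[OF inj_on_subset[OF inj_W B(1)]])
  have "w \<in> span (g ` B)"
  proof (rule ccontr)
    assume n: "w \<notin> span (g ` B)"
    then have "independent (insert w (g ` B))" using ind by (rule independent_insertI)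
    moreover have "insert w (g ` B) \<subseteq> span B" using w B im by auto
    ultimately have "card (insert w (g ` B)) \<le> card B" using independent_span_bound[OF fB] by blast
    moreover have "w \<notin> g ` B" using n span_base by blast
    ultimately show False using fB card by simp
  qed
  also have "span (g ` B) = g ` span B" by (rule g.span_image)
  also have "\<dots> \<subseteq> g ` W" using sB by auto
  finally show "w \<in> g ` W" .
qed

text \<open>Vectors of \<open>\<complex>\<^sup>n\<close> are represented by functions supported in \<open>{..<n}\<close>, because these live in a
  type that is an abelian group.\<close>

definition fun_scale :: "complex \<Rightarrow> (nat \<Rightarrow> complex) \<Rightarrow> nat \<Rightarrow> complex" where
  "fun_scale c f = (\<lambda>i. c * f i)"

interpretation fs: scalar_space fun_scale
  by unfold_locales (auto simp: fun_scale_def fun_eq_iff algebra_simps)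

definition supported :: "nat \<Rightarrow> (nat \<Rightarrow> complex) set" where
  "supported n = {f. \<forall>i\<ge>n. f i = 0}"

definition act :: "nat \<Rightarrow> complex mat \<Rightarrow> (nat \<Rightarrow> complex) \<Rightarrow> nat \<Rightarrow> complex" where
  "act n M f = (\<lambda>i. if i < n then (\<Sum>j<n. M $$ (i, j) * f j) else 0)"

lemma act_supported: "act n M f \<in> supported n"
  by (simp add: act_def supported_def)

lemma subspace_supported: "fs.subspace (supported n)"
  by (rule fs.subspaceI) (auto simp: supported_def fun_scale_def)

lemma act_hom: "module_hom fun_scale fun_scale (act n M)"
  by unfold_locales
    (auto simp: act_def fun_scale_def fun_eq_iff algebra_simps sum.distrib sum_distrib_left)

lemma act_mult:
  assumes "M \<in> carrier_mat n n" "N \<in> carrier_mat n n"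
  shows "act n (M * N) f = act n M (act n N f)"
proof
  fix i
  show "act n (M * N) f i = act n M (act n N f) i"
  proof (cases "i < n")
    case True
    have "(\<Sum>j<n. (M * N) $$ (i, j) * f j) = (\<Sum>j<n. \<Sum>k<n. M $$ (i, k) * N $$ (k, j) * f j)"
      using True assms by (intro sum.cong)
        (auto simp: scalar_prod_def sum_distrib_right lessThan_atLeast0)
    also have "\<dots> = (\<Sum>k<n. \<Sum>j<n. M $$ (i, k) * N $$ (k, j) * f j)" by (rule sum.swap)
    finally show ?thesis using True
      by (simp add: act_def sum_distrib_left mult.assoc)
  qed (simp add: act_def)
qed

lemma act_one: "f \<in> supported n \<Longrightarrow> act n (1\<^sub>m n) f = f"
proof
  fix i assume f: "f \<in> supported n"
  have "(\<Sum>j<n. 1\<^sub>m n $$ (i, j) * f j) = (\<Sum>j<n. if j = i then f j else 0)" if "i < n"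
    using that by (intro sum.cong) auto
  then show "act n (1\<^sub>m n) f i = f i" using f by (auto simp: act_def supported_def)
qed

definition unit :: "nat \<Rightarrow> nat \<Rightarrow> complex" where
  "unit i = (\<lambda>j. if j = i then 1 else 0)"

lemma sum_unit: "(\<Sum>i<n. fun_scale (c i) (unit i)) j = (if j < n then c j else 0)"
proof -
  have "(\<Sum>i<n. fun_scale (c i) (unit i)) j = (\<Sum>i<n. fun_scale (c i) (unit i) j)"
    by (induction n) (auto simp: zero_fun_def plus_fun_def)
  also have "\<dots> = (\<Sum>i<n. if i = j then c i else 0)"
    by (rule sum.cong) (auto simp: fun_scale_def unit_def)
  finally show ?thesis by simp
qed

lemma dim_supported: "fs.dim_at_most (supported n) n" "0 < n \<Longrightarrow> \<not> fs.dim_at_most (supported n) (n - 1)"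
proof -
  have ind: "\<forall>i\<in>{..<n}. c i = 0" if "(\<Sum>i<n. fun_scale (c i) (unit i)) = 0" for c
  proof
    fix i assume "i \<in> {..<n}"
    then have "c i = (\<Sum>i<n. fun_scale (c i) (unit i)) i" by (simp add: sum_unit)
    then show "c i = 0" unfolding that by (simp add: zero_fun_def)
  qed
  have "f \<in> fs.span (unit ` {..<n})" if "f \<in> supported n" for f
  proof -
    have "f = (\<Sum>i<n. fun_scale (f i) (unit i))"
      using that by (auto simp: fun_eq_iff sum_unit supported_def)
    also have "\<dots> \<in> fs.span (unit ` {..<n})"
      by (intro fs.span_sum fs.span_scale fs.span_base) auto
    finally show ?thesis .
  qed
  then have "fs.dim_at_most (supported n) (card (unit ` {..<n}))"
    by (intro fs.dim_at_most_span) auto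
  then show "fs.dim_at_most (supported n) n"
    by (rule fs.dim_at_most_subset) (use card_image_le[of "{..<n}" unit] in auto)
  show "\<not> fs.dim_at_most (supported n) (n - 1)" if "0 < n"
  proof
    assume "fs.dim_at_most (supported n) (n - 1)"
    then have "card {..<n} \<le> n - 1"
      by (rule fs.card_le_dim_at_most[where x = unit]) (use ind in \<open>auto simp: supported_def unit_def\<close>)
    then show False using that by simp
  qed
qed

lemma act_vec:
  assumes "M \<in> carrier_mat n n" "v \<in> carrier_vec n"
  shows "act n M (\<lambda>i. if i < n then v $ i else 0) = (\<lambda>i. if i < n then (M *\<^sub>v v) $ i else 0)"
  using assms by (auto simp: act_def fun_eq_iff scalar_prod_def lessThan_atLeast0 intro!: sum.cong)

section \<open>From matrix representations of the group to operators\<close>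

lemma GL_carrierE:
  assumes "M \<in> carrier (GL n)"
  obtains "M \<in> carrier_mat n n" "inv\<^bsub>GL n\<^esub> M \<in> carrier_mat n n" "inv\<^bsub>GL n\<^esub> M \<in> carrier (GL n)"
    "M * inv\<^bsub>GL n\<^esub> M = 1\<^sub>m n" "inv\<^bsub>GL n\<^esub> M * M = 1\<^sub>m n"
proof -
  interpret group "GL n" by (rule group_GL)
  have c: "K \<in> carrier_mat n n" if "K \<in> carrier (GL n)" for K
    using that by (simp add: GL_def units_of_def Units_def ring_mat_def)
  show thesis using that[OF c c inv_closed[OF assms]] assms r_inv[OF assms] l_inv[OF assms] by simp
qed

lemma presented_group_relation:
  assumes "(l, r) \<in> R" "l \<in> words S" "r \<in> words S"
  shows "word_class S R l = word_class S R r"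
  using word_cong.rel[of "[]" S "[]" l r R] assms by (intro word_class_eq) auto

lemma hom_word_class:
  assumes G: "group G" and f: "f \<in> hom (presented_group S R) G" and w: "w \<in> words S"
  shows "f (word_class S R w) = word_eval G (\<lambda>s. f (word_class S R [(s, True)])) w"
  using w
proof (induction w)
  interpret f: group_hom "presented_group S R" G f
    using G f group_presented_group by (simp add: group_hom_def group_hom_axioms_def)
  case Nil
  then show ?case using f.hom_one by (simp add: presented_group_one)
next
  interpret f: group_hom "presented_group S R" G f
    using G f group_presented_group by (simp add: group_hom_def group_hom_axioms_def)
  case (Cons x w)
  obtain t b where x: "x = (t, b)" by (cases x)
  have t: "t \<in> S" and w: "w \<in> words S" using Cons.prems x by auto
  have tc: "word_class S R [(t, b)] \<in> carrier (presented_group S R)" for b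
    using t by (auto simp: presented_group_carrier)
  have "word_class S R [(t, False)] \<otimes>\<^bsub>presented_group S R\<^esub> word_class S R [(t, True)] = \<one>\<^bsub>presented_group S R\<^esub>"
    using t word_class_eq[OF word_cong.cancel[of "[]" S "[]" t False R]]
    by (simp add: presented_group_mult presented_group_one)
  from f.G.inv_equality[OF this tc tc]
  have "word_class S R [(t, False)] = inv\<^bsub>presented_group S R\<^esub> word_class S R [(t, True)]" by simp
  then have l: "f (word_class S R [(t, b)]) = (if b then f (word_class S R [(t, True)]) else inv\<^bsub>G\<^esub> f (word_class S R [(t, True)]))"
    using tc f.hom_inv by (cases b) auto
  have wc: "word_class S R w \<in> carrier (presented_group S R)" using w by (simp add: presented_group_carrier)
  have "word_class S R (x # w) = word_class S R [(t, b)] \<otimes>\<^bsub>presented_group S R\<^esub> word_class S R w"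
    using t w x by (simp add: presented_group_mult)
  then have "f (word_class S R (x # w)) = f (word_class S R [(t, b)]) \<otimes>\<^bsub>G\<^esub> f (word_class S R w)"
    using f.hom_mult tc wc by simp
  then show ?case using l Cons.IH w by (simp add: x)
qed

lemma hom_presented_group_eqI:
  assumes G: "group G" and f: "f \<in> hom (presented_group S R) G" "f' \<in> hom (presented_group S R) G"
    and eq: "\<And>t. t \<in> S \<Longrightarrow> f (word_class S R [(t, True)]) = f' (word_class S R [(t, True)])"
    and g: "g \<in> carrier (presented_group S R)"
  shows "f g = f' g"
proof -
  obtain w where w: "w \<in> words S" "g = word_class S R w" using g by (auto simp: presented_group_carrier)
  have "word_eval G (\<lambda>s. f (word_class S R [(s, True)])) w = word_eval G (\<lambda>s. f' (word_class S R [(s, True)])) w"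
    using w(1)
  proof (induction w)
    case (Cons x w)
    then show ?case using eq by (cases x) auto
  qed simp
  then show ?thesis using w hom_word_class[OF G f(1)] hom_word_class[OF G f(2)] by simp
qed

lemma GL_carrier_mat: "M \<in> carrier (GL n) \<Longrightarrow> M \<in> carrier_mat n n"
  by (rule GL_carrierE)

lemma hom_WB_closed: "\<rho> \<in> hom (WB n) (GL n) \<Longrightarrow> g \<in> carrier (WB n) \<Longrightarrow> \<rho> g \<in> carrier (GL n)"
  by (auto simp: hom_def)

lemma wb_gen_carrier: "t \<in> wb_gens n \<Longrightarrow> word_class (wb_gens n) (wb_rels n) [(t, b)] \<in> carrier (WB n)"
  by (auto simp: WB_def presented_group_carrier)

lemma wb_alpha_carrier: "i \<in> {1..n-1} \<Longrightarrow> wb_alpha n i \<in> carrier (WB n)"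
  and wb_sigma_carrier: "i \<in> {1..n-1} \<Longrightarrow> wb_sigma n i \<in> carrier (WB n)"
  unfolding wb_alpha_def wb_sigma_def by (rule wb_gen_carrier, simp add: wb_gens_def)+

lemma wb_rels_members:
  shows "i \<in> {1..n-1} \<Longrightarrow> ([(Alpha_gen i, True), (Alpha_gen i, True)], []) \<in> wb_rels n"
    and "i \<in> {1..n-1} \<Longrightarrow> j \<in> {1..n-1} \<Longrightarrow> i + 2 \<le> j \<Longrightarrow>
      ([(Alpha_gen i, True), (Alpha_gen j, True)], [(Alpha_gen j, True), (Alpha_gen i, True)]) \<in> wb_rels n"
    and "i \<in> {1..n-1} \<Longrightarrow> j \<in> {1..n-1} \<Longrightarrow> i + 2 \<le> j \<Longrightarrow>
      ([(Sigma_gen i, True), (Sigma_gen j, True)], [(Sigma_gen j, True), (Sigma_gen i, True)]) \<in> wb_rels n"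
    and "i \<in> {1..n-1} \<Longrightarrow> j \<in> {1..n-1} \<Longrightarrow> i + 2 \<le> j \<or> j + 2 \<le> i \<Longrightarrow>
      ([(Alpha_gen i, True), (Sigma_gen j, True)], [(Sigma_gen j, True), (Alpha_gen i, True)]) \<in> wb_rels n"
    and "i \<in> {1..n-2} \<Longrightarrow> ([(Alpha_gen i, True), (Alpha_gen (Suc i), True), (Alpha_gen i, True)],
      [(Alpha_gen (Suc i), True), (Alpha_gen i, True), (Alpha_gen (Suc i), True)]) \<in> wb_rels n"
    and "i \<in> {1..n-2} \<Longrightarrow> ([(Sigma_gen i, True), (Sigma_gen (Suc i), True), (Sigma_gen i, True)],
      [(Sigma_gen (Suc i), True), (Sigma_gen i, True), (Sigma_gen (Suc i), True)]) \<in> wb_rels n"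
    and "i \<in> {1..n-2} \<Longrightarrow> ([(Alpha_gen i, True), (Alpha_gen (Suc i), True), (Sigma_gen i, True)],
      [(Sigma_gen (Suc i), True), (Alpha_gen i, True), (Alpha_gen (Suc i), True)]) \<in> wb_rels n"
    and "i \<in> {1..n-2} \<Longrightarrow> ([(Sigma_gen i, True), (Sigma_gen (Suc i), True), (Alpha_gen i, True)],
      [(Alpha_gen (Suc i), True), (Sigma_gen i, True), (Sigma_gen (Suc i), True)]) \<in> wb_rels n"
  by (auto simp: wb_rels_def Let_def)

lemma act_word_eval:
  assumes "v \<in> supported n" "\<And>t. t \<in> set ts \<Longrightarrow> f t \<in> carrier (GL n)"
  shows "word_eval (GL n) f (map (\<lambda>t. (t, True)) ts) \<in> carrier_mat n n \<and>
    act n (word_eval (GL n) f (map (\<lambda>t. (t, True)) ts)) v = foldr (\<lambda>t. act n (f t)) ts v"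
  using assms(2)
proof (induction ts)
  case Nil
  then show ?case using act_one[OF assms(1)] by simp
next
  case (Cons t ts)
  have "f t \<in> carrier_mat n n" using Cons.prems[of t] by (auto intro: GL_carrier_mat)
  then show ?case using Cons by (simp add: act_mult)
qed

text \<open>Through this lemma the defining relations of the group become the assumptions of \<open>welded_rep\<close>.\<close>

lemma act_relation:
  assumes \<rho>: "\<rho> \<in> hom (WB n) (GL n)" and v: "v \<in> supported n"
    and R: "(map (\<lambda>t. (t, True)) ts, map (\<lambda>t. (t, True)) us) \<in> wb_rels n"
    and gens: "set ts \<subseteq> wb_gens n" "set us \<subseteq> wb_gens n"
  defines "f \<equiv> \<lambda>t. \<rho> (word_class (wb_gens n) (wb_rels n) [(t, True)])"
  shows "foldr (\<lambda>t. act n (f t)) ts v = foldr (\<lambda>t. act n (f t)) us v"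
proof -
  have w: "map (\<lambda>t. (t, True)) xs \<in> words (wb_gens n)" if "set xs \<subseteq> wb_gens n" for xs
    using that by (induction xs) auto
  have \<rho>': "\<rho> \<in> hom (presented_group (wb_gens n) (wb_rels n)) (GL n)" using \<rho> by (simp add: WB_def)
  have eval: "word_eval (GL n) f (map (\<lambda>t. (t, True)) xs) =
      \<rho> (word_class (wb_gens n) (wb_rels n) (map (\<lambda>t. (t, True)) xs))" if "set xs \<subseteq> wb_gens n" for xs
    unfolding f_def using hom_word_class[OF group_GL \<rho>' w[OF that]] by simp
  have c: "f t \<in> carrier (GL n)" if "t \<in> set ts \<union> set us" for t
    unfolding f_def using that gens hom_WB_closed[OF \<rho> wb_gen_carrier] by auto
  have "word_eval (GL n) f (map (\<lambda>t. (t, True)) ts) = word_eval (GL n) f (map (\<lambda>t. (t, True)) us)"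
    unfolding eval[OF gens(1)] eval[OF gens(2)]
    using presented_group_relation[OF R w[OF gens(1)] w[OF gens(2)]] by simp
  then show ?thesis
    using act_word_eval[OF v, of ts f] act_word_eval[OF v, of us f] c by simp
qed

lemma act_inverse:
  assumes "M \<in> carrier (GL n)" "v \<in> supported n"
  shows "act n (inv\<^bsub>GL n\<^esub> M) (act n M v) = v" "act n M (act n (inv\<^bsub>GL n\<^esub> M) v) = v"
proof -
  obtain N where N: "N = inv\<^bsub>GL n\<^esub> M" "M \<in> carrier_mat n n" "N \<in> carrier_mat n n" "M * N = 1\<^sub>m n" "N * M = 1\<^sub>m n"
    using GL_carrierE[OF assms(1)] by metis
  show "act n (inv\<^bsub>GL n\<^esub> M) (act n M v) = v" "act n M (act n (inv\<^bsub>GL n\<^esub> M) v) = v"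
    unfolding N(1)[symmetric] using act_mult[OF N(3,2), of v] act_mult[OF N(2,3), of v] N(4,5) act_one[OF assms(2)]
    by simp_all
qed

text \<open>Invariance under the generators extends to their inverses because an injective operator maps
  a finite-dimensional invariant subspace onto itself.\<close>

lemma invariant_braid_subgroup:
  assumes \<rho>: "\<rho> \<in> hom (WB n) (GL n)" and W: "fs.subspace W" "W \<subseteq> supported n"
    and inv: "\<And>i v. i \<in> {1..n-1} \<Longrightarrow> v \<in> W \<Longrightarrow> act n (\<rho> (wb_sigma n i)) v \<in> W"
    and g: "g \<in> braid_subgroup n"
  shows "v \<in> W \<Longrightarrow> act n (\<rho> g) v \<in> W"
proof -
  interpret \<rho>: group_hom "WB n" "GL n" \<rho>
    using \<rho> group_WB group_GL by (simp add: group_hom_def group_hom_axioms_def)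
  have "g \<in> carrier (WB n)"
    using g subgroup.subset[OF subgroup_braid_subgroup] by blast
  have gens: "wb_sigma n ` {1..n-1} \<subseteq> carrier (WB n)" using wb_sigma_carrier by auto
  show "v \<in> W \<Longrightarrow> act n (\<rho> g) v \<in> W"
    using g unfolding braid_subgroup_def
  proof (induction arbitrary: v rule: generate.induct)
    case one
    then show ?case using W(2) act_one \<rho>.hom_one by auto
  next
    case (incl h)
    then show ?case using inv by auto
  next
    case (inv h)
    then obtain i where i: "i \<in> {1..n-1}" "h = wb_sigma n i" by auto
    have c: "\<rho> h \<in> carrier (GL n)" using i wb_sigma_carrier \<rho>.hom_closed by auto
    have "W \<subseteq> act n (\<rho> h) ` W"
    proof (rule fs.injective_endomorphism_surj[OF W(1) _ act_hom])
      show "fs.dim_at_most W n" using fs.dim_at_most_subset[OF dim_supported(1) W(2)] by simp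
      show "u = 0" if "u \<in> W" "act n (\<rho> h) u = 0" for u
        using act_inverse(1)[OF c, of u] that W(2) module_hom.zero[OF act_hom] by auto
      show "act n (\<rho> h) u \<in> W" if "u \<in> W" for u using assms(4)[OF i(1) that] i(2) by simp
    qed
    then obtain u where u: "u \<in> W" "v = act n (\<rho> h) u" using inv.prems by auto
    have "\<rho> (inv\<^bsub>WB n\<^esub> h) = inv\<^bsub>GL n\<^esub> (\<rho> h)" using i wb_sigma_carrier by simp
    then show ?case using u act_inverse(1)[OF c] W(2) by auto
  next
    case (eng h1 h2)
    have "h1 \<in> carrier (WB n)" "h2 \<in> carrier (WB n)"
      using eng.hyps \<rho>.G.generate_in_carrier[OF gens] by auto
    then have "\<rho> (h1 \<otimes>\<^bsub>WB n\<^esub> h2) = \<rho> h1 * \<rho> h2" "\<rho> h1 \<in> carrier_mat n n" "\<rho> h2 \<in> carrier_mat n n"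
      using \<rho>.hom_closed by (auto intro: GL_carrier_mat)
    then show ?case using eng by (simp add: act_mult)
  qed
qed

lemma irreducible_functions:
  assumes \<rho>: "\<rho> \<in> hom (WB n) (GL n)"
    and irr: "irreducible_rep (WB n\<lparr>carrier := braid_subgroup n\<rparr>) n \<rho>"
    and W: "fs.subspace W" "W \<subseteq> supported n"
    and inv: "\<And>i v. i \<in> {1..n-1} \<Longrightarrow> v \<in> W \<Longrightarrow> act n (\<rho> (wb_sigma n i)) v \<in> W"
  shows "W = {0} \<or> W = supported n"
proof -
  define emb :: "complex vec \<Rightarrow> nat \<Rightarrow> complex" where "emb v = (\<lambda>i. if i < n then v $ i else 0)" for v
  define X where "X = {v \<in> carrier_vec n. emb v \<in> W}"
  have emb_add: "emb (u + v) = emb u + emb v" if "u \<in> carrier_vec n" "v \<in> carrier_vec n" for u v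
    using that by (auto simp: emb_def fun_eq_iff)
  have emb_smult: "emb (c \<cdot>\<^sub>v u) = fun_scale c (emb u)" if "u \<in> carrier_vec n" for u c
    using that by (auto simp: emb_def fun_eq_iff fun_scale_def)
  have emb_0: "emb (0\<^sub>v n) = 0" by (auto simp: emb_def fun_eq_iff)
  have emb_vec: "emb (vec n f) = f" if "f \<in> supported n" for f
    using that by (auto simp: emb_def fun_eq_iff supported_def)
  have "VectorSpace.subspace class_ring X (module_vec TYPE(complex) n)"
    unfolding VectorSpace.subspace_def LinearCombinations.submodule_def
  proof (intro conjI allI impI)
    show "vectorspace class_ring (module_vec TYPE(complex) n)" by (rule vec_vs)
    then show "Module.module class_ring (module_vec TYPE(complex) n)" by (simp add: vectorspace_def)
    show "X \<subseteq> carrier (module_vec TYPE(complex) n)" by (auto simp: X_def module_vec_simps)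
    show "u \<oplus>\<^bsub>module_vec TYPE(complex) n\<^esub> v \<in> X" if "u \<in> X" "v \<in> X" for u v
      using that fs.subspace_add[OF W(1)] by (auto simp: X_def module_vec_simps emb_add)
    show "\<zero>\<^bsub>module_vec TYPE(complex) n\<^esub> \<in> X"
      using fs.subspace_0[OF W(1)] by (auto simp: X_def module_vec_simps emb_0)
    show "c \<odot>\<^bsub>module_vec TYPE(complex) n\<^esub> v \<in> X" if "v \<in> X" for c v
      using that fs.subspace_scale[OF W(1)] by (auto simp: X_def module_vec_simps emb_smult)
  qed
  moreover have "\<rho> g *\<^sub>v v \<in> X" if g: "g \<in> braid_subgroup n" and v: "v \<in> X" for g v
  proof -
    have "g \<in> carrier (WB n)" using g subgroup.subset[OF subgroup_braid_subgroup] by blast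
    then have c: "\<rho> g \<in> carrier_mat n n" using hom_WB_closed[OF \<rho>] by (auto intro: GL_carrier_mat)
    have "act n (\<rho> g) (emb v) \<in> W"
      using invariant_braid_subgroup[OF \<rho> W inv g] v by (simp add: X_def)
    then show ?thesis using act_vec[OF c, of v] v c by (simp add: X_def emb_def)
  qed
  ultimately have "X = {0\<^sub>v n} \<or> X = carrier_vec n"
    using irr unfolding irreducible_rep_def by simp
  moreover have "f \<in> W \<longleftrightarrow> vec n f \<in> X" if "f \<in> supported n" for f
    using that by (simp add: X_def emb_vec)
  ultimately show ?thesis
  proof (elim disjE)
    assume X: "X = {0\<^sub>v n}"
    have "f = 0" if "f \<in> W" for f
    proof -
      have f: "f \<in> supported n" using that W(2) by blast
      then have "vec n f \<in> X" using that by (simp add: X_def emb_vec)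
      then have "vec n f = 0\<^sub>v n" using X by blast
      then show ?thesis using emb_vec[of f] that W(2) emb_0 by auto
    qed
    then show ?thesis using fs.subspace_0[OF W(1)] by auto
  next
    assume X: "X = carrier_vec n"
    have "f \<in> W" if "f \<in> supported n" for f
      using X emb_vec[OF that] by (auto simp: X_def set_eq_iff dest: spec[of _ "vec n f"])
    then show ?thesis using W(2) by auto
  qed
qed

lemma welded_rep_of_hom:
  assumes n: "7 \<le> n" and \<rho>: "\<rho> \<in> hom (WB n) (GL n)"
    and irr: "irreducible_rep (WB n\<lparr>carrier := braid_subgroup n\<rparr>) n \<rho>"
  shows "welded_rep fun_scale (supported n) (\<lambda>i. act n (\<rho> (wb_alpha n (Suc i)))) n
    (\<lambda>i. act n (\<rho> (wb_sigma n (Suc i))))"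
proof -
  note R = act_relation[OF \<rho>]
  have g: "Alpha_gen (Suc i) \<in> wb_gens n" "Sigma_gen (Suc i) \<in> wb_gens n" if "Suc i < n" for i
    using that by (auto simp: wb_gens_def)
  have b: "\<rho> (wb_sigma n (Suc i)) \<in> carrier (GL n)" if "Suc i < n" for i
    using that by (intro hom_WB_closed[OF \<rho>] wb_sigma_carrier) auto
  note unf = wb_alpha_def wb_sigma_def
  show ?thesis
  proof
    fix i j v
    assume v: "v \<in> supported n"
    show "Suc i < n \<Longrightarrow> act n (\<rho> (wb_alpha n (Suc i))) (act n (\<rho> (wb_alpha n (Suc i))) v) = v"
      using R[OF v, of "[Alpha_gen (Suc i), Alpha_gen (Suc i)]" "[]"] g wb_rels_members(1)[of "Suc i" n]
       by (simp add: unf)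
    show "i + 2 \<le> j \<Longrightarrow> Suc j < n \<Longrightarrow> act n (\<rho> (wb_alpha n (Suc i))) (act n (\<rho> (wb_alpha n (Suc j))) v) =
        act n (\<rho> (wb_alpha n (Suc j))) (act n (\<rho> (wb_alpha n (Suc i))) v)"
      using R[OF v, of "[Alpha_gen (Suc i), Alpha_gen (Suc j)]" "[Alpha_gen (Suc j), Alpha_gen (Suc i)]"] g wb_rels_members(2-4)[of "Suc i" n "Suc j"]
       by (simp add: unf)
    show "i + 2 \<le> j \<Longrightarrow> Suc j < n \<Longrightarrow> act n (\<rho> (wb_sigma n (Suc i))) (act n (\<rho> (wb_sigma n (Suc j))) v) =
        act n (\<rho> (wb_sigma n (Suc j))) (act n (\<rho> (wb_sigma n (Suc i))) v)"
      using R[OF v, of "[Sigma_gen (Suc i), Sigma_gen (Suc j)]" "[Sigma_gen (Suc j), Sigma_gen (Suc i)]"] g wb_rels_members(2-4)[of "Suc i" n "Suc j"]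
       by (simp add: unf)
    show "i + 2 \<le> j \<or> j + 2 \<le> i \<Longrightarrow> Suc i < n \<Longrightarrow> Suc j < n \<Longrightarrow>
        act n (\<rho> (wb_alpha n (Suc i))) (act n (\<rho> (wb_sigma n (Suc j))) v) =
        act n (\<rho> (wb_sigma n (Suc j))) (act n (\<rho> (wb_alpha n (Suc i))) v)"
      using R[OF v, of "[Alpha_gen (Suc i), Sigma_gen (Suc j)]" "[Sigma_gen (Suc j), Alpha_gen (Suc i)]"] g wb_rels_members(2-4)[of "Suc i" n "Suc j"]
       by (simp add: unf)
    assume i: "Suc (Suc i) < n"
    let ?a = "Alpha_gen (Suc i)" and ?a' = "Alpha_gen (Suc (Suc i))"
    let ?s = "Sigma_gen (Suc i)" and ?s' = "Sigma_gen (Suc (Suc i))"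
    show "act n (\<rho> (wb_alpha n (Suc i))) (act n (\<rho> (wb_alpha n (Suc (Suc i)))) (act n (\<rho> (wb_alpha n (Suc i))) v)) =
        act n (\<rho> (wb_alpha n (Suc (Suc i)))) (act n (\<rho> (wb_alpha n (Suc i))) (act n (\<rho> (wb_alpha n (Suc (Suc i)))) v))"
      using R[OF v, of "[?a, ?a', ?a]" "[?a', ?a, ?a']"] g[of i] g[of "Suc i"] i wb_rels_members(5-)[of "Suc i" n]
       by (simp add: unf)
    show "act n (\<rho> (wb_sigma n (Suc i))) (act n (\<rho> (wb_sigma n (Suc (Suc i)))) (act n (\<rho> (wb_sigma n (Suc i))) v)) =
        act n (\<rho> (wb_sigma n (Suc (Suc i)))) (act n (\<rho> (wb_sigma n (Suc i))) (act n (\<rho> (wb_sigma n (Suc (Suc i)))) v))"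
      using R[OF v, of "[?s, ?s', ?s]" "[?s', ?s, ?s']"] g[of i] g[of "Suc i"] i wb_rels_members(5-)[of "Suc i" n]
       by (simp add: unf)
    show "act n (\<rho> (wb_alpha n (Suc i))) (act n (\<rho> (wb_alpha n (Suc (Suc i)))) (act n (\<rho> (wb_sigma n (Suc i))) v)) =
        act n (\<rho> (wb_sigma n (Suc (Suc i)))) (act n (\<rho> (wb_alpha n (Suc i))) (act n (\<rho> (wb_alpha n (Suc (Suc i)))) v))"
      using R[OF v, of "[?a, ?a', ?s]" "[?s', ?a, ?a']"] g[of i] g[of "Suc i"] i wb_rels_members(5-)[of "Suc i" n]
       by (simp add: unf)
    show "act n (\<rho> (wb_sigma n (Suc i))) (act n (\<rho> (wb_sigma n (Suc (Suc i)))) (act n (\<rho> (wb_alpha n (Suc i))) v)) =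
        act n (\<rho> (wb_alpha n (Suc (Suc i)))) (act n (\<rho> (wb_sigma n (Suc i))) (act n (\<rho> (wb_sigma n (Suc (Suc i)))) v))"
      using R[OF v, of "[?s, ?s', ?a]" "[?a', ?s, ?s']"] g[of i] g[of "Suc i"] i wb_rels_members(5-)[of "Suc i" n]
       by (simp add: unf)
  next
    show "Suc i < n \<Longrightarrow> v \<in> supported n \<Longrightarrow> act n (\<rho> (wb_sigma n (Suc i))) v = 0 \<Longrightarrow> v = 0" for i v
      using act_inverse(1)[OF b, of i v] module_hom.zero[OF act_hom] by simp
    show "W = {0} \<or> W = supported n" if W: "fs.subspace W" "W \<subseteq> supported n"
        "\<And>i v. Suc i < n \<Longrightarrow> v \<in> W \<Longrightarrow> act n (\<rho> (wb_sigma n (Suc i))) v \<in> W" for W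
    proof (rule irreducible_functions[OF \<rho> irr W(1,2)])
      show "act n (\<rho> (wb_sigma n i)) v \<in> W" if "i \<in> {1..n-1}" "v \<in> W" for i v
        using W(3)[of "i - 1" v] that by (cases i) auto
    qed
    show "\<exists>v\<in>supported n. v \<noteq> 0 \<and> (\<exists>c. act n (\<rho> (wb_sigma n (Suc 0))) v = fun_scale c v)"
    proof -
      let ?M = "\<rho> (wb_sigma n (Suc 0))"
      have M: "?M \<in> carrier_mat n n" using b[of 0] n by (auto intro: GL_carrier_mat)
      have "spectrum ?M \<noteq> {}" using spectrum_non_empty[OF M] n by simp
      then obtain c v where v: "v \<in> carrier_vec n" "v \<noteq> 0\<^sub>v n" "?M *\<^sub>v v = c \<cdot>\<^sub>v v"
        using M by (auto simp: spectrum_def eigenvalue_def eigenvector_def)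
      let ?f = "\<lambda>i. if i < n then v $ i else 0"
      have "?f \<in> supported n" by (simp add: supported_def)
      moreover have "?f \<noteq> 0"
      proof
        assume "?f = 0"
        then have "v $ i = 0" if "i < n" for i using that fun_cong[of ?f 0 i] by simp
        then have "v = 0\<^sub>v n" using v(1) by (intro eq_vecI) auto
        then show False using v(2) by simp
      qed
      moreover have "act n ?M ?f = fun_scale c ?f"
        using act_vec[OF M v(1)] v by (auto simp: fun_scale_def fun_eq_iff)
      ultimately show ?thesis by blast
    qed
  qed (use n dim_supported in \<open>auto simp: subspace_supported act_supported module_hom.add[OF act_hom] module_hom.scale[OF act_hom]\<close>)
qed

section \<open>Equivalence with the model representation\<close>

lemma mult_monomial_mat:
  assumes M: "M \<in> carrier_mat n n" and p: "\<And>j. j < n \<Longrightarrow> p j < n"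
    and h: "\<And>j. j < n \<Longrightarrow> act n M (h j) = fun_scale (d j) (h (p j))"
  shows "M * mat n n (\<lambda>(i, j). h j i) = mat n n (\<lambda>(i, j). h j i) * monomial_mat n p d"
proof (rule eq_matI)
  fix i j
  assume "i < dim_row (mat n n (\<lambda>(i, j). h j i) * monomial_mat n p d)"
    "j < dim_col (mat n n (\<lambda>(i, j). h j i) * monomial_mat n p d)"
  then have ij: "i < n" "j < n" by (auto simp: monomial_mat_def)
  have "(M * mat n n (\<lambda>(i, j). h j i)) $$ (i, j) = act n M (h j) i"
    using ij M by (simp add: act_def scalar_prod_def lessThan_atLeast0)
  also have "\<dots> = d j * h (p j) i" using h[OF ij(2)] by (simp add: fun_scale_def)
  also have "\<dots> = (\<Sum>k<n. if k = p j then h k i * d j else 0)" using p[OF ij(2)] by simp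
  also have "\<dots> = (\<Sum>k<n. h k i * (if k = p j then d j else 0))" by (rule sum.cong) auto
  also have "\<dots> = (mat n n (\<lambda>(i, j). h j i) * monomial_mat n p d) $$ (i, j)"
    using ij by (simp add: monomial_mat_def scalar_prod_def lessThan_atLeast0 del: sum.delta)
  finally show "(M * mat n n (\<lambda>(i, j). h j i)) $$ (i, j) = (mat n n (\<lambda>(i, j). h j i) * monomial_mat n p d) $$ (i, j)" .
qed (use M in \<open>auto simp: monomial_mat_def\<close>)

lemma independent_family_mat_GL:
  assumes V: "\<And>j. j < n \<Longrightarrow> h j \<in> supported n"
    and ind: "\<And>c. (\<Sum>j<n. fun_scale (c j) (h j)) = 0 \<Longrightarrow> \<forall>j<n. c j = 0"
  shows "mat n n (\<lambda>(i, j). h j i) \<in> carrier (GL n)"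
proof -
  let ?H = "mat n n (\<lambda>(i, j). h j i)"
  have H: "?H \<in> carrier_mat n n" by simp
  have sum: "(\<Sum>j<n. fun_scale (c j) (h j)) i = (\<Sum>j<n. c j * h j i)" for c i
    by (induction n) (auto simp: fun_scale_def)
  have "det ?H \<noteq> 0"
  proof
    assume "det ?H = 0"
    then obtain v where v: "v \<in> carrier_vec n" "v \<noteq> 0\<^sub>v n" "?H *\<^sub>v v = 0\<^sub>v n"
      using det_0_iff_vec_prod_zero[OF H] by auto
    have "(\<Sum>j<n. fun_scale (v $ j) (h j)) i = 0" for i
    proof (cases "i < n")
      case True
      then have "(?H *\<^sub>v v) $ i = (\<Sum>j<n. v $ j * h j i)"
        using v(1) by (auto simp: scalar_prod_def lessThan_atLeast0 intro!: sum.cong)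
      then show ?thesis unfolding sum using v(3) True by simp
    next
      case False
      then show ?thesis unfolding sum using V by (auto simp: supported_def intro!: sum.neutral)
    qed
    then have "\<forall>j<n. v $ j = 0" by (intro ind) (auto simp: fun_eq_iff)
    then have "v = 0\<^sub>v n" using v(1) by (intro eq_vecI) auto
    then show False using v(2) by simp
  qed
  from det_non_zero_imp_unit[OF H this, of "()"] show ?thesis
    by (simp add: GL_def units_of_def)
qed

lemma smult_smult_mat: "a \<cdot>\<^sub>m (b \<cdot>\<^sub>m M) = (a * b :: complex) \<cdot>\<^sub>m M"
  by (rule eq_matI) auto

lemma smult_one_mat: "(1 :: complex) \<cdot>\<^sub>m M = M"
  by (rule eq_matI) auto

lemma smult_mult_smult:
  fixes a b :: complex
  assumes "M \<in> carrier_mat n n" "N \<in> carrier_mat n n"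
  shows "(a \<cdot>\<^sub>m M) * (b \<cdot>\<^sub>m N) = (a * b) \<cdot>\<^sub>m (M * N)"
  using mult_smult_assoc_mat[OF assms(1), of "b \<cdot>\<^sub>m N" n a] mult_smult_distrib[OF assms, of b] assms
  by (simp add: smult_smult_mat)

lemma tensor_char_hom:
  assumes "\<chi> \<in> hom (WB n) complex_units" "\<tau> \<in> hom (WB n) (GL n)"
  shows "tensor_char \<chi> \<tau> \<in> hom (WB n) (GL n)"
proof (rule homI)
  fix g assume g: "g \<in> carrier (WB n)"
  then have c: "\<chi> g \<noteq> 0" and t: "\<tau> g \<in> carrier (GL n)" using assms by (auto simp: hom_def)
  obtain N where N: "\<tau> g \<in> carrier_mat n n" "N \<in> carrier_mat n n" "\<tau> g * N = 1\<^sub>m n" "N * \<tau> g = 1\<^sub>m n"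
    using GL_carrierE[OF t] by metis
  show "tensor_char \<chi> \<tau> g \<in> carrier (GL n)"
    unfolding tensor_char_def
  proof (rule GL_carrierI[of _ _ "inverse (\<chi> g) \<cdot>\<^sub>m N"])
    show "\<chi> g \<cdot>\<^sub>m \<tau> g * (inverse (\<chi> g) \<cdot>\<^sub>m N) = 1\<^sub>m n"
      using N c by (simp add: smult_mult_smult[OF N(1,2)] smult_one_mat)
    show "inverse (\<chi> g) \<cdot>\<^sub>m N * (\<chi> g \<cdot>\<^sub>m \<tau> g) = 1\<^sub>m n"
      using N c by (simp add: smult_mult_smult[OF N(2,1)] smult_one_mat)
  qed (use N in auto)
next
  fix g h assume gh: "g \<in> carrier (WB n)" "h \<in> carrier (WB n)"
  then have m: "\<tau> g \<in> carrier_mat n n" "\<tau> h \<in> carrier_mat n n"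
    using assms by (auto simp: hom_def intro: GL_carrier_mat)
  have "\<chi> (g \<otimes>\<^bsub>WB n\<^esub> h) = \<chi> g * \<chi> h" "\<tau> (g \<otimes>\<^bsub>WB n\<^esub> h) = \<tau> g * \<tau> h"
    using assms gh by (auto simp: hom_def)
  then show "tensor_char \<chi> \<tau> (g \<otimes>\<^bsub>WB n\<^esub> h) = tensor_char \<chi> \<tau> g \<otimes>\<^bsub>GL n\<^esub> tensor_char \<chi> \<tau> h"
    by (simp add: tensor_char_def smult_mult_smult[OF m])
qed

lemma conjugate_hom:
  assumes \<rho>: "\<rho> \<in> hom (WB n) (GL n)" and P: "P \<in> carrier (GL n)"
  shows "(\<lambda>g. P * \<rho> g * inv\<^bsub>GL n\<^esub> P) \<in> hom (WB n) (GL n)"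
proof -
  interpret G: group "GL n" by (rule group_GL)
  have c: "\<rho> g \<in> carrier (GL n)" if "g \<in> carrier (WB n)" for g by (rule hom_WB_closed[OF \<rho> that])
  have "(\<lambda>g. P \<otimes>\<^bsub>GL n\<^esub> \<rho> g \<otimes>\<^bsub>GL n\<^esub> inv\<^bsub>GL n\<^esub> P) \<in> hom (WB n) (GL n)"
  proof (rule homI)
    show "P \<otimes>\<^bsub>GL n\<^esub> \<rho> g \<otimes>\<^bsub>GL n\<^esub> inv\<^bsub>GL n\<^esub> P \<in> carrier (GL n)" if "g \<in> carrier (WB n)" for g
      using c[OF that] P by (intro G.m_closed G.inv_closed)
    fix g h assume gh: "g \<in> carrier (WB n)" "h \<in> carrier (WB n)"
    have "inv\<^bsub>GL n\<^esub> P \<otimes>\<^bsub>GL n\<^esub> (P \<otimes>\<^bsub>GL n\<^esub> K) = K" if "K \<in> carrier (GL n)" for K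
      using that P G.m_assoc[of "inv\<^bsub>GL n\<^esub> P" P K] G.l_inv[OF P] G.l_one[OF that] by simp
    moreover have "\<rho> (g \<otimes>\<^bsub>WB n\<^esub> h) = \<rho> g \<otimes>\<^bsub>GL n\<^esub> \<rho> h" using \<rho> gh by (auto simp: hom_def)
    ultimately show "P \<otimes>\<^bsub>GL n\<^esub> \<rho> (g \<otimes>\<^bsub>WB n\<^esub> h) \<otimes>\<^bsub>GL n\<^esub> inv\<^bsub>GL n\<^esub> P =
        P \<otimes>\<^bsub>GL n\<^esub> \<rho> g \<otimes>\<^bsub>GL n\<^esub> inv\<^bsub>GL n\<^esub> P \<otimes>\<^bsub>GL n\<^esub> (P \<otimes>\<^bsub>GL n\<^esub> \<rho> h \<otimes>\<^bsub>GL n\<^esub> inv\<^bsub>GL n\<^esub> P)"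
      using c[OF gh(1)] c[OF gh(2)] P by (simp add: G.m_assoc del: GL_simps)
  qed
  then show ?thesis by simp
qed

lemma smult_swap_mat:
  "c \<cdot>\<^sub>m swap_mat n i a b = monomial_mat n (\<lambda>j. if j = i - 1 then i else if j = i then i - 1 else j)
     (\<lambda>j. if j = i - 1 then c * b else if j = i then c * a else c)"
  by (rule eq_matI) (auto simp: swap_mat_def monomial_mat_def)

lemma tensor_tau_generators:
  fixes n :: nat
  assumes "y \<noteq> 0" "z \<noteq> 0" "l \<noteq> 0" "k \<in> {-1, 1}"
  defines "T \<equiv> tensor_char (X_rep y k) (tau_rep n z l)"
  shows "T \<in> hom (WB n) (GL n)"
    and "i \<in> {1..n-1} \<Longrightarrow> T (wb_sigma n i) = y \<cdot>\<^sub>m swap_mat n i z 1"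
    and "i \<in> {1..n-1} \<Longrightarrow> T (wb_alpha n i) = k \<cdot>\<^sub>m swap_mat n i (1 / l) l"
  using tensor_char_hom[OF X_rep(1)[OF assms(1,4)] tau_rep(1)[OF assms(2,3)]]
    X_rep(2,3)[OF assms(1,4), of i n] tau_rep(2,3)[OF assms(2,3), of i n] tau_gen_swap_mat[of i n z l]
  by (simp_all add: T_def tensor_char_def del: tau_gen.simps)

theorem equivalent_tensor_tau_exists:
  assumes n: "7 \<le> n" and \<rho>: "\<rho> \<in> hom (WB n) (GL n)"
    and irr: "irreducible_rep (WB n\<lparr>carrier := braid_subgroup n\<rparr>) n \<rho>"
  shows "\<exists>y k z l. y \<noteq> 0 \<and> z \<noteq> 0 \<and> l \<noteq> 0 \<and> z \<noteq> 1 \<and> k \<in> {-1, 1} \<and>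
    equivalent_reps (WB n) n \<rho> (tensor_char (X_rep y k) (tau_rep n z l))"
proof -
  interpret w: welded_rep fun_scale "supported n" "\<lambda>i. act n (\<rho> (wb_alpha n (Suc i)))" n
      "\<lambda>i. act n (\<rho> (wb_sigma n (Suc i)))"
    by (rule welded_rep_of_hom[OF n \<rho> irr])
  obtain k y z l h where k: "k = 1 \<or> k = -1" and nz: "y \<noteq> 0" "z \<noteq> 0" "l \<noteq> 0" "z \<noteq> 1"
    and h: "w.standard_basis k y z l h"
    using w.standard_basis_exists by blast
  have k': "k \<in> {-1, 1}" using k by auto
  define T where "T = tensor_char (X_rep y k) (tau_rep n z l)"
  note T = tensor_tau_generators[OF nz(1-3) k', where n = n, folded T_def]
  define H where "H = mat n n (\<lambda>(i, j). h j i)"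
  have hV: "h j \<in> supported n" if "j < n" for j using h that unfolding w.standard_basis_def by blast
  have ind: "\<forall>j<n. c j = 0" if "(\<Sum>j<n. fun_scale (c j) (h j)) = 0" for c
    using h that unfolding w.standard_basis_def by blast
  have HG: "H \<in> carrier (GL n)" unfolding H_def using hV ind by (rule independent_family_mat_GL)
  interpret G: group "GL n" by (rule group_GL)
  define P where "P = inv\<^bsub>GL n\<^esub> H"
  have P: "P \<in> carrier (GL n)" "inv\<^bsub>GL n\<^esub> P = H" unfolding P_def using HG by simp_all
  have conj: "P * \<rho> g * inv\<^bsub>GL n\<^esub> P = M" if "\<rho> g * H = H * M" "g \<in> carrier (WB n)" "M \<in> carrier_mat n n" for g M
  proof -
    have c: "P \<in> carrier_mat n n" "H \<in> carrier_mat n n" "\<rho> g \<in> carrier_mat n n"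
      using GL_carrier_mat P(1) HG hom_WB_closed[OF \<rho> that(2)] by auto
    have PH: "P * H = 1\<^sub>m n" unfolding P_def using G.l_inv[OF HG] by simp
    have "P * \<rho> g * H = P * (H * M)" using c that(1) by (simp add: assoc_mult_mat[of P n n _ n H n])
    also have "\<dots> = P * H * M" using c that(3) by (simp add: assoc_mult_mat[of P n n H n M n])
    finally show ?thesis using PH that(3) P(2) by simp
  qed
  have sig: "P * \<rho> (wb_sigma n i) * inv\<^bsub>GL n\<^esub> P = T (wb_sigma n i)" if i: "i \<in> {1..n-1}" for i
  proof (rule conj)
    obtain j where j: "i = Suc j" "Suc j < n" using i by (cases i) auto
    have "act n (\<rho> (wb_sigma n i)) (h c) = (if c = j then fun_scale y (h (Suc j)) else if c = Suc j then fun_scale (y * z) (h j) else fun_scale y (h c))"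
      if "c < n" for c
      using h that j unfolding w.standard_basis_def j(1) by blast
    then show "\<rho> (wb_sigma n i) * H = H * T (wb_sigma n i)"
      unfolding T(2)[OF i] smult_swap_mat H_def
      using j GL_carrier_mat[OF hom_WB_closed[OF \<rho> wb_sigma_carrier[OF i]]]
      by (intro mult_monomial_mat) auto
    show "wb_sigma n i \<in> carrier (WB n)" using i by (rule wb_sigma_carrier)
    show "T (wb_sigma n i) \<in> carrier_mat n n" unfolding T(2)[OF i] by simp
  qed
  have alp: "P * \<rho> (wb_alpha n i) * inv\<^bsub>GL n\<^esub> P = T (wb_alpha n i)" if i: "i \<in> {1..n-1}" for i
  proof (rule conj)
    obtain j where j: "i = Suc j" "Suc j < n" using i by (cases i) auto
    have "act n (\<rho> (wb_alpha n i)) (h c) = (if c = j then fun_scale (k * l) (h (Suc j)) else if c = Suc j then fun_scale (k / l) (h j) else fun_scale k (h c))"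
      if "c < n" for c
      using h that j unfolding w.standard_basis_def j(1) by blast
    then show "\<rho> (wb_alpha n i) * H = H * T (wb_alpha n i)"
      unfolding T(3)[OF i] smult_swap_mat H_def
      using j GL_carrier_mat[OF hom_WB_closed[OF \<rho> wb_alpha_carrier[OF i]]]
      by (intro mult_monomial_mat) auto
    show "wb_alpha n i \<in> carrier (WB n)" using i by (rule wb_alpha_carrier)
    show "T (wb_alpha n i) \<in> carrier_mat n n" unfolding T(3)[OF i] by simp
  qed
  have "P * \<rho> g * inv\<^bsub>GL n\<^esub> P = T g" if g: "g \<in> carrier (WB n)" for g
  proof (rule hom_presented_group_eqI[OF group_GL conjugate_hom[OF \<rho> P(1), unfolded WB_def] T(1)[unfolded WB_def]])
    show "g \<in> carrier (presented_group (wb_gens n) (wb_rels n))" using g by (simp add: WB_def)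
    fix t assume "t \<in> wb_gens n"
    then obtain i where i: "i \<in> {1..n-1}" and t: "t = Alpha_gen i \<or> t = Sigma_gen i" by (auto simp: wb_gens_def)
    then show "P * \<rho> (word_class (wb_gens n) (wb_rels n) [(t, True)]) * inv\<^bsub>GL n\<^esub> P =
        T (word_class (wb_gens n) (wb_rels n) [(t, True)])"
      using sig[OF i] alp[OF i] unfolding wb_alpha_def wb_sigma_def by auto
  qed
  then have "equivalent_reps (WB n) n \<rho> T"
    unfolding equivalent_reps_def using P(1) by (intro bexI[of _ P]) auto
  then show ?thesis using nz k' unfolding T_def by blast
qed

section \<open>Uniqueness of the parameters\<close>

definition mat_trace :: "complex mat \<Rightarrow> complex" where
  "mat_trace M = (\<Sum>i<dim_row M. M $$ (i, i))"

lemma mat_trace_mult_commute: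
  assumes "M \<in> carrier_mat n n" "N \<in> carrier_mat n n"
  shows "mat_trace (M * N) = mat_trace (N * M)"
proof -
  have tr: "mat_trace (K * L) = (\<Sum>i<n. \<Sum>j<n. K $$ (i, j) * L $$ (j, i))"
    if "K \<in> carrier_mat n n" "L \<in> carrier_mat n n" for K L
    using that by (simp add: mat_trace_def scalar_prod_def lessThan_atLeast0)
  have "mat_trace (M * N) = (\<Sum>j<n. \<Sum>i<n. M $$ (i, j) * N $$ (j, i))"
    unfolding tr[OF assms] by (rule sum.swap)
  then show ?thesis unfolding tr[OF assms(2,1)] by (simp add: mult.commute)
qed

lemma mat_trace_equivalent:
  assumes \<rho>: "\<rho> \<in> hom (WB n) (GL n)" and eq: "equivalent_reps (WB n) n \<rho> T" and g: "g \<in> carrier (WB n)"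
  shows "mat_trace (T g) = mat_trace (\<rho> g)"
proof -
  obtain P where P: "P \<in> carrier (GL n)" "T g = P * \<rho> g * inv\<^bsub>GL n\<^esub> P"
    using eq g unfolding equivalent_reps_def by blast
  have R: "\<rho> g \<in> carrier_mat n n" by (rule GL_carrier_mat[OF hom_WB_closed[OF \<rho> g]])
  obtain N where N: "N = inv\<^bsub>GL n\<^esub> P" "P \<in> carrier_mat n n" "N \<in> carrier_mat n n" "N * P = 1\<^sub>m n"
    using GL_carrierE[OF P(1)] by metis
  have "mat_trace (T g) = mat_trace (N * (P * \<rho> g))"
    unfolding P(2) N(1)[symmetric] using N R by (intro mat_trace_mult_commute) auto
  also have "N * (P * \<rho> g) = N * P * \<rho> g" by (rule assoc_mult_mat[symmetric]) (use N R in auto)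
  finally show ?thesis using N(4) R by simp
qed

text \<open>The group elements below involve only the first two generators of each kind, so their matrices
  are constant diagonal from the fourth basis vector on.\<close>

lemma mat_trace_monomial:
  assumes n: "3 \<le> n" and K: "\<And>j. 3 \<le> j \<Longrightarrow> p j = j \<and> d j = K"
  shows "mat_trace (monomial_mat n p d) = (if p 0 = 0 then d 0 else 0) + (if p 1 = 1 then d 1 else 0)
    + (if p 2 = 2 then d 2 else 0) + of_nat (n - 3) * K"
proof -
  have "mat_trace (monomial_mat n p d) = (\<Sum>j<n. if p j = j then d j else 0)"
    by (auto simp: mat_trace_def monomial_mat_def intro!: sum.cong)
  also have "\<dots> = (\<Sum>j<3. if p j = j then d j else 0) + (\<Sum>j=3..<n. if p j = j then d j else 0)"
    using n by (simp add: lessThan_atLeast0 sum.atLeastLessThan_concat)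
  also have "(\<Sum>j=3..<n. if p j = j then d j else 0) = (\<Sum>j=3..<n. K)"
    by (rule sum.cong) (use K in auto)
  finally show ?thesis by (simp add: eval_nat_numeral)
qed

text \<open>The element \<open>\<theta> = \<alpha>\<^sub>1 \<sigma>\<^sub>1\<close> acts by \<open>k y\<close> times the diagonal matrix with entries \<open>1 / l, l z, 1, \<dots>, 1\<close>.
  Its trace does not distinguish \<open>l\<close> from \<open>1 / (l z)\<close>. The last element is \<open>\<theta>\<close> divided by its
  conjugate under \<open>\<alpha>\<^sub>2\<close>, which is diagonal with entries \<open>1, l z, 1 / (l z), 1, \<dots>, 1\<close>.\<close>

lemma tensor_tau_traces:
  fixes n :: nat
  assumes n: "3 \<le> n" and nz: "y \<noteq> 0" "z \<noteq> 0" "l \<noteq> 0" "k \<in> {-1, 1}"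
  defines "T \<equiv> tensor_char (X_rep y k) (tau_rep n z l)"
    and "\<theta> \<equiv> wb_alpha n 1 \<otimes>\<^bsub>WB n\<^esub> wb_sigma n 1"
  shows "mat_trace (T (wb_alpha n 1)) = (1 + of_nat (n - 3)) * k"
    and "mat_trace (T (wb_sigma n 1)) = (1 + of_nat (n - 3)) * y"
    and "mat_trace (T (wb_sigma n 1 \<otimes>\<^bsub>WB n\<^esub> wb_sigma n 1)) = (2 * z + 1 + of_nat (n - 3)) * y\<^sup>2"
    and "mat_trace (T \<theta>) = (1 / l + l * z + 1 + of_nat (n - 3)) * (k * y)"
    and "mat_trace (T (\<theta> \<otimes>\<^bsub>WB n\<^esub> (wb_alpha n 2 \<otimes>\<^bsub>WB n\<^esub> (inv\<^bsub>WB n\<^esub> \<theta> \<otimes>\<^bsub>WB n\<^esub> wb_alpha n 2)))) =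
      1 + l * z + 1 / (l * z) + of_nat (n - 3)"
proof -
  note T = tensor_tau_generators[OF nz, where n = n, folded T_def]
  interpret T: group_hom "WB n" "GL n" T
    using T(1) group_WB group_GL by (simp add: group_hom_def group_hom_axioms_def)
  have i: "1 \<in> {1..n-1}" "2 \<in> {1..n-1}" using n by auto
  have c: "wb_alpha n 1 \<in> carrier (WB n)" "wb_sigma n 1 \<in> carrier (WB n)" "wb_alpha n 2 \<in> carrier (WB n)"
    using i wb_alpha_carrier wb_sigma_carrier by auto
  have \<theta>c: "\<theta> \<in> carrier (WB n)" unfolding \<theta>_def using c by simp
  have k2: "k * k = 1" "k \<noteq> 0" using nz(4) by auto
  define p q :: "nat \<Rightarrow> nat" where "p j = (if j = 0 then 1 else if j = 1 then 0 else j)"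
    and "q j = (if j = 1 then 2 else if j = 2 then 1 else j)" for j
  define ds where "ds j = (if j = 0 then y else if j = 1 then y * z else y)" for j :: nat
  define da where "da j = (if j = 0 then k * l else if j = 1 then k / l else k)" for j :: nat
  define db where "db j = (if j = 1 then k * l else if j = 2 then k / l else k)" for j :: nat
  define dF where "dF j = (if j = 0 then l / (k * y) else if j = 1 then 1 / (k * l * y * z) else 1 / (k * y))" for j :: nat
  have lt: "p j < n" "q j < n" if "j < n" for j using that n by (auto simp: p_def q_def)
  have S: "T (wb_sigma n 1) = monomial_mat n p ds"
    unfolding T(2)[OF i(1)] smult_swap_mat by (rule monomial_mat_cong) (auto simp: p_def ds_def)
  have A: "T (wb_alpha n 1) = monomial_mat n p da"
    unfolding T(3)[OF i(1)] smult_swap_mat by (rule monomial_mat_cong) (auto simp: p_def da_def)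
  have B: "T (wb_alpha n 2) = monomial_mat n q db"
    unfolding T(3)[OF i(2)] smult_swap_mat by (rule monomial_mat_cong) (auto simp: q_def db_def)
  have Th: "T \<theta> = monomial_mat n (\<lambda>j. p (p j)) (\<lambda>j. da (p j) * ds j)"
    unfolding \<theta>_def using c by (simp add: S A monomial_mat_mult lt del: One_nat_def)
  have F: "T (inv\<^bsub>WB n\<^esub> \<theta>) = monomial_mat n (\<lambda>j. j) dF"
  proof -
    let ?F = "monomial_mat n (\<lambda>j. j) dF" and ?E = "T (inv\<^bsub>WB n\<^esub> \<theta>)"
    have E: "?E \<in> carrier_mat n n" using \<theta>c by (intro GL_carrier_mat) simp
    have "T \<theta> * ?E = T (\<theta> \<otimes>\<^bsub>WB n\<^esub> inv\<^bsub>WB n\<^esub> \<theta>)"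
      using T.hom_mult[OF \<theta>c T.G.inv_closed[OF \<theta>c]] by (simp only: GL_simps)
    also have "\<theta> \<otimes>\<^bsub>WB n\<^esub> inv\<^bsub>WB n\<^esub> \<theta> = \<one>\<^bsub>WB n\<^esub>" using \<theta>c by (rule T.G.r_inv)
    also have "T \<one>\<^bsub>WB n\<^esub> = 1\<^sub>m n" using T.hom_one by simp
    finally have 1: "T \<theta> * ?E = 1\<^sub>m n" .
    have 2: "?F * T \<theta> = 1\<^sub>m n"
      unfolding Th one_mat_monomial using lt nz k2
      by (subst monomial_mat_mult) (auto intro!: monomial_mat_cong simp: p_def da_def ds_def dF_def)
    have "?E = ?F * T \<theta> * ?E" unfolding 2 using E by simp
    also have "\<dots> = ?F * (T \<theta> * ?E)" using E by (simp add: Th assoc_mult_mat[of _ n n _ n _ n])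
    also have "\<dots> = ?F" unfolding 1 by (rule right_mult_one_mat[OF monomial_mat_carrier])
    finally show ?thesis .
  qed
  show "mat_trace (T (wb_alpha n 1)) = (1 + of_nat (n - 3)) * k"
    unfolding A by (subst mat_trace_monomial[OF n, of _ _ k]) (auto simp: p_def da_def algebra_simps)
  show "mat_trace (T (wb_sigma n 1)) = (1 + of_nat (n - 3)) * y"
    unfolding S by (subst mat_trace_monomial[OF n, of _ _ y]) (auto simp: p_def ds_def algebra_simps)
  have SS: "T (wb_sigma n 1 \<otimes>\<^bsub>WB n\<^esub> wb_sigma n 1) = monomial_mat n (\<lambda>j. p (p j)) (\<lambda>j. ds (p j) * ds j)"
    using c by (simp add: S monomial_mat_mult lt del: One_nat_def)
  show "mat_trace (T (wb_sigma n 1 \<otimes>\<^bsub>WB n\<^esub> wb_sigma n 1)) = (2 * z + 1 + of_nat (n - 3)) * y\<^sup>2"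
    unfolding SS
    by (subst mat_trace_monomial[OF n, of _ _ "y * y"]) (auto simp: p_def ds_def algebra_simps power2_eq_square)
  show "mat_trace (T \<theta>) = (1 / l + l * z + 1 + of_nat (n - 3)) * (k * y)"
    unfolding Th
    by (subst mat_trace_monomial[OF n, of _ _ "k * y"]) (auto simp: p_def ds_def da_def algebra_simps)
  have W: "T (\<theta> \<otimes>\<^bsub>WB n\<^esub> (wb_alpha n 2 \<otimes>\<^bsub>WB n\<^esub> (inv\<^bsub>WB n\<^esub> \<theta> \<otimes>\<^bsub>WB n\<^esub> wb_alpha n 2))) =
      monomial_mat n (\<lambda>j. p (p (q (q j)))) (\<lambda>j. da (p (q (q j))) * ds (q (q j)) * (db (q j) * (dF (q j) * db j)))"
    using c \<theta>c by (simp add: Th B F monomial_mat_mult lt del: One_nat_def)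
  show "mat_trace (T (\<theta> \<otimes>\<^bsub>WB n\<^esub> (wb_alpha n 2 \<otimes>\<^bsub>WB n\<^esub> (inv\<^bsub>WB n\<^esub> \<theta> \<otimes>\<^bsub>WB n\<^esub> wb_alpha n 2)))) =
      1 + l * z + 1 / (l * z) + of_nat (n - 3)"
    unfolding W
    by (subst mat_trace_monomial[OF n, of _ _ 1])
      (use nz(1-3) k2 in \<open>auto simp: p_def q_def ds_def da_def db_def dF_def field_simps\<close>)
qed

text \<open>The first three traces determine \<open>k\<close>, \<open>y\<close> and \<open>z\<close>. If \<open>l \<noteq> l'\<close>, the last two force \<open>z l l' = 1\<close> and
  \<open>z\<^sup>2 l l' = 1\<close>, hence \<open>z = 1\<close>.\<close>

lemma tensor_tau_parameters_unique:
  assumes n: "3 \<le> n" and \<rho>: "\<rho> \<in> hom (WB n) (GL n)"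
    and nz: "y \<noteq> 0" "z \<noteq> 0" "l \<noteq> 0" "k \<in> {-1, 1}" "z \<noteq> 1"
    and nz': "y' \<noteq> 0" "z' \<noteq> 0" "l' \<noteq> 0" "k' \<in> {-1, 1}"
    and eq: "equivalent_reps (WB n) n \<rho> (tensor_char (X_rep y k) (tau_rep n z l))"
    and eq': "equivalent_reps (WB n) n \<rho> (tensor_char (X_rep y' k') (tau_rep n z' l'))"
  shows "y = y' \<and> k = k' \<and> z = z' \<and> l = l'"
proof -
  let ?T = "tensor_char (X_rep y k) (tau_rep n z l)" and ?T' = "tensor_char (X_rep y' k') (tau_rep n z' l')"
  let ?\<theta> = "wb_alpha n 1 \<otimes>\<^bsub>WB n\<^esub> wb_sigma n 1"
  let ?N = "of_nat (n - 3) :: complex"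
  interpret group "WB n" by (rule group_WB)
  have c: "wb_alpha n 1 \<in> carrier (WB n)" "wb_sigma n 1 \<in> carrier (WB n)" "wb_alpha n 2 \<in> carrier (WB n)"
    using n wb_alpha_carrier[of _ n] wb_sigma_carrier[of _ n] by auto
  have tr: "mat_trace (?T g) = mat_trace (?T' g)" if "g \<in> carrier (WB n)" for g
    using mat_trace_equivalent[OF \<rho> eq that] mat_trace_equivalent[OF \<rho> eq' that] by simp
  note t = tensor_tau_traces[OF n nz(1-4)] and t' = tensor_tau_traces[OF n nz']
  have N: "1 + ?N \<noteq> 0" by (metis of_nat_Suc of_nat_eq_0_iff nat.distinct(1) add.commute)
  have k: "k = k'" using tr[OF c(1)] N unfolding t(1) t'(1) by simp
  have y: "y = y'" using tr[OF c(2)] N unfolding t(2) t'(2) by simp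
  have "mat_trace (?T (wb_sigma n 1 \<otimes>\<^bsub>WB n\<^esub> wb_sigma n 1)) = mat_trace (?T' (wb_sigma n 1 \<otimes>\<^bsub>WB n\<^esub> wb_sigma n 1))"
    using c by (intro tr) simp
  then have z: "z = z'" unfolding t(3) t'(3) using nz(1) y by simp
  have "mat_trace (?T ?\<theta>) = mat_trace (?T' ?\<theta>)" using c by (intro tr) simp
  then have 1: "1 / l + l * z = 1 / l' + l' * z"
    unfolding t(4) t'(4) using nz(1,4) y k z by auto
  have "mat_trace (?T (?\<theta> \<otimes>\<^bsub>WB n\<^esub> (wb_alpha n 2 \<otimes>\<^bsub>WB n\<^esub> (inv\<^bsub>WB n\<^esub> ?\<theta> \<otimes>\<^bsub>WB n\<^esub> wb_alpha n 2)))) =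
      mat_trace (?T' (?\<theta> \<otimes>\<^bsub>WB n\<^esub> (wb_alpha n 2 \<otimes>\<^bsub>WB n\<^esub> (inv\<^bsub>WB n\<^esub> ?\<theta> \<otimes>\<^bsub>WB n\<^esub> wb_alpha n 2))))"
    using c by (intro tr) simp
  then have 2: "l * z + 1 / (l * z) = l' * z + 1 / (l' * z)"
    unfolding t(5) t'(5) using z by simp
  have "l = l'"
  proof (rule ccontr)
    assume ne: "l \<noteq> l'"
    have "(l - l') * (z * l * l' - 1) = 0"
      using 1 nz(2,3) nz'(3) by (simp add: field_simps)
    then have 3: "z * l * l' = 1" using ne by simp
    have "z * ((l - l') * (z * (z * l * l') - 1)) = 0"
      using 2 nz(2,3) nz'(3) by (simp add: field_simps)
    then have "z = 1" using ne nz(2) unfolding 3 by simp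
    then show False using nz(5) by simp
  qed
  then show ?thesis using k y z by simp
qed

theorem theorem6p3:
  fixes n :: nat and \<rho> :: "wb_gen word set \<Rightarrow> complex mat"
  assumes "n \<ge> 9 \<or> n = 7"
    and "\<rho> \<in> hom (WB n) (GL n)"
    and "irreducible_rep (WB n\<lparr>carrier := braid_subgroup n\<rparr>) n \<rho>"
  shows "\<exists>!(y, k, z, l).
           y \<noteq> 0 \<and> z \<noteq> 0 \<and> l \<noteq> 0 \<and> z \<noteq> 1 \<and> k \<in> {-1, 1} \<and>
           equivalent_reps (WB n) n \<rho> (tensor_char (X_rep y k) (tau_rep n z l))"
proof -
  have n: "7 \<le> n" "3 \<le> n" using assms(1) by auto
  obtain y k z l where yk: "y \<noteq> 0" "z \<noteq> 0" "l \<noteq> 0" "z \<noteq> 1" "k \<in> {-1, 1}"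
    "equivalent_reps (WB n) n \<rho> (tensor_char (X_rep y k) (tau_rep n z l))"
    using equivalent_tensor_tau_exists[OF n(1) assms(2,3)] by blast
  show ?thesis
  proof (rule ex1I[of _ "(y, k, z, l)"])
    fix q
    assume q: "case q of (y, k, z, l) \<Rightarrow> y \<noteq> 0 \<and> z \<noteq> 0 \<and> l \<noteq> 0 \<and> z \<noteq> 1 \<and> k \<in> {-1, 1} \<and>
           equivalent_reps (WB n) n \<rho> (tensor_char (X_rep y k) (tau_rep n z l))"
    obtain y' k' z' l' where q': "q = (y', k', z', l')" by (cases q) auto
    then show "q = (y, k, z, l)"
      using tensor_tau_parameters_unique[OF n(2) assms(2) yk(1-3,5,4) _ _ _ _ yk(6), of y' z' l' k'] q by simp
  qed (use yk in simp)
qed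

end
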